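(* Let $G$ be the fundamental group of a finite graph of groups $(\mathcal{G},\Gamma)$ and let $N \lhd G$ be a finitely generated virtually abelian normal subgroup such that all of the following conditions are satisfied: (a) $\alpha_e(G_e) = N$ in $G$, for every edge $e \in E\Gamma$; (b) $G_v$ has (LR), for all $v \in V\Gamma$; (c) the natural homomorphism $G \to \mathrm{Out}(N)$ has finite image. Then $G$ has (LR).
   Context: A subgroup $H$ of a group $G$ is a virtual retract of $G$ if there is a finite index subgroup $K$ of $G$ such that $H \subseteq K$ and there is a homomorphism $\rho: K \to H$ whose restriction to $H$ is the identity map. A group $G$ has property (LR) if every finitely generated subgroup of $G$ is a virtual retract of $G$. For a normal subgroup $N$ of $G$, the natural homomorphism $G \to \mathrm{Out}(N) = \mathrm{Aut}(N)/\mathrm{Inn}(N)$ is the composition of the conjugation action $G \to \mathrm{Aut}(N)$ with the quotient map $\mathrm{Aut}(N) \to \mathrm{Out}(N)$. Graphs are in the sense of Serre: a graph $\Gamma$ has a vertex set $V\Gamma$, an edge set $E\Gamma$, an inversion map $e \mapsto \overline{e}$ on $E\Gamma$ with $\overline{e} \ne e$ and $\overline{\overline{e}} = e$, and incidence maps $\alpha,\omega: E\Gamma \to V\Gamma$ with $\omega(\overline{e}) = \alpha(e)$. An orientation is a decomposition $E\Gamma = E\Gamma^+ \sqcup E\Gamma^-$ with $E\Gamma^- = \{\overline{e} \mid e \in E\Gamma^+\}$. A finite graph of groups $(\mathcal{G},\Gamma)$ consists of a non-empty finite connected graph $\Gamma$, vertex groups $G_v$ ($v \in V\Gamma$), edge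 groups $G_e$ ($e \in E\Gamma$) with $G_e = G_{\overline{e}}$, and monomorphisms $\alpha_e: G_e \to G_{\alpha(e)}$ ($e \in E\Gamma$); put $\omega_e := \alpha_{\overline{e}}: G_e \to G_{\omega(e)}$. Given a maximal tree $T$ in $\Gamma$ and an orientation, its fundamental group is the group generated by all $G_v$, $v \in V\Gamma$, and free letters $t_e$, $e \in E\Gamma^+$, subject to the relations of the vertex groups, $t_e\, \omega_e(a)\, t_e^{-1} = \alpha_e(a)$ for all $e \in E\Gamma^+$, $a \in G_e$, and $t_f = 1$ for all $f \in ET \cap E\Gamma^+$; up to isomorphism it does not depend on the choices. The vertex groups embed naturally in the fundamental group $G$ and are treated as subgroups of $G$; so $\alpha_e(G_e) \leqslant G_{\alpha(e)} \leqslant G$. *)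

theory Defs
  imports
    "HOL-Algebra.Bij"
    "HOL-Algebra.Generated_Groups"
    "Graph_Theory.Digraph_Component"
    "Graph_Theory.Bidirected_Digraph"
begin

section \<open>Property (LR)\<close>

definition finite_index :: "('g, 'm) monoid_scheme \<Rightarrow> 'g set \<Rightarrow> bool" where
  "finite_index G K \<longleftrightarrow> subgroup K G \<and> finite (rcosets\<^bsub>G\<^esub> K)"

definition fg_subgroup :: "('g, 'm) monoid_scheme \<Rightarrow> 'g set \<Rightarrow> bool" where
  "fg_subgroup G H \<longleftrightarrow> subgroup H G \<and> (\<exists>S. finite S \<and> S \<subseteq> H \<and> generate G S = H)"

definition virtually_abelian :: "('g, 'm) monoid_scheme \<Rightarrow> bool" where
  "virtually_abelian G \<longleftrightarrow> (\<exists>A. finite_index G A \<and> comm_group (G\<lparr>carrier := A\<rparr>))"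

definition virtual_retract :: "('g, 'm) monoid_scheme \<Rightarrow> 'g set \<Rightarrow> bool" where
  "virtual_retract G H \<longleftrightarrow> subgroup H G \<and>
     (\<exists>K \<rho>. finite_index G K \<and> H \<subseteq> K \<and>
        \<rho> \<in> hom (G\<lparr>carrier := K\<rparr>) (G\<lparr>carrier := H\<rparr>) \<and> (\<forall>h\<in>H. \<rho> h = h))"

definition property_LR :: "('g, 'm) monoid_scheme \<Rightarrow> bool" where
  "property_LR G \<longleftrightarrow> (\<forall>H. fg_subgroup G H \<longrightarrow> virtual_retract G H)"


section \<open>The natural homomorphism to the outer automorphism group\<close>

definition conj_act :: "('g, 'm) monoid_scheme \<Rightarrow> 'g set \<Rightarrow> 'g \<Rightarrow> 'g \<Rightarrow> 'g" where
  "conj_act G N g = (\<lambda>x\<in>N. g \<otimes>\<^bsub>G\<^esub> x \<otimes>\<^bsub>G\<^esub> inv\<^bsub>G\<^esub> g)"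

definition Inn :: "('g, 'm) monoid_scheme \<Rightarrow> ('g \<Rightarrow> 'g) set" where
  "Inn H = conj_act H (carrier H) ` carrier H"

definition Out :: "('g, 'm) monoid_scheme \<Rightarrow> ('g \<Rightarrow> 'g) set monoid" where
  "Out H = AutoGroup H Mod Inn H"

definition to_Out :: "('g, 'm) monoid_scheme \<Rightarrow> 'g set \<Rightarrow> 'g \<Rightarrow> ('g \<Rightarrow> 'g) set" where
  "to_Out G N g = Inn (G\<lparr>carrier := N\<rparr>) #>\<^bsub>AutoGroup (G\<lparr>carrier := N\<rparr>)\<^esub> conj_act G N g"

lemma conj_act_hom:
  assumes "N \<lhd> G"
  shows "conj_act G N \<in> hom G (AutoGroup (G\<lparr>carrier := N\<rparr>))"
proof -
  interpret N: normal N G by fact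
  have mem: "g \<otimes>\<^bsub>G\<^esub> x \<otimes>\<^bsub>G\<^esub> inv\<^bsub>G\<^esub> g \<in> N" if "g \<in> carrier G" "x \<in> N" for g x
    using that N.inv_op_closed2 by blast
  have canc: "g \<otimes>\<^bsub>G\<^esub> (inv\<^bsub>G\<^esub> g \<otimes>\<^bsub>G\<^esub> x \<otimes>\<^bsub>G\<^esub> inv\<^bsub>G\<^esub> (inv\<^bsub>G\<^esub> g)) \<otimes>\<^bsub>G\<^esub> inv\<^bsub>G\<^esub> g = x"
    if "g \<in> carrier G" "x \<in> N" for g x
    using that N.mem_carrier[OF that(2)]
    by (simp add: N.m_assoc) (simp add: N.m_assoc[symmetric])
  have bij: "conj_act G N g \<in> Bij N" if g: "g \<in> carrier G" for g
  proof -
    have "bij_betw (conj_act G N g) N N"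
    proof (rule bij_betwI[where g = "conj_act G N (inv\<^bsub>G\<^esub> g)"])
      show "conj_act G N g \<in> N \<rightarrow> N" "conj_act G N (inv\<^bsub>G\<^esub> g) \<in> N \<rightarrow> N"
        using g mem[of g] mem[of "inv\<^bsub>G\<^esub> g"] by (auto simp: conj_act_def simp del: N.inv_inv)
      show "conj_act G N (inv\<^bsub>G\<^esub> g) (conj_act G N g x) = x" if "x \<in> N" for x
        using g that mem[OF g that] canc[of "inv\<^bsub>G\<^esub> g" x] by (simp add: conj_act_def)
      show "conj_act G N g (conj_act G N (inv\<^bsub>G\<^esub> g) y) = y" if "y \<in> N" for y
        using g that mem[of "inv\<^bsub>G\<^esub> g" y] canc[of g y] by (simp add: conj_act_def)
    qed
    then show ?thesis by (simp add: Bij_def conj_act_def)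
  qed
  have hom: "conj_act G N g \<in> hom (G\<lparr>carrier := N\<rparr>) (G\<lparr>carrier := N\<rparr>)" if g: "g \<in> carrier G" for g
  proof (rule homI)
    fix x y assume "x \<in> carrier (G\<lparr>carrier := N\<rparr>)" "y \<in> carrier (G\<lparr>carrier := N\<rparr>)"
    then have xy: "x \<in> N" "y \<in> N" by auto
    have [simp]: "x \<in> carrier G" "y \<in> carrier G" using xy N.mem_carrier by auto
    have "inv\<^bsub>G\<^esub> g \<otimes>\<^bsub>G\<^esub> (g \<otimes>\<^bsub>G\<^esub> z) = z" if "z \<in> carrier G" for z
      using g that by (simp add: N.m_assoc[symmetric])
    then show "conj_act G N g (x \<otimes>\<^bsub>G\<lparr>carrier := N\<rparr>\<^esub> y) =
        conj_act G N g x \<otimes>\<^bsub>G\<lparr>carrier := N\<rparr>\<^esub> conj_act G N g y"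
      using g xy by (simp add: conj_act_def N.m_assoc)
  qed (use g mem in \<open>auto simp: conj_act_def\<close>)
  show ?thesis
  proof (rule homI)
    show "conj_act G N g \<in> carrier (AutoGroup (G\<lparr>carrier := N\<rparr>))" if "g \<in> carrier G" for g
      using that bij hom by (simp add: AutoGroup_def auto_def)
    fix g h assume gh: "g \<in> carrier G" "h \<in> carrier G"
    have "conj_act G N (g \<otimes>\<^bsub>G\<^esub> h) = compose N (conj_act G N g) (conj_act G N h)"
      unfolding compose_def conj_act_def
      by (rule restrict_ext)
        (use gh mem N.mem_carrier in \<open>simp add: N.m_assoc N.inv_mult_group\<close>)
    then show "conj_act G N (g \<otimes>\<^bsub>G\<^esub> h) =
        conj_act G N g \<otimes>\<^bsub>AutoGroup (G\<lparr>carrier := N\<rparr>)\<^esub> conj_act G N h"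
      using gh bij by (simp add: AutoGroup_def BijGroup_def)
  qed
qed

lemma Inn_normal:
  assumes "group H"
  shows "Inn H \<lhd> AutoGroup H"
proof -
  interpret H: group H by fact
  interpret A: group "AutoGroup H" by (rule H.AutoGroup)
  have H: "H\<lparr>carrier := carrier H\<rparr> = H" by simp
  have "carrier H \<lhd> H" using H.normal_inv_iff H.subgroup_self by auto
  from conj_act_hom[OF this] have c: "conj_act H (carrier H) \<in> hom H (AutoGroup H)"
    by (simp add: H)
  interpret c: group_hom H "AutoGroup H" "conj_act H (carrier H)"
    using c by unfold_locales
  have "subgroup (Inn H) (AutoGroup H)"
    unfolding Inn_def by (rule c.img_is_subgroup)
  moreover have "f \<otimes>\<^bsub>AutoGroup H\<^esub> k \<otimes>\<^bsub>AutoGroup H\<^esub> inv\<^bsub>AutoGroup H\<^esub> f \<in> Inn H"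
    if f: "f \<in> carrier (AutoGroup H)" and k: "k \<in> Inn H" for f k
  proof -
    from k obtain h where h: "h \<in> carrier H" "k = conj_act H (carrier H) h"
      unfolding Inn_def by auto
    have fA: "f \<in> hom H H" "f \<in> Bij (carrier H)"
      using f by (auto simp: AutoGroup_def auto_def)
    interpret f: group_hom H H f using fA by unfold_locales
    have fh: "f h \<in> carrier H" using h by simp
    have kA: "k \<in> carrier (AutoGroup H)" and fhA: "conj_act H (carrier H) (f h) \<in> carrier (AutoGroup H)"
      using h fh by auto
    have B: "g \<in> Bij (carrier H)" if "g \<in> carrier (AutoGroup H)" for g
      using that by (auto simp: AutoGroup_def auto_def)
    have "f \<otimes>\<^bsub>AutoGroup H\<^esub> k = conj_act H (carrier H) (f h) \<otimes>\<^bsub>AutoGroup H\<^esub> f"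
      using fA B[OF kA] B[OF fhA] h fh
      by (auto simp: AutoGroup_def BijGroup_def compose_def conj_act_def intro!: restrict_ext)
    then have "f \<otimes>\<^bsub>AutoGroup H\<^esub> k \<otimes>\<^bsub>AutoGroup H\<^esub> inv\<^bsub>AutoGroup H\<^esub> f = conj_act H (carrier H) (f h)"
      using f fhA by (simp add: A.m_assoc)
    then show ?thesis using fh by (auto simp: Inn_def)
  qed
  ultimately show ?thesis by (simp add: A.normal_inv_iff)
qed

lemma to_Out_hom:
  assumes "N \<lhd> G"
  shows "to_Out G N \<in> hom G (Out (G\<lparr>carrier := N\<rparr>))"
proof -
  interpret N: normal N G by fact
  have "group (G\<lparr>carrier := N\<rparr>)" using N.is_subgroup N.subgroup_imp_group by blast
  then interpret I: normal "Inn (G\<lparr>carrier := N\<rparr>)" "AutoGroup (G\<lparr>carrier := N\<rparr>)"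
    by (rule Inn_normal)
  have "(\<lambda>f. Inn (G\<lparr>carrier := N\<rparr>) #>\<^bsub>AutoGroup (G\<lparr>carrier := N\<rparr>)\<^esub> f) \<circ> conj_act G N
      \<in> hom G (Out (G\<lparr>carrier := N\<rparr>))"
    unfolding Out_def using conj_act_hom[OF assms] I.r_coset_hom_Mod by (rule hom_compose)
  moreover have "(\<lambda>f. Inn (G\<lparr>carrier := N\<rparr>) #>\<^bsub>AutoGroup (G\<lparr>carrier := N\<rparr>)\<^esub> f) \<circ> conj_act G N = to_Out G N"
    by (auto simp: to_Out_def)
  ultimately show ?thesis by simp
qed


section \<open>Groups given by generators and relators\<close>

text \<open>
  The letter \<open>(x, True)\<close> stands for the generator \<open>x\<close> and \<open>(x, False)\<close> for its formal
  inverse.  Elements of the presented group are classes of words, and two words are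
  equivalent if they are joined by insertions and deletions of \<open>x x\<^sup>-\<^sup>1\<close>, \<open>x\<^sup>-\<^sup>1 x\<close>
  and of relators; this is the quotient of the free group on \<open>X\<close> by the normal closure
  of \<open>R\<close>.
\<close>

type_synonym 'x word = "('x \<times> bool) list"

definition words :: "'x set \<Rightarrow> 'x word set" where
  "words X = lists (X \<times> UNIV)"

inductive word_eq :: "'x set \<Rightarrow> 'x word set \<Rightarrow> 'x word \<Rightarrow> 'x word \<Rightarrow> bool"
  for X :: "'x set" and R :: "'x word set" where
  refl: "u \<in> words X \<Longrightarrow> word_eq X R u u"
| sym: "word_eq X R u w \<Longrightarrow> word_eq X R w u"
| trans: "word_eq X R u v \<Longrightarrow> word_eq X R v w \<Longrightarrow> word_eq X R u w"
| cancel: "u \<in> words X \<Longrightarrow> w \<in> words X \<Longrightarrow> x \<in> X \<Longrightarrow>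
    word_eq X R (u @ [(x, b), (x, \<not> b)] @ w) (u @ w)"
| relator: "u \<in> words X \<Longrightarrow> w \<in> words X \<Longrightarrow> r \<in> R \<inter> words X \<Longrightarrow>
    word_eq X R (u @ r @ w) (u @ w)"

definition word_class :: "'x set \<Rightarrow> 'x word set \<Rightarrow> 'x word \<Rightarrow> 'x word set" where
  "word_class X R u = {w. word_eq X R u w}"

definition presented_group :: "'x set \<Rightarrow> 'x word set \<Rightarrow> 'x word set monoid" where
  "presented_group X R =
     \<lparr>carrier = word_class X R ` words X,
      monoid.mult = (\<lambda>A B. \<Union>a\<in>A. \<Union>b\<in>B. word_class X R (a @ b)),
      monoid.one = word_class X R []\<rparr>"

lemma word_eq_words: "word_eq X R u w \<Longrightarrow> u \<in> words X \<and> w \<in> words X"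
  by (induction rule: word_eq.induct) (auto simp: words_def)

lemma append_in_words [simp]: "u @ w \<in> words X \<longleftrightarrow> u \<in> words X \<and> w \<in> words X"
  by (auto simp: words_def)

lemma Nil_in_words [simp]: "[] \<in> words X"
  by (simp add: words_def)

lemma word_eq_append_left:
  "word_eq X R u w \<Longrightarrow> a \<in> words X \<Longrightarrow> word_eq X R (a @ u) (a @ w)"
proof (induction rule: word_eq.induct)
  case (cancel u w x b)
  then show ?case using word_eq.cancel[of "a @ u" X w x R b] by simp
next
  case (relator u w r)
  then show ?case using word_eq.relator[of "a @ u" X w r R] by simp
qed (auto intro: word_eq.refl word_eq.sym word_eq.trans)

lemma word_eq_append_right:
  "word_eq X R u w \<Longrightarrow> a \<in> words X \<Longrightarrow> word_eq X R (u @ a) (w @ a)"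
proof (induction rule: word_eq.induct)
  case (cancel u w x b)
  then show ?case using word_eq.cancel[of u X "w @ a" x R b] by simp
next
  case (relator u w r)
  then show ?case using word_eq.relator[of u X "w @ a" r R] by simp
qed (auto intro: word_eq.refl word_eq.sym word_eq.trans)

lemma word_eq_append:
  assumes "word_eq X R u u'" "word_eq X R w w'"
  shows "word_eq X R (u @ w) (u' @ w')"
  using assms word_eq_append_left word_eq_append_right word_eq_words word_eq.trans by metis

lemma word_class_eq_iff:
  assumes "u \<in> words X"
  shows "word_class X R u = word_class X R w \<longleftrightarrow> word_eq X R u w"
proof
  assume "word_class X R u = word_class X R w"
  then show "word_eq X R u w"
    using word_eq.refl[OF assms] by (auto simp: word_class_def intro: word_eq.sym)
qed (auto simp: word_class_def intro: word_eq.sym word_eq.trans)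

lemma mult_presented_group:
  assumes "u \<in> words X" "w \<in> words X"
  shows "word_class X R u \<otimes>\<^bsub>presented_group X R\<^esub> word_class X R w = word_class X R (u @ w)"
  using assms
  by (auto simp: presented_group_def word_class_def
      intro: word_eq.refl word_eq.trans word_eq_append)

lemma word_inverse:
  "u \<in> words X \<Longrightarrow> \<exists>w\<in>words X. word_eq X R (w @ u) []"
proof (induction u)
  case Nil
  then show ?case by (intro bexI[of _ "[]"]) (auto intro: word_eq.refl)
next
  case (Cons a u)
  obtain x b where a: "a = (x, b)" by force
  have x: "x \<in> X" and u: "u \<in> words X" using Cons.prems a by (auto simp: words_def)
  obtain w where w: "w \<in> words X" "word_eq X R (w @ u) []" using Cons.IH u by blast
  have "word_eq X R (w @ [(x, \<not> b), (x, \<not> \<not> b)] @ u) (w @ u)"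
    using w(1) u x by (rule word_eq.cancel)
  then have "word_eq X R ((w @ [(x, \<not> b)]) @ a # u) []"
    using w(2) a by (auto intro: word_eq.trans)
  moreover have "w @ [(x, \<not> b)] \<in> words X" using w x by (auto simp: words_def)
  ultimately show ?case by blast
qed

theorem group_presented_group: "group (presented_group X R)"
proof (rule groupI)
  let ?P = "presented_group X R"
  have car: "carrier ?P = word_class X R ` words X" and one: "\<one>\<^bsub>?P\<^esub> = word_class X R []"
    by (simp_all add: presented_group_def)
  show "\<one>\<^bsub>?P\<^esub> \<in> carrier ?P" by (auto simp: car one)
  show "A \<otimes>\<^bsub>?P\<^esub> B \<in> carrier ?P" if "A \<in> carrier ?P" "B \<in> carrier ?P" for A B
    using that by (auto simp: car mult_presented_group)
  show "A \<otimes>\<^bsub>?P\<^esub> B \<otimes>\<^bsub>?P\<^esub> C = A \<otimes>\<^bsub>?P\<^esub> (B \<otimes>\<^bsub>?P\<^esub> C)"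
    if "A \<in> carrier ?P" "B \<in> carrier ?P" "C \<in> carrier ?P" for A B C
    using that by (auto simp: car mult_presented_group)
  show "\<one>\<^bsub>?P\<^esub> \<otimes>\<^bsub>?P\<^esub> A = A" if "A \<in> carrier ?P" for A
    using that by (auto simp: car one mult_presented_group)
  show "\<exists>B\<in>carrier ?P. B \<otimes>\<^bsub>?P\<^esub> A = \<one>\<^bsub>?P\<^esub>" if A: "A \<in> carrier ?P" for A
  proof -
    from A obtain u where u: "u \<in> words X" "A = word_class X R u" by (auto simp: car)
    then obtain w where "w \<in> words X" "word_eq X R (w @ u) []" using word_inverse by blast
    then show ?thesis using u
      by (intro bexI[of _ "word_class X R w"]) (auto simp: car one mult_presented_group word_class_eq_iff)
  qed
qed


section \<open>Graphs of groups\<close>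

text \<open>
  A Serre graph is a \<^locale>\<open>bidirected_digraph\<close>: \<open>tail\<close>, \<open>head\<close> and \<open>bar\<close> are
  the maps \<open>\<alpha>\<close>, \<open>\<omega>\<close> and the inversion.  That locale also fixes \<open>bar e = e\<close> for \<open>e\<close>
  outside the edge set.
\<close>

locale graph_of_groups = fin_digraph \<Gamma> + bidirected_digraph \<Gamma> bar
  for \<Gamma> :: "('v, 'e) pre_digraph" and bar :: "'e \<Rightarrow> 'e" +
  fixes Gv :: "'v \<Rightarrow> 'a monoid" and Ge :: "'e \<Rightarrow> 'b monoid" and \<alpha> :: "'e \<Rightarrow> 'b \<Rightarrow> 'a"
  assumes connected: "Digraph_Component.connected \<Gamma>"
    and group_Gv: "v \<in> verts \<Gamma> \<Longrightarrow> group (Gv v)"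
    and group_Ge: "e \<in> arcs \<Gamma> \<Longrightarrow> group (Ge e)"
    and Ge_bar: "e \<in> arcs \<Gamma> \<Longrightarrow> Ge (bar e) = Ge e"
    and \<alpha>_hom: "e \<in> arcs \<Gamma> \<Longrightarrow> \<alpha> e \<in> hom (Ge e) (Gv (tail \<Gamma> e))"
    and \<alpha>_inj: "e \<in> arcs \<Gamma> \<Longrightarrow> inj_on (\<alpha> e) (carrier (Ge e))"

definition orientation :: "('v, 'e) pre_digraph \<Rightarrow> ('e \<Rightarrow> 'e) \<Rightarrow> 'e set \<Rightarrow> bool" where
  "orientation \<Gamma> bar P \<longleftrightarrow> arcs \<Gamma> = P \<union> bar ` P \<and> P \<inter> bar ` P = {}"

text \<open>
  A cycle in the sense of \<^theory>\<open>Graph_Theory.Arc_Walk\<close> may be of the form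
  \<open>[e, bar e]\<close>, so \<^const>\<open>forest\<close> and \<^const>\<open>tree\<close> are of no use for Serre graphs.
  Circuits in Serre's sense are the cycles without backtracking; they may have length 1
  (loops) or 2 (parallel edges).
\<close>

definition serre_tree :: "('e \<Rightarrow> 'e) \<Rightarrow> ('v, 'e) pre_digraph \<Rightarrow> bool" where
  "serre_tree bar T \<longleftrightarrow> bar ` arcs T \<subseteq> arcs T \<and> Digraph_Component.connected T \<and>
     \<not> (\<exists>p. pre_digraph.cycle T p \<and> (\<forall>i. Suc i < length p \<longrightarrow> p ! Suc i \<noteq> bar (p ! i)))"

definition maximal_tree ::
  "('v, 'e) pre_digraph \<Rightarrow> ('e \<Rightarrow> 'e) \<Rightarrow> ('v, 'e) pre_digraph \<Rightarrow> bool" where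
  "maximal_tree \<Gamma> bar T \<longleftrightarrow> pre_digraph.max_subgraph \<Gamma> (serre_tree bar) T"

datatype ('v, 'e, 'a) fg_gen = Elem 'v 'a | Stable 'e

definition fg_gens ::
  "('v, 'e) pre_digraph \<Rightarrow> ('v \<Rightarrow> 'a monoid) \<Rightarrow> 'e set \<Rightarrow> ('v, 'e, 'a) fg_gen set" where
  "fg_gens \<Gamma> Gv P = {Elem v g | v g. v \<in> verts \<Gamma> \<and> g \<in> carrier (Gv v)} \<union> Stable ` P"

text \<open>
  The relators express \<open>g \<cdot> h = gh\<close> in each vertex group, \<open>t\<^sub>e \<omega>\<^sub>e(a) t\<^sub>e\<^sup>-\<^sup>1 = \<alpha>\<^sub>e(a)\<close>
  with \<open>\<omega>\<^sub>e = \<alpha> (bar e)\<close>, and \<open>t\<^sub>f = 1\<close> for the positive edges of the tree.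
\<close>

definition fg_relators ::
  "('v, 'e) pre_digraph \<Rightarrow> ('e \<Rightarrow> 'e) \<Rightarrow> ('v \<Rightarrow> 'a monoid) \<Rightarrow> ('e \<Rightarrow> 'b monoid) \<Rightarrow>
    ('e \<Rightarrow> 'b \<Rightarrow> 'a) \<Rightarrow> ('v, 'e) pre_digraph \<Rightarrow> 'e set \<Rightarrow> ('v, 'e, 'a) fg_gen word set" where
  "fg_relators \<Gamma> bar Gv Ge \<alpha> T P =
     {[(Elem v g, True), (Elem v h, True), (Elem v (g \<otimes>\<^bsub>Gv v\<^esub> h), False)] | v g h.
        v \<in> verts \<Gamma> \<and> g \<in> carrier (Gv v) \<and> h \<in> carrier (Gv v)} \<union>
     {[(Stable e, True), (Elem (head \<Gamma> e) (\<alpha> (bar e) a), True), (Stable e, False),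
       (Elem (tail \<Gamma> e) (\<alpha> e a), False)] | e a. e \<in> P \<and> a \<in> carrier (Ge e)} \<union>
     {[(Stable f, True)] | f. f \<in> arcs T \<inter> P}"

definition fundamental_group ::
  "('v, 'e) pre_digraph \<Rightarrow> ('e \<Rightarrow> 'e) \<Rightarrow> ('v \<Rightarrow> 'a monoid) \<Rightarrow> ('e \<Rightarrow> 'b monoid) \<Rightarrow>
    ('e \<Rightarrow> 'b \<Rightarrow> 'a) \<Rightarrow> ('v, 'e) pre_digraph \<Rightarrow> 'e set \<Rightarrow> ('v, 'e, 'a) fg_gen word set monoid" where
  "fundamental_group \<Gamma> bar Gv Ge \<alpha> T P =
     presented_group (fg_gens \<Gamma> Gv P) (fg_relators \<Gamma> bar Gv Ge \<alpha> T P)"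

definition vertex_emb ::
  "('v, 'e) pre_digraph \<Rightarrow> ('e \<Rightarrow> 'e) \<Rightarrow> ('v \<Rightarrow> 'a monoid) \<Rightarrow> ('e \<Rightarrow> 'b monoid) \<Rightarrow>
    ('e \<Rightarrow> 'b \<Rightarrow> 'a) \<Rightarrow> ('v, 'e) pre_digraph \<Rightarrow> 'e set \<Rightarrow>
    'v \<Rightarrow> 'a \<Rightarrow> ('v, 'e, 'a) fg_gen word set" where
  "vertex_emb \<Gamma> bar Gv Ge \<alpha> T P v g =
     word_class (fg_gens \<Gamma> Gv P) (fg_relators \<Gamma> bar Gv Ge \<alpha> T P) [(Elem v g, True)]"

lemma vertex_emb_hom:
  assumes "graph_of_groups \<Gamma> bar Gv Ge \<alpha>" "v \<in> verts \<Gamma>"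
  shows "vertex_emb \<Gamma> bar Gv Ge \<alpha> T P v \<in> hom (Gv v) (fundamental_group \<Gamma> bar Gv Ge \<alpha> T P)"
proof (rule homI)
  interpret graph_of_groups \<Gamma> bar Gv Ge \<alpha> by fact
  interpret v: group "Gv v" using assms(2) by (rule group_Gv)
  let ?X = "fg_gens \<Gamma> Gv P" and ?R = "fg_relators \<Gamma> bar Gv Ge \<alpha> T P"
  have mem: "[(Elem v g, b)] \<in> words ?X" if "g \<in> carrier (Gv v)" for g b
    using that assms(2) by (auto simp: words_def fg_gens_def)
  show "vertex_emb \<Gamma> bar Gv Ge \<alpha> T P v g \<in> carrier (fundamental_group \<Gamma> bar Gv Ge \<alpha> T P)"
    if "g \<in> carrier (Gv v)" for g
    using mem[OF that, of True] by (auto simp: vertex_emb_def fundamental_group_def presented_group_def)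
  fix g h assume gh: "g \<in> carrier (Gv v)" "h \<in> carrier (Gv v)"
  let ?g = "(Elem v g, True)" and ?h = "(Elem v h, True)" and ?k = "Elem v (g \<otimes>\<^bsub>Gv v\<^esub> h)"
  have k: "g \<otimes>\<^bsub>Gv v\<^esub> h \<in> carrier (Gv v)" using gh by simp
  have "[?g, ?h, (?k, False)] \<in> ?R" using gh assms(2) by (auto simp: fg_relators_def)
  moreover have "[?g, ?h, (?k, False)] \<in> words ?X"
    using mem[OF gh(1)] mem[OF gh(2)] mem[OF k] by (auto simp: words_def)
  ultimately have 1: "word_eq ?X ?R ([] @ [?g, ?h, (?k, False)] @ [(?k, True)]) ([] @ [(?k, True)])"
    using mem[OF k] by (intro word_eq.relator) auto
  have "word_eq ?X ?R ([?g, ?h] @ [(?k, False), (?k, \<not> False)] @ []) ([?g, ?h] @ [])"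
    using mem[OF gh(1)] mem[OF gh(2)] mem[OF k] by (intro word_eq.cancel) (auto simp: words_def)
  then have "word_eq ?X ?R [(?k, True)] [?g, ?h]"
    using 1 by (auto intro: word_eq.sym word_eq.trans)
  then show "vertex_emb \<Gamma> bar Gv Ge \<alpha> T P v (g \<otimes>\<^bsub>Gv v\<^esub> h) =
      vertex_emb \<Gamma> bar Gv Ge \<alpha> T P v g \<otimes>\<^bsub>fundamental_group \<Gamma> bar Gv Ge \<alpha> T P\<^esub>
      vertex_emb \<Gamma> bar Gv Ge \<alpha> T P v h"
    using mem gh k
    by (simp add: vertex_emb_def fundamental_group_def mult_presented_group word_class_eq_iff)
qed

end

(*
  The quotient G/N is generated by the images of the vertex groups and by free stable letters, and
  for a finitely generated subgroup H of G a finite part of its action on the cosets of HN/N can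
  be extended, in the style of Marshall Hall, one vertex group at a time, to a homomorphism from G
  to a wreath product of HN/N with a finite symmetric group; property (LR) of the vertex groups
  provides the finite completions.  The stabiliser of a block is a subgroup K of finite index
  containing H together with a homomorphism from K onto HN/N that is the projection on H.

  To lift this to H, retractions of the vertex groups onto N are induced up to homomorphisms into
  a wreath product of N with a finite symmetric group.  Since the image of G in Out(N) is finite,
  they can be made to agree on N and be extended to the stable letters, which gives a homomorphism
  phi from G, injective on N, to a finitely generated virtually abelian group.  Maschke's theorem
  yields a complement B, up to finite index, of the intersection of phi(H) and the abelian part
  that is invariant under phi(H).  The elements k of K for which some h in H has the same image in
  HN/N and satisfies phi(k) in phi(h) B form a subgroup of finite index that retracts onto H
  by k -> h.
*)

theory Submission
  imports Defs "HOL-Algebra.FiniteProduct"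
begin

section \<open>Subgroups of finite index\<close>

text \<open>Property (LR) is not established for \<open>G/N\<close> or for the quotients of the
  vertex groups. The completions apply it inside a vertex group to finitely generated subgroups
  containing \<open>N\<close>, which exist because \<open>N\<close> is finitely generated, and only
  then pass to the quotient. A virtual retraction onto HN/N does not suffice: its values lift to H
  only up to H \<inter> N, and a homomorphism that is faithful on \<open>N\<close> has to select the
  lift consistently. Retractions of different vertex groups onto \<open>N\<close> induce actions of
  \<open>N\<close> that are twisted by different outer classes; a finite image in Out(N) allows a
  finite set of blocks in which every class occurs equally often. That \<open>N\<close> is virtually
  abelian is used for the averaging that makes a complement invariant under H. The group enters both
  constructions only through its generators and its universal property for wreath products. The
  embedding of the vertex groups, through which they inherit (LR) as subgroups, comes from a
  permutation representation.\<close>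

lemma (in group) inv_cancel_left:
  assumes "x \<in> carrier G" "y \<in> carrier G"
  shows "inv x \<otimes> (x \<otimes> y) = y" "x \<otimes> (inv x \<otimes> y) = y"
  using assms by (simp_all flip: m_assoc)

lemmas (in group) group_simps = m_assoc inv_mult_group inv_cancel_left

lemma finite_index_subgroup: "finite_index G K \<Longrightarrow> subgroup K G"
  by (simp add: finite_index_def)

text \<open>\<open>f\<close> separates the right cosets of \<open>K\<close>, so the coset of
  \<open>x\<close> is a function \<open>F\<close> of \<open>f x\<close> and there are no more cosets
  than values of \<open>f\<close>. Most finite index claims below amount to exhibiting such an
  \<open>f\<close>.\<close>

lemma (in group) finite_indexI:
  assumes K: "subgroup K G" and fin: "finite (f ` carrier G)"
    and f: "\<And>x y. x \<in> carrier G \<Longrightarrow> y \<in> carrier G \<Longrightarrow> f x = f y \<Longrightarrow> x \<otimes> inv y \<in> K"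
  shows "finite_index G K"
proof -
  interpret K: subgroup K G by fact
  define F where "F c = K #> (SOME x. x \<in> carrier G \<and> f x = c)" for c
  have "K #> x = F (f x)" if x: "x \<in> carrier G" for x
  proof -
    define y where "y = (SOME y. y \<in> carrier G \<and> f y = f x)"
    have y: "y \<in> carrier G" "f y = f x"
      using someI[of "\<lambda>y. y \<in> carrier G \<and> f y = f x" x] x by (auto simp: y_def)
    have "x \<otimes> inv y \<in> K" using f[OF x y(1)] y(2) by simp
    moreover have "x = (x \<otimes> inv y) \<otimes> y" using x y by (simp add: m_assoc)
    ultimately have "x \<in> K #> y" by (auto simp: r_coset_def)
    then have "K #> y = K #> x" using repr_independence[OF _ y(1) K] by simp
    then show ?thesis by (simp add: F_def y_def)
  qed
  then have "rcosets K \<subseteq> F ` (f ` carrier G)" by (auto simp: RCOSETS_def)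
  then show ?thesis using fin K by (auto simp: finite_index_def intro: finite_subset)
qed

lemma (in group) finite_index_cosets:
  assumes "finite_index G K" shows "finite ((\<lambda>x. K #> x) ` carrier G)"
  using assms by (auto simp: finite_index_def RCOSETS_def UNION_singleton_eq_range)

lemma (in group) rcos_eqD:
  assumes "subgroup K G" "x \<in> carrier G" "y \<in> carrier G" "K #> x = K #> y"
  shows "x \<otimes> inv y \<in> K"
  using rcos_self[OF assms(2,1)] assms
  by (metis subgroup.rcos_module_imp is_group)

lemma (in group) rcos_eqI:
  assumes "subgroup K G" "x \<in> carrier G" "y \<in> carrier G" "x \<otimes> inv y \<in> K"
  shows "K #> x = K #> y"
proof -
  have "x \<in> K #> y" using subgroup.rcos_module_rev[OF assms(1) is_group assms(3,2,4)] .
  then show ?thesis using repr_independence[OF _ assms(3,1)] by simp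
qed

lemma (in group) finite_index_Int:
  assumes "finite_index G K" "finite_index G L"
  shows "finite_index G (K \<inter> L)"
proof (rule finite_indexI[where f = "\<lambda>x. (K #> x, L #> x)"])
  show "subgroup (K \<inter> L) G"
    using assms by (intro subgroups_Inter_pair finite_index_subgroup)
  show "finite ((\<lambda>x. (K #> x, L #> x)) ` carrier G)"
    by (rule finite_subset[OF _ finite_cartesian_product[OF assms[THEN finite_index_cosets]]]) auto
  show "x \<otimes> inv y \<in> K \<inter> L"
    if "x \<in> carrier G" "y \<in> carrier G" "(K #> x, L #> x) = (K #> y, L #> y)" for x y
    using that rcos_eqD assms[THEN finite_index_subgroup] by auto
qed

lemma (in group) finite_index_carrier: "finite_index G (carrier G)"
  by (rule finite_indexI[where f = "\<lambda>_. ()"]) (auto intro: subgroup_self)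

lemma (in group) finite_index_INT:
  assumes "finite S" "\<And>s. s \<in> S \<Longrightarrow> finite_index G (K s)"
  shows "finite_index G {x \<in> carrier G. \<forall>s\<in>S. x \<in> K s}"
  using assms
proof (induction S)
  case empty
  then show ?case using finite_index_carrier by simp
next
  case (insert s S)
  have "{x \<in> carrier G. \<forall>r\<in>insert s S. x \<in> K r} = K s \<inter> {x \<in> carrier G. \<forall>s\<in>S. x \<in> K s}"
    using finite_index_subgroup[OF insert.prems[of s]] by (auto dest: subgroup.mem_carrier)
  then show ?case using insert by (simp add: finite_index_Int)
qed

lemma (in group_hom) finite_index_vimage:
  assumes "finite_index H L"
  shows "finite_index G {x \<in> carrier G. h x \<in> L}"
proof -
  interpret L: subgroup L H using assms by (rule finite_index_subgroup)
  show ?thesis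
  proof (rule G.finite_indexI[where f = "\<lambda>x. L #>\<^bsub>H\<^esub> h x"])
    show "subgroup {x \<in> carrier G. h x \<in> L} G"
      by (rule G.subgroupI) auto
    show "finite ((\<lambda>x. L #>\<^bsub>H\<^esub> h x) ` carrier G)"
      by (rule finite_subset[OF _ H.finite_index_cosets[OF assms]]) auto
    show "x \<otimes>\<^bsub>G\<^esub> inv\<^bsub>G\<^esub> y \<in> {x \<in> carrier G. h x \<in> L}"
      if "x \<in> carrier G" "y \<in> carrier G" "L #>\<^bsub>H\<^esub> h x = L #>\<^bsub>H\<^esub> h y" for x y
      using H.rcos_eqD[OF L.subgroup_axioms _ _ that(3)] that by auto
  qed
qed

lemma r_coset_restrict [simp]: "K #>\<^bsub>G\<lparr>carrier := A\<rparr>\<^esub> x = K #>\<^bsub>G\<^esub> x"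
  by (simp add: r_coset_def)

lemma (in group) finite_index_restrict:
  assumes "finite_index G K" "subgroup L G"
  shows "finite_index (G\<lparr>carrier := L\<rparr>) (K \<inter> L)"
proof -
  interpret L: group "G\<lparr>carrier := L\<rparr>" using assms(2) by (rule subgroup_imp_group)
  interpret i: group_hom "G\<lparr>carrier := L\<rparr>" G "\<lambda>x. x"
    using assms(2) subgroup.mem_carrier
    by unfold_locales (auto simp: hom_def)
  have "{x \<in> carrier (G\<lparr>carrier := L\<rparr>). x \<in> K} = K \<inter> L" by auto
  then show ?thesis using i.finite_index_vimage[OF assms(1)] by simp
qed

text \<open>With \<open>r\<close> choosing a representative of each coset of \<open>K\<close>, an
  element \<open>x\<close> is determined modulo \<open>L\<close> by its coset \<open>K x\<close>
  together with the coset modulo \<open>L\<close> of the element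
  \<open>x \<otimes> inv (r (K #> x))\<close> of \<open>K\<close>. Both range over finite
  sets.\<close>

lemma (in group) finite_index_trans:
  assumes K: "finite_index G K" and L: "finite_index (G\<lparr>carrier := K\<rparr>) L"
  shows "finite_index G L"
proof -
  interpret K: subgroup K G using K by (rule finite_index_subgroup)
  interpret KG: group "G\<lparr>carrier := K\<rparr>" by (rule subgroup_imp_group) (rule K.subgroup_axioms)
  have LG: "subgroup L G"
    using incl_subgroup[OF K.subgroup_axioms] finite_index_subgroup[OF L] by simp
  define r where "r C = (SOME x. x \<in> carrier G \<and> K #> x = C)" for C
  have r: "r (K #> x) \<in> carrier G" "K #> r (K #> x) = K #> x" if "x \<in> carrier G" for x
    using someI[of "\<lambda>y. y \<in> carrier G \<and> K #> y = K #> x" x] that by (auto simp: r_def)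
  have xr: "x \<otimes> inv (r (K #> x)) \<in> K" if "x \<in> carrier G" for x
    using that r[OF that] by (intro rcos_eqD K.subgroup_axioms) auto
  let ?f = "\<lambda>x. (K #> x, L #> (x \<otimes> inv (r (K #> x))))"
  show ?thesis
  proof (rule finite_indexI[where f = ?f])
    show "subgroup L G" by (rule LG)
    have "finite ((\<lambda>x. L #> x) ` K)" using KG.finite_index_cosets[OF L] by simp
    from finite_cartesian_product[OF finite_index_cosets[OF K] this]
    show "finite (?f ` carrier G)"
      by (rule finite_subset[rotated]) (use xr in auto)
    show "x \<otimes> inv y \<in> L" if xy: "x \<in> carrier G" "y \<in> carrier G" and "?f x = ?f y" for x y
    proof -
      let ?c = "r (K #> y)"
      have c: "?c \<in> carrier G" using r xy by simp
      have "(x \<otimes> inv ?c) \<otimes> inv (y \<otimes> inv ?c) \<in> L"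
        using rcos_eqD[OF LG, of "x \<otimes> inv ?c" "y \<otimes> inv ?c"] that c by auto
      moreover have "(x \<otimes> inv ?c) \<otimes> inv (y \<otimes> inv ?c) = x \<otimes> inv y"
        using xy c by (simp add: group_simps)
      ultimately show ?thesis by simp
    qed
  qed
qed

text \<open>\<open>?M\<close> is the kernel of the action by right translation on the finitely many
  cosets of \<open>K\<close>, so its index is at most the number of self-maps of that set.\<close>

lemma (in group) finite_index_normal_core:
  assumes "finite_index G K"
  obtains M where "M \<lhd> G" "finite_index G M" "M \<subseteq> K"
proof
  interpret K: subgroup K G using assms by (rule finite_index_subgroup)
  let ?M = "{g \<in> carrier G. \<forall>x\<in>carrier G. x \<otimes> g \<otimes> inv x \<in> K}"
  have sub: "subgroup ?M G"
  proof (rule subgroupI)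
    fix a b assume a: "a \<in> ?M" and b: "b \<in> ?M"
    have "x \<otimes> (a \<otimes> b) \<otimes> inv x = (x \<otimes> a \<otimes> inv x) \<otimes> (x \<otimes> b \<otimes> inv x)" if "x \<in> carrier G" for x
      using a b that by (simp add: group_simps)
    then show "a \<otimes> b \<in> ?M" using a b by auto
    have "x \<otimes> inv a \<otimes> inv x = inv (x \<otimes> a \<otimes> inv x)" if "x \<in> carrier G" for x
      using a that by (simp add: m_assoc inv_mult_group)
    then show "inv a \<in> ?M" using a by auto
  qed (auto intro!: exI[of _ "\<one>"])
  show "?M \<lhd> G"
  proof (rule normal_invI[OF sub])
    fix x h assume x: "x \<in> carrier G" and h: "h \<in> ?M"
    have "y \<otimes> (x \<otimes> h \<otimes> inv x) \<otimes> inv y = (y \<otimes> x) \<otimes> h \<otimes> inv (y \<otimes> x)" if "y \<in> carrier G" for y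
      using x h that by (simp add: m_assoc inv_mult_group)
    then show "x \<otimes> h \<otimes> inv x \<in> ?M" using x h by auto
  qed
  show "?M \<subseteq> K" by (auto dest: bspec[of _ _ \<one>])
  show "finite_index G ?M"
  proof (rule finite_indexI[OF sub, where f = "\<lambda>g. \<lambda>C\<in>rcosets K. C #> g"])
    have "C #> g \<in> rcosets K" if "C \<in> rcosets K" "g \<in> carrier G" for C g
      using that by (auto simp: RCOSETS_def coset_mult_assoc K.subset intro!: bexI[of _ "_ \<otimes> g"])
    then have "(\<lambda>C\<in>rcosets K. C #> g) \<in> (rcosets K) \<rightarrow>\<^sub>E (rcosets K)" if "g \<in> carrier G" for g
      using that by auto
    then have "(\<lambda>g. \<lambda>C\<in>rcosets K. C #> g) ` carrier G \<subseteq> (rcosets K) \<rightarrow>\<^sub>E (rcosets K)"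
      by blast
    then show "finite ((\<lambda>g. \<lambda>C\<in>rcosets K. C #> g) ` carrier G)"
      using assms by (elim finite_subset) (auto simp: finite_index_def intro: finite_PiE)
    fix g h assume gh: "g \<in> carrier G" "h \<in> carrier G"
      and eq: "(\<lambda>C\<in>rcosets K. C #> g) = (\<lambda>C\<in>rcosets K. C #> h)"
    have "x \<otimes> (g \<otimes> inv h) \<otimes> inv x \<in> K" if x: "x \<in> carrier G" for x
    proof -
      have "(K #> x) #> g = (K #> x) #> h"
        using fun_cong[OF eq, of "K #> x"] x by (auto simp: RCOSETS_def split: if_splits)
      then have "K #> (x \<otimes> g) = K #> (x \<otimes> h)"
        using x gh by (simp add: coset_mult_assoc K.subset)
      then have "(x \<otimes> g) \<otimes> inv (x \<otimes> h) \<in> K" using x gh by (intro rcos_eqD K.subgroup_axioms) auto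
      then show ?thesis using x gh by (simp add: m_assoc inv_mult_group)
    qed
    then show "g \<otimes> inv h \<in> ?M" using gh by auto
  qed
qed

section \<open>Homomorphisms out of a presented group\<close>

primrec eval_word :: "('w, 'm) monoid_scheme \<Rightarrow> ('x \<Rightarrow> 'w) \<Rightarrow> 'x word \<Rightarrow> 'w" where
  "eval_word W f [] = \<one>\<^bsub>W\<^esub>"
| "eval_word W f (l # u) = (if snd l then f (fst l) else inv\<^bsub>W\<^esub> f (fst l)) \<otimes>\<^bsub>W\<^esub> eval_word W f u"

context group
begin

lemma eval_word_closed:
  "f \<in> X \<rightarrow> carrier G \<Longrightarrow> u \<in> words X \<Longrightarrow> eval_word G f u \<in> carrier G"
  by (induction u) (auto simp: words_def Pi_iff)

lemma eval_word_append:
  assumes f: "f \<in> X \<rightarrow> carrier G" and "u \<in> words X" "w \<in> words X"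
  shows "eval_word G f (u @ w) = eval_word G f u \<otimes> eval_word G f w"
  using assms(2)
proof (induction u)
  case Nil
  then show ?case using eval_word_closed[OF f assms(3)] by simp
next
  case (Cons l u)
  then have "u \<in> words X" "f (fst l) \<in> carrier G" using f by (auto simp: words_def)
  then show ?case
    using Cons.IH eval_word_closed[OF f assms(3)] eval_word_closed[OF f] by (simp add: m_assoc)
qed

lemma eval_word_cong:
  assumes f: "f \<in> X \<rightarrow> carrier G"
    and R: "\<And>r. r \<in> R \<Longrightarrow> r \<in> words X \<Longrightarrow> eval_word G f r = \<one>"
  shows "word_eq X R u w \<Longrightarrow> eval_word G f u = eval_word G f w"
proof (induction rule: word_eq.induct)
  case (cancel u w x b)
  have x: "f x \<in> carrier G" using f cancel by auto
  have "[(x, b), (x, \<not> b)] \<in> words X" using cancel by (auto simp: words_def)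
  moreover have "eval_word G f [(x, b), (x, \<not> b)] = \<one>" using x by auto
  ultimately show ?case
    using cancel by (simp add: eval_word_append[OF f] eval_word_closed[OF f] del: eval_word.simps append_Cons)
next
  case (relator u w r)
  then show ?case
    using R[of r] by (simp add: eval_word_append[OF f] eval_word_closed[OF f])
qed auto

lemma presented_group_hom:
  assumes f: "f \<in> X \<rightarrow> carrier G"
    and R: "\<And>r. r \<in> R \<Longrightarrow> r \<in> words X \<Longrightarrow> eval_word G f r = \<one>"
  obtains \<Theta> where "\<Theta> \<in> hom (presented_group X R) G"
    "\<And>x. x \<in> X \<Longrightarrow> \<Theta> (word_class X R [(x, True)]) = f x"
proof
  define \<Theta> where "\<Theta> A = eval_word G f (SOME u. u \<in> A)" for A
  have \<Theta>: "\<Theta> (word_class X R u) = eval_word G f u" if "u \<in> words X" for u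
  proof -
    have "u \<in> word_class X R u" using that by (auto simp: word_class_def intro: word_eq.refl)
    then have "(SOME w. w \<in> word_class X R u) \<in> word_class X R u" by (rule someI)
    then have "word_eq X R u (SOME w. w \<in> word_class X R u)" by (simp add: word_class_def)
    from eval_word_cong[OF f R this] show ?thesis by (simp add: \<Theta>_def)
  qed
  show "\<Theta> \<in> hom (presented_group X R) G"
  proof (rule homI)
    fix A assume "A \<in> carrier (presented_group X R)"
    then show "\<Theta> A \<in> carrier G" using eval_word_closed[OF f] \<Theta> by (auto simp: presented_group_def)
  next
    fix A B assume "A \<in> carrier (presented_group X R)" "B \<in> carrier (presented_group X R)"
    then obtain u w where "u \<in> words X" "A = word_class X R u" "w \<in> words X" "B = word_class X R w"
      by (auto simp: presented_group_def)
    then show "\<Theta> (A \<otimes>\<^bsub>presented_group X R\<^esub> B) = \<Theta> A \<otimes> \<Theta> B"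
      by (simp add: mult_presented_group \<Theta> eval_word_append[OF f])
  qed
  show "\<Theta> (word_class X R [(x, True)]) = f x" if "x \<in> X" for x
    using that f by (subst \<Theta>) (auto simp: words_def Pi_iff)
qed

end

lemma inv_presented_group_letter:
  assumes "x \<in> X"
  shows "inv\<^bsub>presented_group X R\<^esub> word_class X R [(x, True)] = word_class X R [(x, False)]"
proof -
  interpret P: group "presented_group X R" by (rule group_presented_group)
  have w: "[(x, b)] \<in> words X" for b using assms by (auto simp: words_def)
  have "word_eq X R ([] @ [(x, False), (x, \<not> False)] @ []) ([] @ [])"
    using assms by (intro word_eq.cancel) auto
  then have "word_class X R [(x, False), (x, True)] = word_class X R []"
    using w by (subst word_class_eq_iff) (auto simp: words_def)
  then have "word_class X R [(x, False)] \<otimes>\<^bsub>presented_group X R\<^esub> word_class X R [(x, True)]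
      = \<one>\<^bsub>presented_group X R\<^esub>"
    using w by (simp add: mult_presented_group) (simp add: presented_group_def)
  then show ?thesis
    using w by (intro P.inv_equality) (auto simp: presented_group_def)
qed

lemma presented_group_generate:
  "generate (presented_group X R) ((\<lambda>x. word_class X R [(x, True)]) ` X) = carrier (presented_group X R)"
proof
  interpret P: group "presented_group X R" by (rule group_presented_group)
  let ?gen = "(\<lambda>x. word_class X R [(x, True)]) ` X"
  have w: "[(x, b)] \<in> words X" if "x \<in> X" for x b using that by (auto simp: words_def)
  have "?gen \<subseteq> carrier (presented_group X R)"
    using w by (auto simp: presented_group_def)
  then show "generate (presented_group X R) ?gen \<subseteq> carrier (presented_group X R)"
    by (rule P.generate_incl)
  have "word_class X R u \<in> generate (presented_group X R) ?gen" if "u \<in> words X" for u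
    using that
  proof (induction u)
    case Nil
    then show ?case using generate.one[of "presented_group X R"] by (simp add: presented_group_def)
  next
    case (Cons l u)
    obtain x b where l: "l = (x, b)" by force
    have x: "x \<in> X" and u: "u \<in> words X" using Cons.prems l by (auto simp: words_def)
    have "word_class X R [(x, b)] \<in> generate (presented_group X R) ?gen"
    proof (cases b)
      case True
      then show ?thesis using x by (auto intro: generate.incl)
    next
      case False
      then show ?thesis
        using x generate.inv[of "word_class X R [(x, True)]" ?gen "presented_group X R"]
        by (auto simp: inv_presented_group_letter)
    qed
    then have "word_class X R [(x, b)] \<otimes>\<^bsub>presented_group X R\<^esub> word_class X R u
        \<in> generate (presented_group X R) ?gen"
      using Cons.IH[OF u] by (rule generate.eng)
    then show ?case using w[OF x] u l by (simp add: mult_presented_group)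
  qed
  then show "carrier (presented_group X R) \<subseteq> generate (presented_group X R) ?gen"
    by (auto simp: presented_group_def)
qed


section \<open>The fundamental group of a graph of groups\<close>

lemma orientation_arcs:
  assumes "orientation \<Gamma> bar P" "e \<in> P"
  shows "e \<in> arcs \<Gamma>" "bar e \<in> arcs \<Gamma>" "bar e \<notin> P"
  using assms by (auto simp: orientation_def)

definition stable_emb ::
  "('v, 'e) pre_digraph \<Rightarrow> ('e \<Rightarrow> 'e) \<Rightarrow> ('v \<Rightarrow> 'a monoid) \<Rightarrow> ('e \<Rightarrow> 'b monoid) \<Rightarrow>
    ('e \<Rightarrow> 'b \<Rightarrow> 'a) \<Rightarrow> ('v, 'e) pre_digraph \<Rightarrow> 'e set \<Rightarrow> 'e \<Rightarrow> ('v, 'e, 'a) fg_gen word set" where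
  "stable_emb \<Gamma> bar Gv Ge \<alpha> T P e =
     word_class (fg_gens \<Gamma> Gv P) (fg_relators \<Gamma> bar Gv Ge \<alpha> T P) [(Stable e, True)]"

locale fundamental_group_setup = graph_of_groups \<Gamma> bar Gv Ge \<alpha>
  for \<Gamma> :: "('v, 'e) pre_digraph" and bar :: "'e \<Rightarrow> 'e"
    and Gv :: "'v \<Rightarrow> 'a monoid" and Ge :: "'e \<Rightarrow> 'b monoid" and \<alpha> :: "'e \<Rightarrow> 'b \<Rightarrow> 'a" +
  fixes T :: "('v, 'e) pre_digraph" and P :: "'e set"
  assumes maximal_tree: "maximal_tree \<Gamma> bar T" and orientation: "orientation \<Gamma> bar P"
begin

abbreviation "FG \<equiv> fundamental_group \<Gamma> bar Gv Ge \<alpha> T P"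
abbreviation "\<iota> \<equiv> vertex_emb \<Gamma> bar Gv Ge \<alpha> T P"
abbreviation "\<tau> \<equiv> stable_emb \<Gamma> bar Gv Ge \<alpha> T P"
abbreviation "gens \<equiv> fg_gens \<Gamma> Gv P"
abbreviation "rels \<equiv> fg_relators \<Gamma> bar Gv Ge \<alpha> T P"

lemmas P_arcs = orientation_arcs[OF orientation]

lemma head_in_verts_P: "e \<in> P \<Longrightarrow> head \<Gamma> e \<in> verts \<Gamma>" "e \<in> P \<Longrightarrow> tail \<Gamma> e \<in> verts \<Gamma>"
  using P_arcs by auto

lemma \<alpha>_closed: "e \<in> arcs \<Gamma> \<Longrightarrow> a \<in> carrier (Ge e) \<Longrightarrow> \<alpha> e a \<in> carrier (Gv (tail \<Gamma> e))"
  using \<alpha>_hom by (auto simp: hom_def)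

lemma \<alpha>_bar_hom: "e \<in> arcs \<Gamma> \<Longrightarrow> \<alpha> (bar e) \<in> hom (Ge e) (Gv (head \<Gamma> e))"
  using \<alpha>_hom[of "bar e"] by (simp add: Ge_bar)

lemma \<alpha>_bar_closed: "e \<in> arcs \<Gamma> \<Longrightarrow> a \<in> carrier (Ge e) \<Longrightarrow> \<alpha> (bar e) a \<in> carrier (Gv (head \<Gamma> e))"
  using \<alpha>_bar_hom by (auto simp: hom_def)

lemma group_FG: "group FG"
  unfolding fundamental_group_def by (rule group_presented_group)

lemma letters_in_words:
  "v \<in> verts \<Gamma> \<Longrightarrow> g \<in> carrier (Gv v) \<Longrightarrow> Elem v g \<in> gens"
  "e \<in> P \<Longrightarrow> Stable e \<in> gens"
  by (auto simp: fg_gens_def)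

lemma stable_emb_closed: "e \<in> P \<Longrightarrow> \<tau> e \<in> carrier FG"
  by (auto simp: stable_emb_def fundamental_group_def presented_group_def fg_gens_def words_def)

lemma \<iota>_hom: "v \<in> verts \<Gamma> \<Longrightarrow> \<iota> v \<in> hom (Gv v) FG"
  by (rule vertex_emb_hom) unfold_locales

lemma \<iota>_closed: "v \<in> verts \<Gamma> \<Longrightarrow> g \<in> carrier (Gv v) \<Longrightarrow> \<iota> v g \<in> carrier FG"
  using \<iota>_hom by (auto simp: hom_def)

lemma FG_generate:
  "generate FG ((\<Union>v\<in>verts \<Gamma>. \<iota> v ` carrier (Gv v)) \<union> \<tau> ` P) = carrier FG"
proof -
  have "(\<lambda>x. word_class gens rels [(x, True)]) ` gens =
      (\<Union>v\<in>verts \<Gamma>. \<iota> v ` carrier (Gv v)) \<union> \<tau> ` P"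
    by (auto simp: vertex_emb_def stable_emb_def fg_gens_def)
  then show ?thesis
    using presented_group_generate[of gens rels] by (simp add: fundamental_group_def)
qed

lemma word_class_relator:
  assumes "r \<in> rels" "r \<in> words gens"
  shows "word_class gens rels r = \<one>\<^bsub>FG\<^esub>"
proof -
  have "word_eq gens rels ([] @ r @ []) ([] @ [])"
    using assms by (intro word_eq.relator) auto
  then show ?thesis
    using assms by (simp add: word_class_eq_iff fundamental_group_def presented_group_def)
qed

lemma stable_emb_tree:
  assumes "f \<in> arcs T" "f \<in> P" shows "\<tau> f = \<one>\<^bsub>FG\<^esub>"
  unfolding stable_emb_def
  by (rule word_class_relator) (use assms in \<open>auto simp: fg_relators_def words_def fg_gens_def\<close>)

lemma stable_emb_conj:
  assumes e: "e \<in> P" and a: "a \<in> carrier (Ge e)"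
  shows "\<tau> e \<otimes>\<^bsub>FG\<^esub> \<iota> (head \<Gamma> e) (\<alpha> (bar e) a) \<otimes>\<^bsub>FG\<^esub> inv\<^bsub>FG\<^esub> \<tau> e = \<iota> (tail \<Gamma> e) (\<alpha> e a)"
proof -
  interpret FG: group FG by (rule group_FG)
  let ?r = "[(Stable e, True), (Elem (head \<Gamma> e) (\<alpha> (bar e) a), True), (Stable e, False),
       (Elem (tail \<Gamma> e) (\<alpha> e a), False)]"
  have mem: "Elem (head \<Gamma> e) (\<alpha> (bar e) a) \<in> gens" "Elem (tail \<Gamma> e) (\<alpha> e a) \<in> gens" "Stable e \<in> gens"
    using assms P_arcs \<alpha>_closed \<alpha>_bar_closed by (auto intro!: letters_in_words)
  then have w: "[(Elem (head \<Gamma> e) (\<alpha> (bar e) a), b)] \<in> words gens"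
    "[(Elem (tail \<Gamma> e) (\<alpha> e a), b)] \<in> words gens" "[(Stable e, b)] \<in> words gens" for b
    by (auto simp: words_def)
  have "?r \<in> rels" using assms by (auto simp: fg_relators_def)
  moreover have rw: "?r \<in> words gens" using mem by (auto simp: words_def)
  ultimately have 1: "word_class gens rels ?r = \<one>\<^bsub>FG\<^esub>" by (rule word_class_relator)
  have 2: "word_class gens rels ?r = (\<tau> e \<otimes>\<^bsub>FG\<^esub> \<iota> (head \<Gamma> e) (\<alpha> (bar e) a) \<otimes>\<^bsub>FG\<^esub> inv\<^bsub>FG\<^esub> \<tau> e)
      \<otimes>\<^bsub>FG\<^esub> inv\<^bsub>FG\<^esub> \<iota> (tail \<Gamma> e) (\<alpha> e a)"
    using mem w unfolding vertex_emb_def stable_emb_def fundamental_group_def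
    by (simp add: inv_presented_group_letter) (simp add: mult_presented_group words_def)
  have "\<tau> e \<in> carrier FG" "\<iota> (head \<Gamma> e) (\<alpha> (bar e) a) \<in> carrier FG" "\<iota> (tail \<Gamma> e) (\<alpha> e a) \<in> carrier FG"
    using assms P_arcs by (auto intro!: stable_emb_closed \<iota>_closed \<alpha>_closed \<alpha>_bar_closed)
  with 1 2 show ?thesis by (metis FG.inv_equality FG.inv_inv FG.inv_closed FG.m_closed)
qed

text \<open>The universal property of the presentation. The edge relation is written without
  inverses, as an intertwining condition, because the images of the stable letters arise below as
  intertwining elements.\<close>

lemma FG_hom:
  assumes "group W"
    and \<theta>: "\<And>v. v \<in> verts \<Gamma> \<Longrightarrow> \<theta> v \<in> hom (Gv v) W"
    and s: "\<And>e. e \<in> P \<Longrightarrow> s e \<in> carrier W"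
    and s_tree: "\<And>e. e \<in> P \<Longrightarrow> e \<in> arcs T \<Longrightarrow> s e = \<one>\<^bsub>W\<^esub>"
    and conj: "\<And>e a. e \<in> P \<Longrightarrow> a \<in> carrier (Ge e) \<Longrightarrow>
      s e \<otimes>\<^bsub>W\<^esub> \<theta> (head \<Gamma> e) (\<alpha> (bar e) a) = \<theta> (tail \<Gamma> e) (\<alpha> e a) \<otimes>\<^bsub>W\<^esub> s e"
  obtains \<Theta> where "\<Theta> \<in> hom FG W"
    "\<And>v g. v \<in> verts \<Gamma> \<Longrightarrow> g \<in> carrier (Gv v) \<Longrightarrow> \<Theta> (\<iota> v g) = \<theta> v g"
    "\<And>e. e \<in> P \<Longrightarrow> \<Theta> (\<tau> e) = s e"
proof -
  interpret W: group W by fact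
  define f where "f x = (case x of Elem v g \<Rightarrow> \<theta> v g | Stable e \<Rightarrow> s e)" for x
  have \<theta>c: "\<theta> v g \<in> carrier W" if "v \<in> verts \<Gamma>" "g \<in> carrier (Gv v)" for v g
    using \<theta> that by (auto simp: hom_def)
  have f: "f \<in> gens \<rightarrow> carrier W"
    using s \<theta>c by (auto simp: fg_gens_def f_def)
  have "eval_word W f r = \<one>\<^bsub>W\<^esub>" if r: "r \<in> rels" for r
  proof -
    consider (vert) v g h where "v \<in> verts \<Gamma>" "g \<in> carrier (Gv v)" "h \<in> carrier (Gv v)"
        "r = [(Elem v g, True), (Elem v h, True), (Elem v (g \<otimes>\<^bsub>Gv v\<^esub> h), False)]"
      | (edge) e a where "e \<in> P" "a \<in> carrier (Ge e)"
        "r = [(Stable e, True), (Elem (head \<Gamma> e) (\<alpha> (bar e) a), True), (Stable e, False),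
          (Elem (tail \<Gamma> e) (\<alpha> e a), False)]"
      | (tree) e where "e \<in> P" "e \<in> arcs T" "r = [(Stable e, True)]"
      using r by (auto simp: fg_relators_def)
    then show ?thesis
    proof cases
      case vert
      then show ?thesis using \<theta>c[OF vert(1)] hom_mult[OF \<theta>[OF vert(1)] vert(2,3)]
        by (simp add: f_def flip: W.m_assoc)
    next
      case edge
      have "\<theta> (head \<Gamma> e) (\<alpha> (bar e) a) \<in> carrier W" "\<theta> (tail \<Gamma> e) (\<alpha> e a) \<in> carrier W"
        using edge P_arcs by (auto intro!: \<theta>c \<alpha>_closed \<alpha>_bar_closed)
      then show ?thesis using edge conj[OF edge(1,2)] s[OF edge(1)]
        by (simp add: f_def flip: W.m_assoc) (simp add: W.m_assoc)
    next
      case tree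
      then show ?thesis using s_tree by (simp add: f_def)
    qed
  qed
  from W.presented_group_hom[OF f this] obtain \<Theta> where \<Theta>: "\<Theta> \<in> hom FG W"
    "\<And>x. x \<in> gens \<Longrightarrow> \<Theta> (word_class gens rels [(x, True)]) = f x"
    by (auto simp: fundamental_group_def)
  show thesis
    by (rule that[OF \<Theta>(1)]) (auto simp: vertex_emb_def stable_emb_def \<Theta>(2) letters_in_words f_def)
qed

end

section \<open>Trees, and stable letters that are trivial on the maximal tree\<close>

context bidirected_digraph
begin

text \<open>Running back along an edge would return to its tail, a vertex that the path has already
  visited.\<close>

lemma apath_no_backtrack:
  assumes "apath u p v" "Suc i < length p"
  shows "p ! Suc i \<noteq> arev (p ! i)"
  using assms
proof (induction p arbitrary: u i)
  case Nil
  then show ?case by simp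
next
  case (Cons e es)
  show ?case
  proof (cases i)
    case 0
    obtain e' es' where es: "es = e' # es'" using Cons.prems(2) 0 by (cases es) auto
    have e: "e \<in> arcs G" "tail G e \<notin> set (awalk_verts (head G e) es)"
      using Cons.prems(1) by (auto simp: apath_Cons_iff)
    have "apath (head G e') es' v" using Cons.prems(1) by (simp add: apath_Cons_iff es)
    then have "head G e' \<in> set (awalk_verts (head G e) es)"
      unfolding es using hd_in_awalk_verts(2) by auto
    then show ?thesis using e 0 es by (auto simp: head_arev)
  next
    case (Suc j)
    then show ?thesis using Cons by (auto simp: apath_Cons_iff)
  qed
qed

end

context fundamental_group_setup
begin

lemma subgraph_T: "subgraph T \<Gamma>"
  and serre_tree_T: "serre_tree bar T"
  using maximal_tree by (auto simp: maximal_tree_def max_subgraph_def)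

lemma T_simps: "tail T = tail \<Gamma>" "head T = head \<Gamma>" "arcs T \<subseteq> arcs \<Gamma>" "wf_digraph T"
  using subgraph_T by (auto simp: subgraph_def compatible_def)

text \<open>Otherwise a path would close up with \<open>f\<close> to a circuit without backtracking in the tree.\<close>

lemma tree_edge_separates:
  assumes f: "f \<in> arcs T" "f \<in> P" and S: "S \<subseteq> arcs T \<inter> P" "f \<notin> S"
  defines "D \<equiv> \<lparr>verts = verts T, arcs = S \<union> bar ` S, tail = tail \<Gamma>, head = head \<Gamma>\<rparr>"
  shows "\<not> head \<Gamma> f \<rightarrow>\<^sup>*\<^bsub>D\<^esub> tail \<Gamma> f"
proof
  interpret T: wf_digraph T by (rule T_simps)
  have barT: "bar ` arcs T \<subseteq> arcs T" using serre_tree_T by (simp add: serre_tree_def)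
  have DT: "arcs D \<subseteq> arcs T" using S barT by (auto simp: D_def)
  interpret D: wf_digraph D
  proof
    fix e assume e: "e \<in> arcs D"
    then have "e \<in> arcs T" using DT by auto
    then show "tail D e \<in> verts D" "head D e \<in> verts D"
      using T.wellformed[of e] by (simp_all add: D_def T_simps)
  qed
  have sub: "subgraph D T"
    using DT T.wf_digraph_axioms D.wf_digraph_axioms
    by (auto simp: subgraph_def compatible_def D_def T_simps)
  assume "head \<Gamma> f \<rightarrow>\<^sup>*\<^bsub>D\<^esub> tail \<Gamma> f"
  then obtain p where p: "D.apath (head \<Gamma> f) p (tail \<Gamma> f)"
    using D.reachable_apath by auto
  have pT: "T.apath (head \<Gamma> f) p (tail \<Gamma> f)"
    using T.subgraph_apath_imp_apath[OF p sub] .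
  then have p\<Gamma>: "apath (head \<Gamma> f) p (tail \<Gamma> f)"
    using subgraph_apath_imp_apath[OF _ subgraph_T] by simp
  have "T.cycle (f # p)"
    unfolding T.cycle_def using pT f(1) T.wellformed[OF f(1)]
    by (intro exI[of _ "tail \<Gamma> f"]) (auto simp: T.apath_def T.awalk_Cons_iff T_simps)
  moreover have "(f # p) ! Suc i \<noteq> bar ((f # p) ! i)" if "Suc i < length (f # p)" for i
  proof (cases i)
    case 0
    \<comment> \<open>Backtracking inside \<open>p\<close> is excluded because \<open>p\<close> is a
      path, which leaves the junction with \<open>f\<close>. The first edge of \<open>p\<close> is
      in \<open>S\<close> or is the inverse of an edge in \<open>S\<close>; it is not
      \<open>bar f\<close>, since \<open>bar f\<close> is outside \<open>P\<close> and
      \<open>f\<close> is outside \<open>S\<close>.\<close>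
    have "set p \<subseteq> arcs D" using p by (simp add: D.apath_def D.awalk_def)
    then have "p ! 0 \<in> S \<union> bar ` S"
      using that 0 nth_mem[of 0 p] unfolding D_def by (simp add: subset_iff)
    moreover have "bar f \<notin> P" "f \<in> arcs \<Gamma>" using P_arcs f by auto
    ultimately show ?thesis using S 0 by (auto simp: arev_eq_iff)
  next
    case (Suc j)
    then show ?thesis using apath_no_backtrack[OF p\<Gamma>] that by simp
  qed
  ultimately show False using serre_tree_T by (auto simp: serre_tree_def)
qed

text \<open>The stable letters of the tree have to be sent to one, which arbitrary elements
  \<open>s\<close> do not satisfy; a potential \<open>w\<close> on the vertices corrects them by
  conjugation. The edges of the tree are added one at a time. The ends of \<open>f\<close> lie in
  different components of the edges already treated, so \<open>w\<close> can be changed on the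
  component \<open>C\<close> of the head of \<open>f\<close> alone. The change is a left
  multiplication, which preserves the equations of the old edges.\<close>

lemma tree_potential:
  assumes "group W" and s: "\<And>e. e \<in> P \<Longrightarrow> s e \<in> carrier W"
  obtains w where "\<And>v. w v \<in> carrier W"
    "\<And>f. f \<in> P \<Longrightarrow> f \<in> arcs T \<Longrightarrow> w (tail \<Gamma> f) \<otimes>\<^bsub>W\<^esub> s f = w (head \<Gamma> f)"
proof -
  interpret W: group W by fact
  have fin: "finite (arcs T \<inter> P)" using T_simps(3) finite_arcs by (auto intro: finite_subset)
  have "\<exists>w. (\<forall>v. w v \<in> carrier W) \<and> (\<forall>f\<in>S. w (tail \<Gamma> f) \<otimes>\<^bsub>W\<^esub> s f = w (head \<Gamma> f))"
    if "S \<subseteq> arcs T \<inter> P" for S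
    using finite_subset[OF that fin] that
  proof (induction S)
    case empty
    then show ?case by (auto intro: exI[of _ "\<lambda>_. \<one>\<^bsub>W\<^esub>"])
  next
    case (insert f S)
    then obtain w where w: "\<And>v. w v \<in> carrier W"
      "\<And>f. f \<in> S \<Longrightarrow> w (tail \<Gamma> f) \<otimes>\<^bsub>W\<^esub> s f = w (head \<Gamma> f)" by auto
    have f: "f \<in> arcs T" "f \<in> P" using insert.prems by auto
    interpret T: wf_digraph T by (rule T_simps)
    let ?D = "\<lparr>verts = verts T, arcs = S \<union> bar ` S, tail = tail \<Gamma>, head = head \<Gamma>\<rparr>"
    have barT: "bar ` arcs T \<subseteq> arcs T" using serre_tree_T by (simp add: serre_tree_def)
    interpret D: wf_digraph ?D
    proof
      fix e assume "e \<in> arcs ?D"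
      then have "e \<in> arcs T" using insert.prems barT by auto
      then show "tail ?D e \<in> verts ?D" "head ?D e \<in> verts ?D"
        using T.wellformed[of e] by (simp_all add: T_simps)
    qed
    define C where "C = {v. head \<Gamma> f \<rightarrow>\<^sup>*\<^bsub>?D\<^esub> v}"
    have "tail \<Gamma> f \<notin> C"
      using tree_edge_separates[OF f _ insert.hyps(2)] insert.prems by (auto simp: C_def)
    have hC: "head \<Gamma> f \<in> C"
      using T.wellformed[OF f(1)] by (auto simp: C_def T_simps)
    have step: "head \<Gamma> e \<in> C" if "e \<in> S \<union> bar ` S" "tail \<Gamma> e \<in> C" for e
    proof -
      have "tail \<Gamma> e \<rightarrow>\<^bsub>?D\<^esub> head \<Gamma> e" using that by (auto simp: arcs_ends_def arc_to_ends_def)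
      then show ?thesis using that(2) D.reachable_adj_trans by (auto simp: C_def)
    qed
    have C_iff: "tail \<Gamma> e \<in> C \<longleftrightarrow> head \<Gamma> e \<in> C" if "e \<in> S" for e
    proof -
      have "e \<in> arcs \<Gamma>" using that insert.prems T_simps by auto
      then show ?thesis using step[of e] step[of "bar e"] that by auto
    qed
    define g where "g = w (tail \<Gamma> f) \<otimes>\<^bsub>W\<^esub> s f \<otimes>\<^bsub>W\<^esub> inv\<^bsub>W\<^esub> w (head \<Gamma> f)"
    have g: "g \<in> carrier W" using w s f by (simp add: g_def)
    show ?case
    proof (intro exI[of _ "\<lambda>v. if v \<in> C then g \<otimes>\<^bsub>W\<^esub> w v else w v"] conjI allI ballI)
      show "(if v \<in> C then g \<otimes>\<^bsub>W\<^esub> w v else w v) \<in> carrier W" for v using w g by simp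
      fix e assume e: "e \<in> insert f S"
      show "(if tail \<Gamma> e \<in> C then g \<otimes>\<^bsub>W\<^esub> w (tail \<Gamma> e) else w (tail \<Gamma> e)) \<otimes>\<^bsub>W\<^esub> s e =
          (if head \<Gamma> e \<in> C then g \<otimes>\<^bsub>W\<^esub> w (head \<Gamma> e) else w (head \<Gamma> e))"
      proof (cases "e = f")
        case True
        then show ?thesis using \<open>tail \<Gamma> f \<notin> C\<close> hC w s[OF f(2)]
          by (simp add: g_def W.m_assoc)
      next
        case False
        then have e: "e \<in> S" "s e \<in> carrier W" using e s insert.prems by auto
        then show ?thesis using w g C_iff[OF e(1)] by (simp add: W.m_assoc)
      qed
    qed
  qed
  from this[OF subset_refl] show thesis using that by blast
qed

text \<open>Conjugating each \<open>\<theta> v\<close> by the potential \<open>w v\<close>, and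
  replacing \<open>s e\<close> by \<open>s' e\<close>, turns any solution of the edge relations into
  one that is trivial on the tree.\<close>

lemma FG_hom_conj:
  assumes "group W"
    and \<theta>: "\<And>v. v \<in> verts \<Gamma> \<Longrightarrow> \<theta> v \<in> hom (Gv v) W"
    and s: "\<And>e. e \<in> P \<Longrightarrow> s e \<in> carrier W"
    and conj: "\<And>e a. e \<in> P \<Longrightarrow> a \<in> carrier (Ge e) \<Longrightarrow>
      s e \<otimes>\<^bsub>W\<^esub> \<theta> (head \<Gamma> e) (\<alpha> (bar e) a) = \<theta> (tail \<Gamma> e) (\<alpha> e a) \<otimes>\<^bsub>W\<^esub> s e"
  obtains \<Theta> w where "\<Theta> \<in> hom FG W" "\<And>v. w v \<in> carrier W"
    "\<And>v g. v \<in> verts \<Gamma> \<Longrightarrow> g \<in> carrier (Gv v) \<Longrightarrow> \<Theta> (\<iota> v g) = w v \<otimes>\<^bsub>W\<^esub> \<theta> v g \<otimes>\<^bsub>W\<^esub> inv\<^bsub>W\<^esub> w v"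
proof -
  interpret W: group W by fact
  obtain w where w: "\<And>v. w v \<in> carrier W"
    "\<And>f. f \<in> P \<Longrightarrow> f \<in> arcs T \<Longrightarrow> w (tail \<Gamma> f) \<otimes>\<^bsub>W\<^esub> s f = w (head \<Gamma> f)"
    by (rule tree_potential[OF \<open>group W\<close>, of s]) (use s in auto)
  have \<theta>c: "\<theta> v g \<in> carrier W" if "v \<in> verts \<Gamma>" "g \<in> carrier (Gv v)" for v g
    using \<theta> that by (auto simp: hom_def)
  define \<theta>' where "\<theta>' v g = w v \<otimes>\<^bsub>W\<^esub> \<theta> v g \<otimes>\<^bsub>W\<^esub> inv\<^bsub>W\<^esub> w v" for v g
  define s' where "s' e = w (tail \<Gamma> e) \<otimes>\<^bsub>W\<^esub> s e \<otimes>\<^bsub>W\<^esub> inv\<^bsub>W\<^esub> w (head \<Gamma> e)" for e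
  obtain \<Theta> where "\<Theta> \<in> hom FG W"
    "\<And>v g. v \<in> verts \<Gamma> \<Longrightarrow> g \<in> carrier (Gv v) \<Longrightarrow> \<Theta> (\<iota> v g) = \<theta>' v g"
  proof (rule FG_hom[OF \<open>group W\<close>, of \<theta>' s'])
    show "\<theta>' v \<in> hom (Gv v) W" if v: "v \<in> verts \<Gamma>" for v
    proof (rule homI)
      show "\<theta>' v g \<in> carrier W" if "g \<in> carrier (Gv v)" for g
        using that w \<theta>c[OF v] by (simp add: \<theta>'_def)
      fix g h assume gh: "g \<in> carrier (Gv v)" "h \<in> carrier (Gv v)"
      show "\<theta>' v (g \<otimes>\<^bsub>Gv v\<^esub> h) = \<theta>' v g \<otimes>\<^bsub>W\<^esub> \<theta>' v h"
        using w(1)[of v] \<theta>c[OF v] gh unfolding \<theta>'_def hom_mult[OF \<theta>[OF v] gh]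
        by (simp add: W.group_simps)
    qed
    show "s' e \<in> carrier W" if "e \<in> P" for e using w s that by (simp add: s'_def)
    show "s' e = \<one>\<^bsub>W\<^esub>" if "e \<in> P" "e \<in> arcs T" for e using w that by (simp add: s'_def)
    fix e a assume e: "e \<in> P" and a: "a \<in> carrier (Ge e)"
    have c: "\<theta> (head \<Gamma> e) (\<alpha> (bar e) a) \<in> carrier W" "\<theta> (tail \<Gamma> e) (\<alpha> e a) \<in> carrier W"
      using e a P_arcs by (auto intro!: \<theta>c \<alpha>_closed \<alpha>_bar_closed)
    have "s' e \<otimes>\<^bsub>W\<^esub> \<theta>' (head \<Gamma> e) (\<alpha> (bar e) a)
      = w (tail \<Gamma> e) \<otimes>\<^bsub>W\<^esub> (s e \<otimes>\<^bsub>W\<^esub> \<theta> (head \<Gamma> e) (\<alpha> (bar e) a)) \<otimes>\<^bsub>W\<^esub> inv\<^bsub>W\<^esub> w (head \<Gamma> e)"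
      using w s[OF e] c by (simp add: s'_def \<theta>'_def W.group_simps)
    also have "\<dots> = \<theta>' (tail \<Gamma> e) (\<alpha> e a) \<otimes>\<^bsub>W\<^esub> s' e"
      using w s[OF e] c unfolding conj[OF e a] by (simp add: s'_def \<theta>'_def W.group_simps)
    finally show "s' e \<otimes>\<^bsub>W\<^esub> \<theta>' (head \<Gamma> e) (\<alpha> (bar e) a) = \<theta>' (tail \<Gamma> e) (\<alpha> e a) \<otimes>\<^bsub>W\<^esub> s' e" .
  qed (use that in blast)
  then show thesis by (intro that[of \<Theta> w]) (use w in \<open>simp_all add: \<theta>'_def\<close>)
qed

end

subsection \<open>Vertex groups embed\<close>

definition perm_group :: "('x \<Rightarrow> 'x) monoid" where
  "perm_group = \<lparr>carrier = {f. bij f}, monoid.mult = (\<circ>), monoid.one = id\<rparr>"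

lemma perm_group_simps [simp]:
  "f \<in> carrier perm_group \<longleftrightarrow> bij f" "f \<otimes>\<^bsub>perm_group\<^esub> g = f \<circ> g" "\<one>\<^bsub>perm_group\<^esub> = id"
  by (simp_all add: perm_group_def)

lemma group_perm_group: "group perm_group"
proof (rule groupI)
  show "\<exists>g\<in>carrier perm_group. g \<otimes>\<^bsub>perm_group\<^esub> f = \<one>\<^bsub>perm_group\<^esub>"
    if "f \<in> carrier perm_group" for f :: "'x \<Rightarrow> 'x"
    using that by (intro bexI[of _ "inv_into UNIV f"]) (auto simp: bij_imp_bij_inv bij_is_inj)
qed (auto simp: bij_comp comp_assoc)

text \<open>Prepending an entry embeds one way, pairing with a fixed element of \<open>S\<close> the
  other way. Thus \<open>'a list\<close> absorbs every nonempty factor \<open>S\<close>, finite or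
  infinite.\<close>

lemma bij_betw_Times_lists:
  assumes "S \<noteq> ({} :: 'a set)"
  obtains h where "bij_betw h (S \<times> (UNIV :: 'a list set)) (UNIV :: 'a list set)"
proof -
  obtain a where "a \<in> S" using assms by auto
  have "inj_on (\<lambda>(x, l). x # l) (S \<times> (UNIV :: 'a list set))" by (auto simp: inj_on_def)
  moreover have "inj_on (\<lambda>l. (a, l)) (UNIV :: 'a list set)" by (auto simp: inj_on_def)
  ultimately show thesis
    using Schroeder_Bernstein[of "\<lambda>(x, l). x # l" "S \<times> (UNIV :: 'a list set)" UNIV "\<lambda>l. (a, l)"]
      \<open>a \<in> S\<close> that by auto
qed

text \<open>
  Left multiplication on \<open>G \<times> 'a list\<close>, a free action with so many orbits that its restriction
  to any subgroup \<open>E\<close> is isomorphic to left multiplication on \<open>E \<times> 'a list\<close>.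
\<close>

lemma (in group) free_permutation_rep:
  obtains \<theta> :: "'a \<Rightarrow> 'a list \<Rightarrow> 'a list" where
    "\<theta> \<in> hom G perm_group" "inj_on \<theta> (carrier G)"
    "\<And>E :: 'c monoid. \<And>a. group E \<Longrightarrow> a \<in> hom E G \<Longrightarrow> inj_on a (carrier E) \<Longrightarrow>
      \<exists>\<beta>. bij_betw \<beta> (carrier E \<times> (UNIV :: 'a list set)) UNIV \<and>
        (\<forall>x\<in>carrier E. \<forall>y\<in>carrier E. \<forall>l. \<theta> (a x) (\<beta> (y, l)) = \<beta> (x \<otimes>\<^bsub>E\<^esub> y, l))"
proof -
  obtain h where h: "bij_betw h (carrier G \<times> (UNIV :: 'a list set)) (UNIV :: 'a list set)"
    using bij_betw_Times_lists[of "carrier G"] by auto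
  define k where "k = inv_into (carrier G \<times> UNIV) h"
  have k: "k z \<in> carrier G \<times> UNIV" "h (k z) = z" for z
    using h unfolding k_def bij_betw_def by (metis UNIV_I inv_into_into f_inv_into_f)+
  have kh: "k (h (x, l)) = (x, l)" if "x \<in> carrier G" for x l
    using h that unfolding k_def bij_betw_def by (intro inv_into_f_f) auto
  define \<theta> where "\<theta> g = (\<lambda>z. h (g \<otimes> fst (k z), snd (k z)))" for g
  have \<theta>h: "\<theta> g (h (x, l)) = h (g \<otimes> x, l)" if "x \<in> carrier G" for g x l
    using kh that by (simp add: \<theta>_def)
  have \<theta>\<theta>: "\<theta> g (\<theta> g' z) = \<theta> (g \<otimes> g') z" if "g \<in> carrier G" "g' \<in> carrier G" for g g' z
  proof -
    obtain x l where "k z = (x, l)" "x \<in> carrier G" using k(1)[of z] by auto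
    moreover from this have "z = h (x, l)" using k(2)[of z] by simp
    ultimately show ?thesis using that by (simp add: \<theta>h m_assoc)
  qed
  have \<theta>1: "\<theta> \<one> z = z" for z
    using k[of z] by (cases "k z") (auto simp: \<theta>_def)
  have bij: "bij (\<theta> g)" if "g \<in> carrier G" for g
    using that by (intro o_bij[of "\<theta> (inv g)"]) (auto simp: fun_eq_iff \<theta>\<theta> \<theta>1)
  show thesis
  proof (rule that)
    show "\<theta> \<in> hom G perm_group" using bij \<theta>\<theta> by (intro homI) (auto simp: fun_eq_iff)
    show "inj_on \<theta> (carrier G)"
    proof (rule inj_onI)
      fix x y assume xy: "x \<in> carrier G" "y \<in> carrier G" "\<theta> x = \<theta> y"
      then have "h (x, []) = h (y, [])" using \<theta>h[OF one_closed, of x "[]"] \<theta>h[OF one_closed, of y "[]"] by (metis r_one)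
      then show "x = y" using kh[OF xy(1)] kh[OF xy(2)] by (metis prod.inject)
    qed
    fix E :: "'c monoid" and a assume E: "group E" "a \<in> hom E G" "inj_on a (carrier E)"
    interpret E: group_hom E G a using E by (simp add: group_hom_def group_hom_axioms_def is_group)
    let ?I = "a ` carrier E"
    have I: "subgroup ?I G" by (rule E.img_is_subgroup)
    \<comment> \<open>The representatives \<open>R\<close> of the right cosets of the image
      \<open>?I\<close> of \<open>E\<close> make \<open>G\<close>, as a set with left action of
      \<open>E\<close>, a product \<open>E \<times> R\<close>.\<close>
    define rep where "rep g = (SOME r. r \<in> ?I #> g)" for g
    have rep: "rep g \<in> ?I #> g" if "g \<in> carrier G" for g
      unfolding rep_def using rcos_self[OF that I] by (rule someI)
    define R where "R = rep ` carrier G"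
    have R_ex: "\<exists>r\<in>R. \<exists>x\<in>carrier E. g = a x \<otimes> r" if g: "g \<in> carrier G" for g
    proof -
      obtain x where x: "x \<in> carrier E" "rep g = a x \<otimes> g"
        using rep[OF g] by (auto simp: r_coset_def)
      then have "g = a (inv\<^bsub>E\<^esub> x) \<otimes> rep g"
        using g by (simp add: inv_cancel_left)
      moreover have "rep g \<in> R" using g by (auto simp: R_def)
      moreover have "inv\<^bsub>E\<^esub> x \<in> carrier E" using x by simp
      ultimately show ?thesis by blast
    qed
    have R_coset: "r = rep r \<and> r \<in> carrier G" if rR: "r \<in> R" for r
    proof -
      obtain g where g: "g \<in> carrier G" "r = rep g" using rR by (auto simp: R_def)
      have r: "r \<in> ?I #> g" using rep g by simp
      then have "?I #> g = ?I #> r" using repr_independence[OF _ g(1) I] by simp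
      then have "rep r = rep g" by (simp add: rep_def)
      then show ?thesis
        using g r r_coset_subset_G[OF subgroup.subset[OF I] g(1)] by auto
    qed
    let ?m = "\<lambda>(x, r). a x \<otimes> r"
    have m: "bij_betw ?m (carrier E \<times> R) (carrier G)"
    proof (rule bij_betw_imageI)
      show "inj_on ?m (carrier E \<times> R)"
      proof (rule inj_onI, clarify)
        fix x r y q assume *: "x \<in> carrier E" "y \<in> carrier E" "r \<in> R" "q \<in> R" "a x \<otimes> r = a y \<otimes> q"
        have rq: "r \<in> carrier G" "q \<in> carrier G" using R_coset * by auto
        have "r = inv (a x) \<otimes> (a x \<otimes> r)"
          by (rule inv_cancel_left(1)[symmetric]) (use * rq in auto)
        also have "\<dots> = a (inv\<^bsub>E\<^esub> x \<otimes>\<^bsub>E\<^esub> y) \<otimes> q" using * rq by (simp add: m_assoc)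
        finally have r_eq: "r = a (inv\<^bsub>E\<^esub> x \<otimes>\<^bsub>E\<^esub> y) \<otimes> q" .
        have "inv\<^bsub>E\<^esub> x \<otimes>\<^bsub>E\<^esub> y \<in> carrier E" using *(1,2) by simp
        then have "r \<in> ?I #> q" using r_eq unfolding r_coset_def by blast
        then have "?I #> q = ?I #> r" using repr_independence[OF _ rq(2) I] by simp
        then have "rep q = rep r" by (simp add: rep_def)
        then have rq': "r = q" using R_coset * by metis
        then have "a x = a y" using * rq by simp
        then show "x = y \<and> r = q" using rq' E(3) * by (auto dest: inj_onD)
      qed
      show "?m ` (carrier E \<times> R) = carrier G"
        using R_ex R_coset by (fastforce simp: image_iff)
    qed
    \<comment> \<open>The orbits of \<open>E\<close> are indexed by
      \<open>R \<times> 'a list\<close>. As \<open>R\<close> is nonempty, \<open>k'\<close> renames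
      them by \<open>'a list\<close> alone, an index set that is the same for every
      \<open>E\<close>.\<close>
    obtain g0 where "g0 \<in> R" using R_ex[OF one_closed] by auto
    then obtain k' where k': "bij_betw k' (R \<times> (UNIV :: 'a list set)) (UNIV :: 'a list set)"
      using bij_betw_Times_lists[of R] by auto
    define q where "q = inv_into (R \<times> UNIV) k'"
    have q: "bij_betw q UNIV (R \<times> UNIV)" unfolding q_def using k' by (rule bij_betw_inv_into)
    define \<beta> where "\<beta> = (\<lambda>(x, l). h (a x \<otimes> fst (q l), snd (q l)))"
    have qR: "fst (q l) \<in> R" for l using bij_betwE[OF q] by (simp add: mem_Times_iff)
    have "bij_betw \<beta> (carrier E \<times> (UNIV :: 'a list set)) UNIV"
    proof -
      have q': "q (k' (r, l)) = (r, l)" if "r \<in> R" for r l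
        using k' that by (simp add: q_def bij_betw_def)
      have k'q: "k' (q l) = l" for l
        using k' by (simp add: q_def bij_betw_def f_inv_into_f)
      have 1: "bij_betw (\<lambda>(x, l). ((x, fst (q l)), snd (q l))) (carrier E \<times> UNIV) ((carrier E \<times> R) \<times> UNIV)"
        by (rule bij_betwI[where g = "\<lambda>((x, r), l). (x, k' (r, l))"]) (auto simp: q' k'q qR)
      have 2: "bij_betw (map_prod ?m id) ((carrier E \<times> R) \<times> (UNIV :: 'a list set)) (carrier G \<times> UNIV)"
        by (rule bij_betw_map_prod[OF m]) simp
      have "\<beta> = h \<circ> (map_prod ?m id \<circ> (\<lambda>(x, l). ((x, fst (q l)), snd (q l))))"
        by (auto simp: \<beta>_def split_beta)
      then show ?thesis using bij_betw_trans[OF bij_betw_trans[OF 1 2] h] by simp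
    qed
    moreover have "\<theta> (a x) (\<beta> (y, l)) = \<beta> (x \<otimes>\<^bsub>E\<^esub> y, l)"
      if "x \<in> carrier E" "y \<in> carrier E" for x y l
      using that qR[of l] R_coset by (simp add: \<beta>_def \<theta>h m_assoc)
    ultimately show "\<exists>\<beta>. bij_betw \<beta> (carrier E \<times> (UNIV :: 'a list set)) UNIV \<and>
        (\<forall>x\<in>carrier E. \<forall>y\<in>carrier E. \<forall>l. \<theta> (a x) (\<beta> (y, l)) = \<beta> (x \<otimes>\<^bsub>E\<^esub> y, l))"
      by blast
  qed
qed

text \<open>All vertex groups act faithfully on \<open>'a list\<close>. The two images of an edge
  group act there in isomorphic ways, both being left multiplication on the edge group times
  \<open>'a list\<close>, so a permutation \<open>s e\<close> intertwines them. Hence the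
  fundamental group acts on \<open>'a list\<close>, and each vertex group acts through a conjugate
  of its faithful action.\<close>

lemma (in fundamental_group_setup) \<iota>_inj:
  assumes v: "v \<in> verts \<Gamma>"
  shows "inj_on (\<iota> v) (carrier (Gv v))"
proof -
  let ?Q = "\<lambda>(v :: 'v) (\<theta> :: 'a \<Rightarrow> 'a list \<Rightarrow> 'a list). \<theta> \<in> hom (Gv v) perm_group \<and> inj_on \<theta> (carrier (Gv v)) \<and>
    (\<forall>E :: 'b monoid. \<forall>a. group E \<longrightarrow> a \<in> hom E (Gv v) \<longrightarrow> inj_on a (carrier E) \<longrightarrow>
      (\<exists>\<beta>. bij_betw \<beta> (carrier E \<times> (UNIV :: 'a list set)) UNIV \<and>
        (\<forall>x\<in>carrier E. \<forall>y\<in>carrier E. \<forall>l. \<theta> (a x) (\<beta> (y, l)) = \<beta> (x \<otimes>\<^bsub>E\<^esub> y, l))))"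
  have "\<exists>\<theta> :: 'a \<Rightarrow> 'a list \<Rightarrow> 'a list. ?Q v \<theta>" if "v \<in> verts \<Gamma>" for v
    using group.free_permutation_rep[OF group_Gv[OF that], where 'c = 'b] by metis
  then obtain \<theta> :: "'v \<Rightarrow> 'a \<Rightarrow> 'a list \<Rightarrow> 'a list" where \<theta>: "\<And>v. v \<in> verts \<Gamma> \<Longrightarrow> ?Q v (\<theta> v)"
    by metis
  have \<theta>_free: "\<exists>\<beta>. bij_betw \<beta> (carrier E \<times> (UNIV :: 'a list set)) UNIV \<and>
      (\<forall>x\<in>carrier E. \<forall>y\<in>carrier E. \<forall>l. \<theta> v (a x) (\<beta> (y, l)) = \<beta> (x \<otimes>\<^bsub>E\<^esub> y, l))"
    if "v \<in> verts \<Gamma>" "group E" "a \<in> hom E (Gv v)" "inj_on a (carrier E)" for v a and E :: "'b monoid"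
    using \<theta>[OF that(1)] that(2-) by blast
  have "\<exists>s. bij s \<and> (\<forall>a\<in>carrier (Ge e). s \<circ> \<theta> (head \<Gamma> e) (\<alpha> (bar e) a) = \<theta> (tail \<Gamma> e) (\<alpha> e a) \<circ> s)"
    if e: "e \<in> P" for e
  proof -
    have eA: "e \<in> arcs \<Gamma>" "bar e \<in> arcs \<Gamma>" using P_arcs e by auto
    interpret E: group "Ge e" using eA(1) by (rule group_Ge)
    obtain \<beta> where \<beta>: "bij_betw \<beta> (carrier (Ge e) \<times> (UNIV :: 'a list set)) UNIV"
      "\<And>x y l. x \<in> carrier (Ge e) \<Longrightarrow> y \<in> carrier (Ge e) \<Longrightarrow>
         \<theta> (tail \<Gamma> e) (\<alpha> e x) (\<beta> (y, l)) = \<beta> (x \<otimes>\<^bsub>Ge e\<^esub> y, l)"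
      using \<theta>_free[OF head_in_verts_P(2)[OF e] E.is_group \<alpha>_hom[OF eA(1)] \<alpha>_inj[OF eA(1)]] by blast
    obtain \<gamma> where \<gamma>: "bij_betw \<gamma> (carrier (Ge e) \<times> (UNIV :: 'a list set)) UNIV"
      "\<And>x y l. x \<in> carrier (Ge e) \<Longrightarrow> y \<in> carrier (Ge e) \<Longrightarrow>
         \<theta> (head \<Gamma> e) (\<alpha> (bar e) x) (\<gamma> (y, l)) = \<gamma> (x \<otimes>\<^bsub>Ge e\<^esub> y, l)"
      using \<theta>_free[OF head_in_verts_P(1)[OF e] E.is_group \<alpha>_bar_hom[OF eA(1)]]
        \<alpha>_inj[OF eA(2)] Ge_bar[OF eA(1)] by auto
    define s where "s = \<beta> \<circ> inv_into (carrier (Ge e) \<times> UNIV) \<gamma>"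
    have s\<gamma>: "s (\<gamma> (y, l)) = \<beta> (y, l)" if "y \<in> carrier (Ge e)" for y l
      using \<gamma>(1) that by (simp add: s_def bij_betw_def)
    have "bij s"
      unfolding s_def using \<beta>(1) \<gamma>(1) bij_betw_inv_into bij_betw_trans by blast
    moreover have "s \<circ> \<theta> (head \<Gamma> e) (\<alpha> (bar e) a) = \<theta> (tail \<Gamma> e) (\<alpha> e a) \<circ> s" if a: "a \<in> carrier (Ge e)" for a
    proof
      fix z
      have "z \<in> \<gamma> ` (carrier (Ge e) \<times> UNIV)" using \<gamma>(1) by (simp add: bij_betw_def)
      then obtain y l where "y \<in> carrier (Ge e)" "z = \<gamma> (y, l)" by auto
      then show "(s \<circ> \<theta> (head \<Gamma> e) (\<alpha> (bar e) a)) z = (\<theta> (tail \<Gamma> e) (\<alpha> e a) \<circ> s) z"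
        using a by (simp add: s\<gamma> \<beta>(2) \<gamma>(2))
    qed
    ultimately show ?thesis by blast
  qed
  then obtain s where s: "\<And>e. e \<in> P \<Longrightarrow> bij (s e)"
    "\<And>e a. e \<in> P \<Longrightarrow> a \<in> carrier (Ge e) \<Longrightarrow>
       s e \<circ> \<theta> (head \<Gamma> e) (\<alpha> (bar e) a) = \<theta> (tail \<Gamma> e) (\<alpha> e a) \<circ> s e"
    by metis
  obtain \<Theta> w where \<Theta>: "\<Theta> \<in> hom FG perm_group" "\<And>v. w v \<in> carrier perm_group"
    "\<And>v g. v \<in> verts \<Gamma> \<Longrightarrow> g \<in> carrier (Gv v) \<Longrightarrow>
      \<Theta> (\<iota> v g) = w v \<otimes>\<^bsub>perm_group\<^esub> \<theta> v g \<otimes>\<^bsub>perm_group\<^esub> inv\<^bsub>perm_group\<^esub> w v"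
    by (rule FG_hom_conj[OF group_perm_group, of \<theta> s]) (use \<theta> s in auto)
  interpret W: group "perm_group :: ('a list \<Rightarrow> 'a list) monoid" by (rule group_perm_group)
  show ?thesis
  proof (rule inj_onI)
    fix g h assume gh: "g \<in> carrier (Gv v)" "h \<in> carrier (Gv v)" "\<iota> v g = \<iota> v h"
    have c: "\<theta> v x \<in> carrier perm_group" if "x \<in> carrier (Gv v)" for x
      using \<theta>[OF v] that by (auto simp: hom_def)
    have eq: "w v \<otimes>\<^bsub>perm_group\<^esub> \<theta> v g \<otimes>\<^bsub>perm_group\<^esub> inv\<^bsub>perm_group\<^esub> w v
        = w v \<otimes>\<^bsub>perm_group\<^esub> \<theta> v h \<otimes>\<^bsub>perm_group\<^esub> inv\<^bsub>perm_group\<^esub> w v"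
      using \<Theta>(3)[OF v] gh by metis
    have cancel: "inv\<^bsub>perm_group\<^esub> w v \<otimes>\<^bsub>perm_group\<^esub>
        (w v \<otimes>\<^bsub>perm_group\<^esub> x \<otimes>\<^bsub>perm_group\<^esub> inv\<^bsub>perm_group\<^esub> w v) \<otimes>\<^bsub>perm_group\<^esub> w v = x"
      if "x \<in> carrier perm_group" for x
      using that \<Theta>(2)[of v] by (simp add: W.group_simps del: perm_group_simps)
    have "\<theta> v g = \<theta> v h"
      using eq cancel[OF c[OF gh(1)]] cancel[OF c[OF gh(2)]] by metis
    then show "g = h" using \<theta>[OF v] gh by (auto dest: inj_onD)
  qed
qed

section \<open>Permutational wreath products\<close>

text \<open>The pair \<open>(p, m)\<close> stands for the permutation of \<open>I \<times> M\<close>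
  that sends \<open>(i, x)\<close> to \<open>(p i, m i \<otimes> x)\<close>, and multiplication is
  composition of these maps; the coordinates \<open>m\<close> are therefore indexed by the block
  from which a point comes.\<close>

definition wreath :: "'i set \<Rightarrow> ('m, 'z) monoid_scheme \<Rightarrow> (('i \<Rightarrow> 'i) \<times> ('i \<Rightarrow> 'm)) monoid" where
  "wreath I M = \<lparr>carrier = {p. p permutes I} \<times> (I \<rightarrow>\<^sub>E carrier M),
     monoid.mult = (\<lambda>a b. (fst a \<circ> fst b, \<lambda>i\<in>I. snd a (fst b i) \<otimes>\<^bsub>M\<^esub> snd b i)),
     monoid.one = (id, \<lambda>i\<in>I. \<one>\<^bsub>M\<^esub>)\<rparr>"

lemma wreath_carrier: "w \<in> carrier (wreath I M) \<longleftrightarrow> fst w permutes I \<and> snd w \<in> I \<rightarrow>\<^sub>E carrier M"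
  by (cases w) (simp add: wreath_def)

lemma wreath_mult: "a \<otimes>\<^bsub>wreath I M\<^esub> b = (fst a \<circ> fst b, \<lambda>i\<in>I. snd a (fst b i) \<otimes>\<^bsub>M\<^esub> snd b i)"
  by (simp add: wreath_def)

lemma wreath_one: "\<one>\<^bsub>wreath I M\<^esub> = (id, \<lambda>i\<in>I. \<one>\<^bsub>M\<^esub>)"
  by (simp add: wreath_def)

lemma wreath_closed:
  assumes "w \<in> carrier (wreath I M)"
  shows "i \<in> I \<Longrightarrow> fst w i \<in> I" "i \<in> I \<Longrightarrow> snd w i \<in> carrier M"
  using assms by (auto simp: wreath_carrier permutes_in_image)

lemma wreath_eqI:
  assumes "a \<in> carrier (wreath I M)" "b \<in> carrier (wreath I M)"
    and "\<And>i. i \<in> I \<Longrightarrow> fst a i = fst b i" "\<And>i. i \<in> I \<Longrightarrow> snd a i = snd b i"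
  shows "a = b"
proof (rule prod_eqI)
  show "fst a = fst b"
  proof
    show "fst a i = fst b i" for i
      using assms by (cases "i \<in> I") (auto simp: wreath_carrier permutes_not_in)
  qed
  show "snd a = snd b"
    using assms(1,2) assms(4) unfolding wreath_carrier by (meson PiE_ext)
qed

lemma group_wreath:
  assumes "group M" shows "group (wreath I M)"
proof (rule groupI)
  interpret M: group M by fact
  show "\<one>\<^bsub>wreath I M\<^esub> \<in> carrier (wreath I M)"
    by (simp add: wreath_carrier wreath_one permutes_id)
  have cl: "a \<otimes>\<^bsub>wreath I M\<^esub> b \<in> carrier (wreath I M)"
    if "a \<in> carrier (wreath I M)" "b \<in> carrier (wreath I M)" for a b
    using that wreath_closed[OF that(1)] wreath_closed[OF that(2)]
    by (auto simp: wreath_carrier wreath_mult intro: permutes_compose)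
  then show "a \<otimes>\<^bsub>wreath I M\<^esub> b \<in> carrier (wreath I M)"
    if "a \<in> carrier (wreath I M)" "b \<in> carrier (wreath I M)" for a b using that by blast
  show "a \<otimes>\<^bsub>wreath I M\<^esub> b \<otimes>\<^bsub>wreath I M\<^esub> c = a \<otimes>\<^bsub>wreath I M\<^esub> (b \<otimes>\<^bsub>wreath I M\<^esub> c)"
    if "a \<in> carrier (wreath I M)" "b \<in> carrier (wreath I M)" "c \<in> carrier (wreath I M)" for a b c
    using wreath_closed[OF that(1)] wreath_closed[OF that(2)] wreath_closed[OF that(3)]
    by (intro wreath_eqI[of _ I M] cl that) (simp_all add: wreath_mult M.m_assoc)
  show "\<one>\<^bsub>wreath I M\<^esub> \<otimes>\<^bsub>wreath I M\<^esub> a = a" if "a \<in> carrier (wreath I M)" for a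
    using that wreath_closed[OF that] \<open>\<one>\<^bsub>wreath I M\<^esub> \<in> carrier (wreath I M)\<close>
    by (intro wreath_eqI[of _ I M] cl that) (simp_all add: wreath_mult wreath_one)
  show "\<exists>b\<in>carrier (wreath I M). b \<otimes>\<^bsub>wreath I M\<^esub> a = \<one>\<^bsub>wreath I M\<^esub>"
    if a: "a \<in> carrier (wreath I M)" for a
  proof
    let ?p = "inv_into UNIV (fst a)"
    let ?b = "(?p, \<lambda>i\<in>I. inv\<^bsub>M\<^esub> snd a (?p i))"
    have p: "?p permutes I" using a by (simp add: wreath_carrier permutes_inv)
    then show b: "?b \<in> carrier (wreath I M)"
      using wreath_closed[OF a] by (simp add: wreath_carrier permutes_in_image)
    have "?p (fst a i) = i" for i
      using a permutes_inverses(2)[of "fst a" I] by (simp add: wreath_carrier)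
    then show "?b \<otimes>\<^bsub>wreath I M\<^esub> a = \<one>\<^bsub>wreath I M\<^esub>"
      using wreath_closed[OF a]
      by (auto simp: wreath_mult wreath_one fun_eq_iff)
  qed
qed

text \<open>A homomorphism to a wreath product is an action \<open>p\<close> on the index set
  together with a cocycle \<open>c\<close> over it. That each \<open>p u\<close> is a permutation
  follows from the action laws.\<close>

lemma wreath_homI:
  fixes p :: "'u \<Rightarrow> 'i \<Rightarrow> 'i"
  assumes "group U" "group M"
    and p: "\<And>u i. u \<in> carrier U \<Longrightarrow> i \<in> I \<Longrightarrow> p u i \<in> I"
    and c: "\<And>u i. u \<in> carrier U \<Longrightarrow> i \<in> I \<Longrightarrow> c u i \<in> carrier M"
    and p_one: "\<And>i. i \<in> I \<Longrightarrow> p \<one>\<^bsub>U\<^esub> i = i"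
    and p_mult: "\<And>u v i. u \<in> carrier U \<Longrightarrow> v \<in> carrier U \<Longrightarrow> i \<in> I \<Longrightarrow>
      p (u \<otimes>\<^bsub>U\<^esub> v) i = p u (p v i)"
    and c_mult: "\<And>u v i. u \<in> carrier U \<Longrightarrow> v \<in> carrier U \<Longrightarrow> i \<in> I \<Longrightarrow>
      c (u \<otimes>\<^bsub>U\<^esub> v) i = c u (p v i) \<otimes>\<^bsub>M\<^esub> c v i"
  shows "(\<lambda>u. (\<lambda>i. if i \<in> I then p u i else i, \<lambda>i\<in>I. c u i)) \<in> hom U (wreath I M)"
proof (rule homI)
  interpret U: group U by fact
  interpret W: group "wreath I M" by (rule group_wreath) fact
  let ?w = "\<lambda>u. (\<lambda>i. if i \<in> I then p u i else i, \<lambda>i\<in>I. c u i)"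
  have cl: "?w u \<in> carrier (wreath I M)" if u: "u \<in> carrier U" for u
  proof -
    have "bij_betw (\<lambda>i. if i \<in> I then p u i else i) I I"
      by (rule bij_betwI[where g = "p (inv\<^bsub>U\<^esub> u)"])
        (use u p p_mult[of u "inv\<^bsub>U\<^esub> u"] p_mult[of "inv\<^bsub>U\<^esub> u" u] p_one in auto)
    then have "(\<lambda>i. if i \<in> I then p u i else i) permutes I"
      by (rule bij_imp_permutes) simp
    then show ?thesis using c u by (simp add: wreath_carrier)
  qed
  then show "?w u \<in> carrier (wreath I M)" if "u \<in> carrier U" for u using that by blast
  show "?w (u \<otimes>\<^bsub>U\<^esub> v) = ?w u \<otimes>\<^bsub>wreath I M\<^esub> ?w v" if "u \<in> carrier U" "v \<in> carrier U" for u v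
    using that p by (intro wreath_eqI[OF cl W.m_closed[OF cl cl]]) (simp_all add: wreath_mult p_mult c_mult)
qed

lemma wreath_hom_pointwise:
  assumes "\<theta> \<in> hom U (wreath I M)" "u \<in> carrier U" "v \<in> carrier U" "i \<in> I"
  shows "fst (\<theta> (u \<otimes>\<^bsub>U\<^esub> v)) i = fst (\<theta> u) (fst (\<theta> v) i)"
    "snd (\<theta> (u \<otimes>\<^bsub>U\<^esub> v)) i = snd (\<theta> u) (fst (\<theta> v) i) \<otimes>\<^bsub>M\<^esub> snd (\<theta> v) i"
  using assms by (simp_all add: hom_mult wreath_mult)

text \<open>The factor \<open>d i\<close> moves the base point of the block \<open>i\<close>.\<close>

lemma wreath_transport:
  assumes "group U" "group M" and \<theta>: "\<theta> \<in> hom U (wreath I M)"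
    and b: "inj_on b I" "b ` I \<subseteq> J" and d: "\<And>i. i \<in> I \<Longrightarrow> d i \<in> carrier M"
  obtains \<theta>' where "\<theta>' \<in> hom U (wreath J M)"
    "\<And>u i. u \<in> carrier U \<Longrightarrow> i \<in> I \<Longrightarrow> fst (\<theta>' u) (b i) = b (fst (\<theta> u) i)"
    "\<And>u i. u \<in> carrier U \<Longrightarrow> i \<in> I \<Longrightarrow>
      snd (\<theta>' u) (b i) = d (fst (\<theta> u) i) \<otimes>\<^bsub>M\<^esub> snd (\<theta> u) i \<otimes>\<^bsub>M\<^esub> inv\<^bsub>M\<^esub> d i"
    "\<And>u. u \<in> carrier U \<Longrightarrow> \<theta> u = \<one>\<^bsub>wreath I M\<^esub> \<Longrightarrow> \<theta>' u = \<one>\<^bsub>wreath J M\<^esub>"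
proof -
  interpret U: group U by fact
  interpret M: group M by fact
  interpret W: group "wreath I M" by (rule group_wreath) fact
  interpret W': group "wreath J M" by (rule group_wreath) fact
  interpret \<theta>: group_hom U "wreath I M" \<theta>
    using \<theta> by unfold_locales
  define b' where "b' = inv_into I b"
  have b'b: "b' (b i) = i" if "i \<in> I" for i using b that by (simp add: b'_def)
  define p where "p u j = (if j \<in> b ` I then b (fst (\<theta> u) (b' j)) else j)" for u j
  define c where "c u j = (if j \<in> b ` I then
    d (fst (\<theta> u) (b' j)) \<otimes>\<^bsub>M\<^esub> snd (\<theta> u) (b' j) \<otimes>\<^bsub>M\<^esub> inv\<^bsub>M\<^esub> d (b' j) else \<one>\<^bsub>M\<^esub>)" for u j
  have pb: "p u (b i) = b (fst (\<theta> u) i)"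
    "c u (b i) = d (fst (\<theta> u) i) \<otimes>\<^bsub>M\<^esub> snd (\<theta> u) i \<otimes>\<^bsub>M\<^esub> inv\<^bsub>M\<^esub> d i" if "i \<in> I" for u i
    using that by (simp_all add: p_def c_def b'b)
  have p_out: "p u j = j" "c u j = \<one>\<^bsub>M\<^esub>" if "j \<notin> b ` I" for u j
    using that by (simp_all add: p_def c_def)
  let ?\<theta> = "\<lambda>u. (\<lambda>j. if j \<in> J then p u j else j, \<lambda>j\<in>J. c u j)"
  note cl = wreath_closed[OF \<theta>.hom_closed]
  have hom: "?\<theta> \<in> hom U (wreath J M)"
  proof (rule wreath_homI[OF \<open>group U\<close> \<open>group M\<close>])
    show "p u j \<in> J" if "u \<in> carrier U" "j \<in> J" for u j
      using that b cl by (auto simp: p_def b'b)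
    show "c u j \<in> carrier M" if "u \<in> carrier U" "j \<in> J" for u j
      using that d cl by (auto simp: c_def b'b)
    show "p \<one>\<^bsub>U\<^esub> j = j" if "j \<in> J" for j
      using that by (auto simp: p_def b'b wreath_one)
    show "p (u \<otimes>\<^bsub>U\<^esub> v) j = p u (p v j)" if "u \<in> carrier U" "v \<in> carrier U" "j \<in> J" for u v j
      using that cl by (cases "j \<in> b ` I") (auto simp: pb p_out wreath_mult)
    show "c (u \<otimes>\<^bsub>U\<^esub> v) j = c u (p v j) \<otimes>\<^bsub>M\<^esub> c v j" if "u \<in> carrier U" "v \<in> carrier U" "j \<in> J" for u v j
      using that cl d by (cases "j \<in> b ` I") (auto simp: pb p_out wreath_mult M.group_simps)
  qed
  show thesis
  proof (rule that[OF hom])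
    fix u assume u: "u \<in> carrier U" "\<theta> u = \<one>\<^bsub>wreath I M\<^esub>"
    show "?\<theta> u = \<one>\<^bsub>wreath J M\<^esub>"
    proof (rule wreath_eqI)
      show "?\<theta> u \<in> carrier (wreath J M)" using hom u(1) by (rule hom_in_carrier)
      show "\<one>\<^bsub>wreath J M\<^esub> \<in> carrier (wreath J M)" by (rule W'.one_closed)
    qed (use u(2) d in \<open>auto simp: wreath_one p_def c_def b'b\<close>)
  qed (use b in \<open>auto simp: p_def c_def b'b\<close>)
qed

text \<open>Since \<open>I\<close> is finite, the complements of \<open>D\<close> and of its image
  have equally many elements, and any bijection between them completes \<open>\<sigma>\<close>. The
  coordinates outside \<open>D\<close> are set to one.\<close>

lemma wreath_partial_extend:
  assumes "group M" "finite I" "D \<subseteq> I" "inj_on \<sigma> D" "\<sigma> ` D \<subseteq> I" "\<And>i. i \<in> D \<Longrightarrow> c i \<in> carrier M"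
  obtains w where "w \<in> carrier (wreath I M)" "\<And>i. i \<in> D \<Longrightarrow> fst w i = \<sigma> i \<and> snd w i = c i"
proof -
  interpret M: group M by fact
  have "card (I - D) = card (I - \<sigma> ` D)"
    using assms by (simp add: card_Diff_subset finite_subset card_image)
  then obtain f where f: "bij_betw f (I - D) (I - \<sigma> ` D)"
    using assms(2) finite_same_card_bij by blast
  let ?p = "\<lambda>i. if i \<in> I then if i \<in> D then \<sigma> i else f i else i"
  have "bij_betw (\<lambda>i. if i \<in> D then \<sigma> i else f i) (D \<union> (I - D)) (\<sigma> ` D \<union> (I - \<sigma> ` D))"
  proof (rule bij_betw_combine)
    have "bij_betw \<sigma> D (\<sigma> ` D)" using assms(4) by (rule inj_on_imp_bij_betw)
    then show "bij_betw (\<lambda>i. if i \<in> D then \<sigma> i else f i) D (\<sigma> ` D)"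
      by (rule bij_betw_cong[THEN iffD1, rotated]) simp
    show "bij_betw (\<lambda>i. if i \<in> D then \<sigma> i else f i) (I - D) (I - \<sigma> ` D)"
      using f by (rule bij_betw_cong[THEN iffD1, rotated]) simp
  qed auto
  moreover have "D \<union> (I - D) = I" "\<sigma> ` D \<union> (I - \<sigma> ` D) = I" using assms by auto
  ultimately have "bij_betw (\<lambda>i. if i \<in> D then \<sigma> i else f i) I I" by simp
  then have "bij_betw ?p I I"
    by (rule bij_betw_cong[THEN iffD1, rotated]) simp
  then have "?p permutes I" by (rule bij_imp_permutes) simp
  then show thesis
    using assms by (intro that[of "(?p, \<lambda>i\<in>I. if i \<in> D then c i else \<one>\<^bsub>M\<^esub>)"]) (auto simp: wreath_carrier)
qed


section \<open>Transversals and induced actions\<close>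

text \<open>\<open>rep u\<close> is the chosen representative of the left coset of \<open>u\<close>.
  As a function on the whole group it lets the action on cosets be written as
  \<open>rep (u \<otimes> r)\<close>. The representative of \<open>K\<close> itself need not be
  \<open>\<one>\<close>.\<close>

locale left_transversal = group G + subgroup K G for K and G (structure) +
  fixes rep :: "'a \<Rightarrow> 'a"
  assumes rep_closed [simp]: "u \<in> carrier G \<Longrightarrow> rep u \<in> carrier G"
    and rep_coset: "u \<in> carrier G \<Longrightarrow> inv (rep u) \<otimes> u \<in> K"
    and rep_eqI: "u \<in> carrier G \<Longrightarrow> v \<in> carrier G \<Longrightarrow> inv u \<otimes> v \<in> K \<Longrightarrow> rep u = rep v"
    and rep_finite: "finite (rep ` carrier G)"
begin

lemma rep_eqD:
  assumes "u \<in> carrier G" "v \<in> carrier G" "rep u = rep v"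
  shows "inv u \<otimes> v \<in> K"
proof -
  have "inv (inv (rep u) \<otimes> u) \<otimes> (inv (rep v) \<otimes> v) \<in> K"
    using rep_coset[OF assms(1)] rep_coset[OF assms(2)] by blast
  then show ?thesis using assms by (simp add: group_simps)
qed

lemma rep_rep [simp]: "u \<in> carrier G \<Longrightarrow> rep (rep u) = rep u"
  by (rule rep_eqI) (simp_all add: rep_coset)

lemma rep_mult_rep:
  assumes "u \<in> carrier G" "r \<in> carrier G" shows "rep (u \<otimes> rep r) = rep (u \<otimes> r)"
  using assms rep_coset[of r] by (intro rep_eqI) (simp_all add: group_simps)

text \<open>The element \<open>k\<close> of \<open>K\<close> with
  \<open>u \<otimes> r = rep (u \<otimes> r) \<otimes> k\<close>. These are the coordinates of a
  representation induced from \<open>K\<close>, and also the Schreier generators of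
  \<open>K\<close>.\<close>

definition cocyc :: "'a \<Rightarrow> 'a \<Rightarrow> 'a" where
  "cocyc u r = inv (rep (u \<otimes> r)) \<otimes> (u \<otimes> r)"

lemma cocyc_closed: "u \<in> carrier G \<Longrightarrow> r \<in> carrier G \<Longrightarrow> cocyc u r \<in> K"
  by (simp add: cocyc_def rep_coset)

lemma cocyc_mult:
  assumes "u \<in> carrier G" "v \<in> carrier G" "r \<in> carrier G"
  shows "cocyc (u \<otimes> v) r = cocyc u (rep (v \<otimes> r)) \<otimes> cocyc v r"
  using assms by (simp add: cocyc_def group_simps rep_mult_rep)

end

text \<open>Inversion exchanges left and right cosets, so representatives of the right cosets, of
  which there are finitely many by assumption, are chosen and inverted.\<close>

lemma (in group) left_transversal_exists:
  assumes "finite_index G K"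
  obtains rep where "left_transversal K G rep"
proof
  interpret K: subgroup K G using assms by (rule finite_index_subgroup)
  define s where "s C = (SOME r. r \<in> C)" for C :: "'a set"
  define rep where "rep u = inv (s (K #> inv u))" for u
  have s: "s (K #> inv u) \<in> K #> inv u" if "u \<in> carrier G" for u
    unfolding s_def using rcos_self[OF inv_closed[OF that] K.subgroup_axioms] by (rule someI)
  show "left_transversal K G rep"
  proof
    fix u assume u: "u \<in> carrier G"
    obtain k where k: "k \<in> K" "s (K #> inv u) = k \<otimes> inv u"
      using s[OF u] by (auto simp: r_coset_def)
    then show "rep u \<in> carrier G" "inv (rep u) \<otimes> u \<in> K"
      using u by (auto simp: rep_def m_assoc)
    show "rep u = rep v" if "v \<in> carrier G" "inv u \<otimes> v \<in> K" for v
      using rcos_eqI[OF K.subgroup_axioms, of "inv u" "inv v"] that u by (simp add: rep_def)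
  next
    have "rep ` carrier G \<subseteq> (\<lambda>C. inv (s C)) ` ((\<lambda>x. K #> x) ` carrier G)"
      by (auto simp: rep_def)
    then show "finite (rep ` carrier G)"
      using finite_index_cosets[OF assms] by (meson finite_imageI finite_subset)
  qed
qed

section \<open>Retractions in (LR) groups\<close>

text \<open>Groups with (LR) are residually finite. If \<open>z\<close> has finite order, the kernel
  of a virtual retraction onto the finite group generated by \<open>z\<close> has finite index and
  does not contain \<open>z\<close>. If \<open>z\<close> has infinite order, a subgroup
  \<open>K\<close> that retracts onto the group generated by the square of \<open>z\<close> cannot
  contain \<open>z\<close>: the image of \<open>z\<close> would be an even power of \<open>z\<close>
  with the same square as \<open>z\<close>.\<close>

lemma (in group) property_LR_avoid_element:
  assumes LR: "property_LR G" and z: "z \<in> carrier G" "z \<noteq> \<one>"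
  shows "\<exists>M. finite_index G M \<and> z \<notin> M"
proof (cases "\<exists>i::int. i \<noteq> 0 \<and> z [^] i = \<one>")
  case True
  let ?C = "generate G {z}"
  obtain i :: int where i: "i \<noteq> 0" "z [^] i = \<one>" using True by auto
  have "z [^] k = z [^] (k mod i)" for k
  proof -
    have "z [^] k = z [^] (i * (k div i) + k mod i)" by simp
    also have "\<dots> = (z [^] i) [^] (k div i) \<otimes> z [^] (k mod i)"
      unfolding int_pow_mult[OF z(1)] using z by (simp add: int_pow_pow)
    finally show ?thesis using z i by (simp add: int_pow_one)
  qed
  \<comment> \<open>The exponent \<open>i\<close> may be negative, so the remainders are placed in a
    symmetric interval.\<close>
  moreover have "k mod i \<in> {- \<bar>i\<bar>..\<bar>i\<bar>}" for k
    using abs_mod_less[OF i(1), of k] by auto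
  ultimately have "z [^] k \<in> (\<lambda>k. z [^] k) ` {- \<bar>i\<bar>..\<bar>i\<bar>}" for k :: int
    by (rule image_eqI)
  then have "?C \<subseteq> (\<lambda>k. z [^] k) ` {- \<bar>i\<bar>..\<bar>i\<bar>}"
    using generate_pow[OF z(1)] by auto
  then have fin: "finite ?C" by (rule finite_subset) simp
  have C: "subgroup ?C G" using z by (simp add: generate_is_subgroup)
  then have "fg_subgroup G ?C"
    unfolding fg_subgroup_def by (auto intro!: exI[of _ "{z}"] generate.incl)
  then obtain K \<rho> where K: "finite_index G K" "?C \<subseteq> K"
    and \<rho>: "\<rho> \<in> hom (G\<lparr>carrier := K\<rparr>) (G\<lparr>carrier := ?C\<rparr>)" "\<forall>h\<in>?C. \<rho> h = h"
    using LR by (auto simp: property_LR_def virtual_retract_def)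
  interpret KG: group "G\<lparr>carrier := K\<rparr>" using K by (intro subgroup_imp_group finite_index_subgroup)
  interpret CG: group "G\<lparr>carrier := ?C\<rparr>" using C by (rule subgroup_imp_group)
  interpret \<rho>: group_hom "G\<lparr>carrier := K\<rparr>" "G\<lparr>carrier := ?C\<rparr>" \<rho> using \<rho> by unfold_locales
  have "finite_index (G\<lparr>carrier := ?C\<rparr>) {\<one>}"
  proof (rule CG.finite_indexI[where f = "\<lambda>x. x"])
    show "subgroup {\<one>} (G\<lparr>carrier := ?C\<rparr>)" using CG.triv_subgroup by simp
    show "x \<otimes>\<^bsub>G\<lparr>carrier := ?C\<rparr>\<^esub> inv\<^bsub>G\<lparr>carrier := ?C\<rparr>\<^esub> y \<in> {\<one>}"
      if "x \<in> carrier (G\<lparr>carrier := ?C\<rparr>)" "y \<in> carrier (G\<lparr>carrier := ?C\<rparr>)" "x = y" for x y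
      using CG.r_inv[of y] that by simp
  qed (use fin in simp)
  then have "finite_index (G\<lparr>carrier := K\<rparr>) {x \<in> K. \<rho> x \<in> {\<one>}}"
    using \<rho>.finite_index_vimage[of "{\<one>}"] by simp
  then have "finite_index G {x \<in> K. \<rho> x \<in> {\<one>}}" by (rule finite_index_trans[OF K(1)])
  moreover have "z \<in> ?C" by (auto intro: generate.incl)
  then have "z \<notin> {x \<in> K. \<rho> x \<in> {\<one>}}" using \<rho> z by auto
  ultimately show ?thesis by blast
next
  case False
  let ?y = "z [^] (2::int)"
  let ?C = "generate G {?y}"
  have y: "?y \<in> carrier G" "?y \<in> ?C" using z by (auto intro: generate.incl)
  have C: "subgroup ?C G" using y by (intro generate_is_subgroup) simp
  then have "fg_subgroup G ?C"
    unfolding fg_subgroup_def by (auto intro!: exI[of _ "{?y}"] generate.incl)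
  then obtain K \<rho> where K: "finite_index G K" "?C \<subseteq> K"
    and \<rho>: "\<rho> \<in> hom (G\<lparr>carrier := K\<rparr>) (G\<lparr>carrier := ?C\<rparr>)" "\<forall>h\<in>?C. \<rho> h = h"
    using LR by (auto simp: property_LR_def virtual_retract_def)
  have "z \<notin> K"
  proof
    assume zK: "z \<in> K"
    then have "\<rho> z \<in> ?C" using \<rho> by (auto simp: hom_def)
    then obtain k :: int where k: "\<rho> z = ?y [^] k" using generate_pow[OF y(1)] by auto
    have "?y = \<rho> ?y" using \<rho> y by simp
    also have "?y = z \<otimes> z" using z int_pow_mult[of z 1 1] by simp
    also have "\<rho> (z \<otimes> z) = \<rho> z \<otimes> \<rho> z" using \<rho> zK by (auto simp: hom_def)
    also have "\<dots> = z [^] (4 * k)"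
      using z by (simp add: k int_pow_pow flip: int_pow_mult)
    finally have "z [^] (4 * k) = z [^] (2::int)" using z int_pow_mult[of z 1 1] by simp
    then have "z [^] (4 * k - 2) = \<one>" using z by (simp add: int_pow_diff)
    then have "4 * k - 2 = 0" using False by blast
    then show False by presburger
  qed
  then show ?thesis using K by blast
qed

text \<open>Subgroups with a virtual retraction are closed in the profinite topology.\<close>

lemma (in group) property_LR_avoid:
  assumes LR: "property_LR G" and L: "fg_subgroup G L" and Z: "finite Z" "Z \<inter> L = {}"
  obtains K \<rho> where "finite_index G K" "L \<subseteq> K" "\<rho> \<in> hom (G\<lparr>carrier := K\<rparr>) (G\<lparr>carrier := L\<rparr>)"
    "\<And>l. l \<in> L \<Longrightarrow> \<rho> l = l" "Z \<inter> K = {}"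
proof -
  obtain K \<rho> where K: "finite_index G K" "L \<subseteq> K"
    and \<rho>: "\<rho> \<in> hom (G\<lparr>carrier := K\<rparr>) (G\<lparr>carrier := L\<rparr>)" "\<forall>l\<in>L. \<rho> l = l"
    using LR L by (auto simp: property_LR_def virtual_retract_def)
  interpret K: subgroup K G using K by (intro finite_index_subgroup)
  interpret L: subgroup L G using L by (simp add: fg_subgroup_def)
  interpret KG: group "G\<lparr>carrier := K\<rparr>" by (rule subgroup_imp_group) (rule K.subgroup_axioms)
  have \<rho>L: "\<rho> k \<in> L" if "k \<in> K" for k using \<rho> that by (auto simp: hom_def)
  have \<rho>m: "\<rho> (k \<otimes> l) = \<rho> k \<otimes> \<rho> l" if "k \<in> K" "l \<in> K" for k l using \<rho> that by (auto simp: hom_def)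
  have \<rho>i: "\<rho> (inv k) = inv (\<rho> k)" if "k \<in> K" for k
    using \<rho>m[of "inv k" k] \<rho>L[of k] \<rho>L[of "inv k"] that \<rho>(2) L.one_closed
    by (intro inv_equality[symmetric]) auto
  have [simp]: "\<rho> k \<in> carrier G" if "k \<in> K" for k using \<rho>L[OF that] by simp
  have "\<exists>M. finite_index G M \<and> inv (\<rho> z) \<otimes> z \<notin> M" if "z \<in> Z \<inter> K" for z
  proof (rule property_LR_avoid_element[OF LR])
    show "inv (\<rho> z) \<otimes> z \<noteq> \<one>"
    proof
      assume "inv (\<rho> z) \<otimes> z = \<one>"
      then have "z = \<rho> z" using that by (metis IntD2 K.mem_carrier \<open>\<And>k. k \<in> K \<Longrightarrow> \<rho> k \<in> carrier G\<close> inv_closed inv_equality inv_inv)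
      then show False using \<rho>L[of z] that Z by auto
    qed
  qed (use that in simp)
  then obtain M where M: "\<And>z. z \<in> Z \<inter> K \<Longrightarrow> finite_index G (M z) \<and> inv (\<rho> z) \<otimes> z \<notin> M z"
    by metis
  have "finite_index G {x \<in> carrier G. \<forall>z\<in>Z \<inter> K. x \<in> M z}"
    using Z M by (intro finite_index_INT) auto
  then obtain Q where Q: "Q \<lhd> G" "finite_index G Q" "Q \<subseteq> {x \<in> carrier G. \<forall>z\<in>Z \<inter> K. x \<in> M z}"
    by (rule finite_index_normal_core)
  interpret Q: normal Q G by fact
  \<comment> \<open>An element \<open>k\<close> of \<open>K\<close> is in \<open>L\<close> iff
    \<open>\<rho> k = k\<close>. \<open>?K\<close> asks for this only modulo the normal finite index
    subgroup \<open>Q\<close>, which was chosen so that \<open>\<rho> z\<close> and \<open>z\<close>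
    remain different modulo \<open>Q\<close> for all \<open>z\<close> in
    \<open>Z \<inter> K\<close>.\<close>
  let ?K = "{k \<in> K. inv (\<rho> k) \<otimes> k \<in> Q}"
  have fi: "finite_index (G\<lparr>carrier := K\<rparr>) ?K"
  proof (rule KG.finite_indexI[where f = "\<lambda>k. (Q #> k, Q #> \<rho> k)"])
    show "subgroup ?K (G\<lparr>carrier := K\<rparr>)"
    proof (rule KG.subgroupI)
      show "?K \<noteq> {}" using \<rho>(2) L.one_closed by (auto intro!: exI[of _ \<one>])
      fix a b assume a: "a \<in> ?K" and b: "b \<in> ?K"
      have "inv (\<rho> b) \<otimes> (inv (\<rho> a) \<otimes> a) \<otimes> \<rho> b \<in> Q"
        using a b Q.inv_op_closed1[of "\<rho> b" "inv (\<rho> a) \<otimes> a"] by auto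
      then have "(inv (\<rho> b) \<otimes> (inv (\<rho> a) \<otimes> a) \<otimes> \<rho> b) \<otimes> (inv (\<rho> b) \<otimes> b) \<in> Q" using b by auto
      then show "a \<otimes>\<^bsub>G\<lparr>carrier := K\<rparr>\<^esub> b \<in> ?K" using a b by (simp add: \<rho>m group_simps)
      have "\<rho> a \<otimes> inv (inv (\<rho> a) \<otimes> a) \<otimes> inv (\<rho> a) \<in> Q"
        using a Q.inv_op_closed2[of "\<rho> a" "inv (inv (\<rho> a) \<otimes> a)"] by auto
      then show "inv\<^bsub>G\<lparr>carrier := K\<rparr>\<^esub> a \<in> ?K"
        using a by (simp add: m_inv_consistent[OF K.subgroup_axioms] \<rho>i group_simps)
    qed auto
    show "finite ((\<lambda>k. (Q #> k, Q #> \<rho> k)) ` carrier (G\<lparr>carrier := K\<rparr>))"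
      by (rule finite_subset[OF _ finite_cartesian_product[OF finite_index_cosets[OF Q(2)] finite_index_cosets[OF Q(2)]]])
        auto
    fix x y assume "x \<in> carrier (G\<lparr>carrier := K\<rparr>)" "y \<in> carrier (G\<lparr>carrier := K\<rparr>)"
      and eq: "(Q #> x, Q #> \<rho> x) = (Q #> y, Q #> \<rho> y)"
    then have xy: "x \<in> K" "y \<in> K" by auto
    have "x \<otimes> inv y \<in> Q" "\<rho> x \<otimes> inv (\<rho> y) \<in> Q"
      using rcos_eqD[OF Q.subgroup_axioms] eq xy by auto
    then have "inv (\<rho> x \<otimes> inv (\<rho> y)) \<otimes> (x \<otimes> inv y) \<in> Q" by auto
    then show "x \<otimes>\<^bsub>G\<lparr>carrier := K\<rparr>\<^esub> inv\<^bsub>G\<lparr>carrier := K\<rparr>\<^esub> y \<in> ?K"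
      using xy by (simp add: m_inv_consistent[OF K.subgroup_axioms] \<rho>m \<rho>i)
  qed
  show thesis
  proof (rule that)
    show "finite_index G ?K" by (rule finite_index_trans[OF K(1) fi])
    show "L \<subseteq> ?K" using K(2) \<rho>(2) by auto
    show "\<rho> \<in> hom (G\<lparr>carrier := ?K\<rparr>) (G\<lparr>carrier := L\<rparr>)" using \<rho> by (auto simp: hom_def)
    show "Z \<inter> ?K = {}" using M Q(3) by auto
  qed (use \<rho> in auto)
qed

lemma inj_on_extend:
  assumes "finite A" "D \<subseteq> A" "inj_on f D" "f ` D \<subseteq> B" "finite B" "card A \<le> card B"
  obtains g where "inj_on g A" "g ` A \<subseteq> B" "\<And>x. x \<in> D \<Longrightarrow> g x = f x"
proof -
  have "card (A - D) \<le> card (B - f ` D)"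
    using assms by (simp add: card_Diff_subset finite_subset card_image)
  then obtain h where h: "h ` (A - D) \<subseteq> B - f ` D" "inj_on h (A - D)"
    using assms card_le_inj[of "A - D" "B - f ` D"] by auto
  let ?g = "\<lambda>x. if x \<in> D then f x else h x"
  have "inj_on ?g A"
    using h assms(3) by (fastforce simp: inj_on_def)
  moreover have "?g ` A \<subseteq> B" using h assms by auto
  ultimately show thesis by (rule that) simp
qed

section \<open>Virtual retractions modulo the edge group\<close>

text \<open>
  Marshall Hall's completion for one vertex group: each orbit \<open>U a H\<close> is replaced by the action
  induced from a finite index subgroup \<open>K a\<close> of \<open>U\<close>, which retracts onto the finitely generated
  subgroup \<open>L a\<close> of the stabiliser of \<open>a H\<close> that the instances in \<open>\<Delta>\<close> involve.
\<close>

lemma local_extension: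
  fixes U (structure)
  assumes "group U" and F: "group F" and LR: "property_LR U"
    and \<pi>: "\<pi> \<in> hom U F" and N: "fg_subgroup U N"
    and N_conj: "\<And>u n. u \<in> carrier U \<Longrightarrow> n \<in> N \<Longrightarrow> inv u \<otimes> n \<otimes> u \<in> N"
    and \<pi>N: "\<And>n. n \<in> N \<Longrightarrow> \<pi> n = \<one>\<^bsub>F\<^esub>"
    and H: "subgroup H F" and Y: "finite Y" "Y \<subseteq> carrier F"
    and Y_inj: "\<And>y y'. y \<in> Y \<Longrightarrow> y' \<in> Y \<Longrightarrow> inv\<^bsub>F\<^esub> y \<otimes>\<^bsub>F\<^esub> y' \<in> H \<Longrightarrow> y = y'"
    and \<Delta>: "finite \<Delta>" "\<Delta> \<subseteq> carrier U"
    and e: "inj_on e Y" "e ` Y \<subseteq> {..<m :: nat}"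
  shows "\<exists>n0. \<forall>n\<ge>n0. \<exists>\<theta>\<in>hom U (wreath {..<n} (F\<lparr>carrier := H\<rparr>)).
    (\<forall>x\<in>N. \<theta> x = \<one>\<^bsub>wreath {..<n} (F\<lparr>carrier := H\<rparr>)\<^esub>) \<and>
    (\<forall>u\<in>\<Delta>. \<forall>y\<in>Y. \<forall>y'\<in>Y. \<forall>h\<in>H. \<pi> u \<otimes>\<^bsub>F\<^esub> y = y' \<otimes>\<^bsub>F\<^esub> h \<longrightarrow>
      fst (\<theta> u) (e y) = e y' \<and> snd (\<theta> u) (e y) = h)"
proof -
  interpret U: group U by fact
  interpret F: group F by fact
  interpret H: subgroup H F by fact
  interpret \<pi>: group_hom U F \<pi> using \<pi> by unfold_locales
  let ?M = "F\<lparr>carrier := H\<rparr>"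
  have gM: "group ?M" by (rule F.subgroup_imp_group) fact
  interpret M: group ?M by (rule gM)
  have M_inv: "inv\<^bsub>?M\<^esub> h = inv\<^bsub>F\<^esub> h" if "h \<in> H" for h
    using F.m_inv_consistent[OF H that] .
  note YF = subsetD[OF Y(2)]
  \<comment> \<open>\<open>rel y z\<close> says that the cosets of \<open>y\<close> and
    \<open>z\<close> modulo \<open>H\<close> lie in the same orbit of \<open>U\<close>;
    \<open>base\<close> selects one point of \<open>Y\<close> in each orbit.\<close>
  define rel where "rel y z \<longleftrightarrow> (\<exists>u\<in>carrier U. inv\<^bsub>F\<^esub> y \<otimes>\<^bsub>F\<^esub> (\<pi> u \<otimes>\<^bsub>F\<^esub> z) \<in> H)" for y z
  have rel_trans: "rel x z" if r: "rel x y" "rel y z" "x \<in> Y" "y \<in> Y" "z \<in> Y" for x y z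
  proof -
    obtain u v where uv: "u \<in> carrier U" "v \<in> carrier U" "inv\<^bsub>F\<^esub> x \<otimes>\<^bsub>F\<^esub> (\<pi> u \<otimes>\<^bsub>F\<^esub> y) \<in> H"
      "inv\<^bsub>F\<^esub> y \<otimes>\<^bsub>F\<^esub> (\<pi> v \<otimes>\<^bsub>F\<^esub> z) \<in> H" using r by (auto simp: rel_def)
    have "(inv\<^bsub>F\<^esub> x \<otimes>\<^bsub>F\<^esub> (\<pi> u \<otimes>\<^bsub>F\<^esub> y)) \<otimes>\<^bsub>F\<^esub> (inv\<^bsub>F\<^esub> y \<otimes>\<^bsub>F\<^esub> (\<pi> v \<otimes>\<^bsub>F\<^esub> z)) \<in> H"
      using uv by blast
    then have "inv\<^bsub>F\<^esub> x \<otimes>\<^bsub>F\<^esub> (\<pi> (u \<otimes> v) \<otimes>\<^bsub>F\<^esub> z) \<in> H"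
      using uv that YF by (simp add: F.group_simps)
    then show ?thesis using uv unfolding rel_def by blast
  qed
  have rel_sym: "rel z y" if r: "rel y z" "y \<in> Y" "z \<in> Y" for y z
  proof -
    obtain u where u: "u \<in> carrier U" "inv\<^bsub>F\<^esub> y \<otimes>\<^bsub>F\<^esub> (\<pi> u \<otimes>\<^bsub>F\<^esub> z) \<in> H"
      using r by (auto simp: rel_def)
    then have "inv\<^bsub>F\<^esub> (inv\<^bsub>F\<^esub> y \<otimes>\<^bsub>F\<^esub> (\<pi> u \<otimes>\<^bsub>F\<^esub> z)) \<in> H" by blast
    then have "inv\<^bsub>F\<^esub> z \<otimes>\<^bsub>F\<^esub> (\<pi> (inv u) \<otimes>\<^bsub>F\<^esub> y) \<in> H"
      using u that YF by (simp add: F.group_simps)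
    then show ?thesis using u unfolding rel_def by blast
  qed
  have rel_refl: "rel y y" if "y \<in> Y" for y
    unfolding rel_def using that YF by (intro bexI[of _ \<one>]) auto
  define base where "base y = (SOME z. z \<in> Y \<and> rel y z)" for y
  have base: "base y \<in> Y" "rel y (base y)" if "y \<in> Y" for y
    using someI[of "\<lambda>z. z \<in> Y \<and> rel y z" y] that rel_refl by (auto simp: base_def)
  have base_eq: "base y = base z" if "rel y z" "y \<in> Y" "z \<in> Y" for y z
  proof -
    have "(x \<in> Y \<and> rel y x) = (x \<in> Y \<and> rel z x)" for x using that rel_trans rel_sym by blast
    then show ?thesis by (simp add: base_def)
  qed
  have "\<forall>y\<in>Y. \<exists>u. u \<in> carrier U \<and> inv\<^bsub>F\<^esub> y \<otimes>\<^bsub>F\<^esub> (\<pi> u \<otimes>\<^bsub>F\<^esub> base y) \<in> H"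
    using base by (auto simp: rel_def)
  then obtain g where g: "\<And>y. y \<in> Y \<Longrightarrow> g y \<in> carrier U"
    "\<And>y. y \<in> Y \<Longrightarrow> inv\<^bsub>F\<^esub> y \<otimes>\<^bsub>F\<^esub> (\<pi> (g y) \<otimes>\<^bsub>F\<^esub> base y) \<in> H"
    by metis
  \<comment> \<open>\<open>\<pi> (g y)\<close> moves the coset of \<open>base y\<close> to the coset
    of \<open>y\<close>, and \<open>\<eta> y\<close> is the error that remains inside
    \<open>H\<close>.\<close>
  define \<eta> where "\<eta> y = inv\<^bsub>F\<^esub> (base y) \<otimes>\<^bsub>F\<^esub> (inv\<^bsub>F\<^esub> \<pi> (g y) \<otimes>\<^bsub>F\<^esub> y)" for y
  have \<eta>: "\<eta> y \<in> H" "y = \<pi> (g y) \<otimes>\<^bsub>F\<^esub> (base y \<otimes>\<^bsub>F\<^esub> \<eta> y)" if y: "y \<in> Y" for y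
  proof -
    have c: "\<pi> (g y) \<in> carrier F" "y \<in> carrier F" "base y \<in> carrier F"
      using g base YF y by auto
    have "inv\<^bsub>F\<^esub> (inv\<^bsub>F\<^esub> y \<otimes>\<^bsub>F\<^esub> (\<pi> (g y) \<otimes>\<^bsub>F\<^esub> base y)) \<in> H" using g[OF y] by blast
    then show "\<eta> y \<in> H" unfolding \<eta>_def using c by (simp add: F.group_simps)
    show "y = \<pi> (g y) \<otimes>\<^bsub>F\<^esub> (base y \<otimes>\<^bsub>F\<^esub> \<eta> y)"
      unfolding \<eta>_def using c by (simp add: F.group_simps)
  qed
  obtain SN where SN: "finite SN" "SN \<subseteq> N" "generate U SN = N" and N_sub: "subgroup N U"
    using N by (auto simp: fg_subgroup_def)
  interpret N: subgroup N U by (rule N_sub)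
  \<comment> \<open>An instance that leads from \<open>y\<close> to \<open>y'\<close> along
    \<open>u\<close> involves exactly the element \<open>l\<close> with
    \<open>u \<otimes> g y = g y' \<otimes> l\<close>, which stabilises the coset of the base point.
    The full stabiliser may fail to be finitely generated, so \<open>L a\<close> is generated by
    these finitely many elements. The generators of \<open>N\<close> are added so that
    \<open>K a\<close> will contain \<open>N\<close> and \<open>N\<close> will act
    trivially.\<close>
  define S where "S a = SN \<union> {l \<in> (\<lambda>(u, y, y'). inv (g y') \<otimes> u \<otimes> g y) ` (\<Delta> \<times> Y \<times> Y).
    inv\<^bsub>F\<^esub> a \<otimes>\<^bsub>F\<^esub> (\<pi> l \<otimes>\<^bsub>F\<^esub> a) \<in> H}" for a
  define L where "L a = generate U (S a)" for a
  have S: "finite (S a)" "S a \<subseteq> carrier U" for a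
    using SN \<Delta> Y g by (auto simp: S_def)
  have L_sub: "subgroup (L a) U" for a unfolding L_def by (rule U.generate_is_subgroup) (rule S)
  have SL: "S a \<subseteq> L a" for a unfolding L_def by (auto intro: generate.incl)
  have NL: "N \<subseteq> L a" for a
    unfolding L_def SN(3)[symmetric] by (rule U.mono_generate) (auto simp: S_def)
  have Lfg: "fg_subgroup U (L a)" for a
    unfolding fg_subgroup_def using L_sub
    by (intro conjI exI[of _ "S a"]) (simp_all add: S SL L_def[symmetric])
  have L_stab: "inv\<^bsub>F\<^esub> a \<otimes>\<^bsub>F\<^esub> (\<pi> l \<otimes>\<^bsub>F\<^esub> a) \<in> H" if a: "a \<in> carrier F" and l: "l \<in> L a" for a l
    using l unfolding L_def
  proof (induction l)
    case one
    then show ?case using a by simp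
  next
    case (incl l)
    then show ?case using SN \<pi>N a by (auto simp: S_def)
  next
    case (inv l)
    then have "inv\<^bsub>F\<^esub> a \<otimes>\<^bsub>F\<^esub> (\<pi> l \<otimes>\<^bsub>F\<^esub> a) \<in> H" using SN \<pi>N a by (auto simp: S_def)
    then have "inv\<^bsub>F\<^esub> (inv\<^bsub>F\<^esub> a \<otimes>\<^bsub>F\<^esub> (\<pi> l \<otimes>\<^bsub>F\<^esub> a)) \<in> H" by blast
    moreover have "l \<in> carrier U" using inv S by auto
    ultimately show ?case using a by (simp add: F.group_simps)
  next
    case (eng l l')
    have "l \<in> carrier U" "l' \<in> carrier U" using eng U.generate_in_carrier[OF S(2)] by auto
    moreover have "(inv\<^bsub>F\<^esub> a \<otimes>\<^bsub>F\<^esub> (\<pi> l \<otimes>\<^bsub>F\<^esub> a)) \<otimes>\<^bsub>F\<^esub> (inv\<^bsub>F\<^esub> a \<otimes>\<^bsub>F\<^esub> (\<pi> l' \<otimes>\<^bsub>F\<^esub> a)) \<in> H"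
      using eng by blast
    ultimately show ?case using a by (simp add: F.group_simps)
  qed
  \<comment> \<open>Two points \<open>y\<close> and \<open>y'\<close> of one orbit would be given
    the same place in the induced action iff \<open>inv (g y) \<otimes> g y'\<close> were in
    \<open>K a\<close>. For different points this element does not stabilise the coset of
    \<open>a\<close>, hence is outside \<open>L a\<close>, and \<open>K a\<close> can be chosen to
    avoid it.\<close>
  define Z where "Z a = (\<lambda>(y, y'). inv (g y) \<otimes> g y') ` {(y, y') \<in> Y \<times> Y. base y = a \<and> base y' = a \<and> y \<noteq> y'}" for a
  have "finite (Z a)" for a
    unfolding Z_def using Y by (intro finite_imageI) (auto intro: finite_subset[of _ "Y \<times> Y"])
  moreover have "Z a \<inter> L a = {}" for a
  proof -
    have False if y: "y \<in> Y" "y' \<in> Y" "base y = a" "base y' = a" "y \<noteq> y'" "inv (g y) \<otimes> g y' \<in> L a" for y y'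
    proof -
      have a: "a \<in> carrier F" using base(1) y YF by blast
      have c: "\<pi> (g y) \<in> carrier F" "\<pi> (g y') \<in> carrier F" "\<eta> y \<in> carrier F" "\<eta> y' \<in> carrier F"
        using g \<eta> y H.subset by auto
      have "inv\<^bsub>F\<^esub> (\<eta> y) \<otimes>\<^bsub>F\<^esub> (inv\<^bsub>F\<^esub> a \<otimes>\<^bsub>F\<^esub> (\<pi> (inv (g y) \<otimes> g y') \<otimes>\<^bsub>F\<^esub> a)) \<otimes>\<^bsub>F\<^esub> \<eta> y' \<in> H"
        using L_stab[OF a y(6)] \<eta>(1) y by blast
      then have "inv\<^bsub>F\<^esub> (\<pi> (g y) \<otimes>\<^bsub>F\<^esub> (a \<otimes>\<^bsub>F\<^esub> \<eta> y)) \<otimes>\<^bsub>F\<^esub> (\<pi> (g y') \<otimes>\<^bsub>F\<^esub> (a \<otimes>\<^bsub>F\<^esub> \<eta> y')) \<in> H"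
        using a c g y by (simp add: F.group_simps)
      then have "inv\<^bsub>F\<^esub> y \<otimes>\<^bsub>F\<^esub> y' \<in> H" using \<eta>(2) y by metis
      then show False using Y_inj y by blast
    qed
    then show ?thesis by (auto simp: Z_def)
  qed
  ultimately have "\<exists>K \<rho>. finite_index U K \<and> L a \<subseteq> K \<and> \<rho> \<in> hom (U\<lparr>carrier := K\<rparr>) (U\<lparr>carrier := L a\<rparr>) \<and>
      (\<forall>l\<in>L a. \<rho> l = l) \<and> Z a \<inter> K = {}" for a
    using U.property_LR_avoid[OF LR Lfg, of "Z a" a] by metis
  then obtain K \<rho> where K: "\<And>a. finite_index U (K a)" "\<And>a. L a \<subseteq> K a" "\<And>a. Z a \<inter> K a = {}"
    and \<rho>: "\<And>a. \<rho> a \<in> hom (U\<lparr>carrier := K a\<rparr>) (U\<lparr>carrier := L a\<rparr>)" "\<And>a l. l \<in> L a \<Longrightarrow> \<rho> a l = l"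
    by metis
  have "\<exists>rep. left_transversal (K a) U rep" for a
    using U.left_transversal_exists[OF K(1)] by blast
  then obtain rep where rep: "\<And>a. left_transversal (K a) U (rep a)" by metis
  have K_sub: "subgroup (K a) U" for a using K(1) by (rule finite_index_subgroup)
  note KU = subgroup.mem_carrier[OF K_sub]
  have \<rho>L: "\<rho> a k \<in> L a" if "k \<in> K a" for a k using \<rho>(1)[of a] that by (auto simp: hom_def)
  \<comment> \<open>The stabiliser of the coset of \<open>a\<close> acts on that coset through
    \<open>H\<close>, by conjugating with \<open>a\<close>. Composed with the retraction
    \<open>\<rho> a\<close> this is the representation of \<open>K a\<close> in \<open>H\<close>
    that is induced up to \<open>U\<close>.\<close>
  define \<sigma> where "\<sigma> a k = inv\<^bsub>F\<^esub> a \<otimes>\<^bsub>F\<^esub> (\<pi> (\<rho> a k) \<otimes>\<^bsub>F\<^esub> a)" for a k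
  have \<sigma>H: "\<sigma> a k \<in> H" if "a \<in> carrier F" "k \<in> K a" for a k
    unfolding \<sigma>_def by (rule L_stab[OF that(1) \<rho>L[OF that(2)]])
  have \<sigma>m: "\<sigma> a (k \<otimes> k') = \<sigma> a k \<otimes>\<^bsub>F\<^esub> \<sigma> a k'" if "a \<in> carrier F" "k \<in> K a" "k' \<in> K a" for a k k'
  proof -
    have "\<rho> a (k \<otimes> k') = \<rho> a k \<otimes> \<rho> a k'" using \<rho>(1)[of a] that by (auto simp: hom_def)
    moreover have "\<rho> a k \<in> carrier U" "\<rho> a k' \<in> carrier U"
      using \<rho>L that subgroup.mem_carrier[OF L_sub] by blast+
    ultimately show ?thesis using that by (simp add: \<sigma>_def F.group_simps)
  qed
  let ?I = "SIGMA a:Y. rep a ` carrier U"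
  have fin: "finite ?I" using Y left_transversal.rep_finite[OF rep] by auto
  define p where "p u = (\<lambda>(a, r). (a, rep a (u \<otimes> r)))" for u
  define c where "c u = (\<lambda>(a, r). \<sigma> a (left_transversal.cocyc U (rep a) u r))" for u
  let ?\<theta> = "\<lambda>u. (\<lambda>i. if i \<in> ?I then p u i else i, \<lambda>i\<in>?I. c u i)"
  note repc = left_transversal.rep_closed[OF rep]
  have \<theta>: "?\<theta> \<in> hom U (wreath ?I ?M)"
  proof (rule wreath_homI[OF \<open>group U\<close> gM])
    show "p u i \<in> ?I" if "u \<in> carrier U" "i \<in> ?I" for u i
      using that repc by (auto simp: p_def)
    show "c u i \<in> carrier ?M" if "u \<in> carrier U" "i \<in> ?I" for u i
      using that repc YF by (auto simp: c_def intro!: \<sigma>H left_transversal.cocyc_closed[OF rep])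
    show "p \<one> i = i" if "i \<in> ?I" for i
      using that repc left_transversal.rep_rep[OF rep] by (auto simp: p_def)
    show "p (u \<otimes> v) i = p u (p v i)" if "u \<in> carrier U" "v \<in> carrier U" "i \<in> ?I" for u v i
      using that repc left_transversal.rep_mult_rep[OF rep] by (auto simp: p_def) (simp add: U.m_assoc)
    show "c (u \<otimes> v) i = c u (p v i) \<otimes>\<^bsub>?M\<^esub> c v i" if "u \<in> carrier U" "v \<in> carrier U" "i \<in> ?I" for u v i
      using that repc YF left_transversal.cocyc_closed[OF rep]
      by (auto simp: p_def c_def left_transversal.cocyc_mult[OF rep] \<sigma>m)
  qed
  \<comment> \<open>As \<open>U\<close> normalises \<open>N\<close> and \<open>N\<close> lies in
    \<open>K a\<close>, the elements of \<open>N\<close> fix every left coset of \<open>K a\<close>,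
    and their cocycle values lie in \<open>N\<close>, where \<open>\<rho> a\<close> is the identity
    and \<open>\<pi>\<close> is trivial.\<close>
  have \<theta>N: "?\<theta> n = \<one>\<^bsub>wreath ?I ?M\<^esub>" if n: "n \<in> N" for n
  proof (rule wreath_eqI)
    have nU: "n \<in> carrier U" using n by simp
    show "?\<theta> n \<in> carrier (wreath ?I ?M)" using \<theta> nU by (rule hom_in_carrier)
    show "\<one>\<^bsub>wreath ?I ?M\<^esub> \<in> carrier (wreath ?I ?M)"
      using group.is_monoid[OF group_wreath[OF gM]] by (rule monoid.one_closed)
    have *: "rep a (n \<otimes> r) = r" "left_transversal.cocyc U (rep a) n r \<in> N"
      if "a \<in> Y" "r \<in> rep a ` carrier U" for a r
    proof -
      have r: "r \<in> carrier U" "rep a r = r" using that repc left_transversal.rep_rep[OF rep] by auto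
      have inN: "inv r \<otimes> (n \<otimes> r) \<in> N" using N_conj[OF r(1) n] r nU by (simp add: U.m_assoc)
      then have "inv r \<otimes> (n \<otimes> r) \<in> K a" using NL K(2) by blast
      then have "rep a r = rep a (n \<otimes> r)"
        using r nU by (intro left_transversal.rep_eqI[OF rep]) auto
      then show "rep a (n \<otimes> r) = r" using r by simp
      then show "left_transversal.cocyc U (rep a) n r \<in> N"
        using inN by (simp add: left_transversal.cocyc_def[OF rep])
    qed
    show "fst (?\<theta> n) i = fst \<one>\<^bsub>wreath ?I ?M\<^esub> i" if "i \<in> ?I" for i
      using that * by (auto simp: wreath_one p_def)
    have \<sigma>N: "\<sigma> a x = \<one>\<^bsub>F\<^esub>" if "x \<in> N" "a \<in> carrier F" for a x
      using that NL \<rho>(2) by (simp add: \<sigma>_def \<pi>N subset_iff)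
    show "snd (?\<theta> n) i = snd \<one>\<^bsub>wreath ?I ?M\<^esub> i" if "i \<in> ?I" for i
      using that * YF by (auto simp: wreath_one c_def \<sigma>N)
  qed
  define \<theta>0 where "\<theta>0 = ?\<theta>"
  note \<theta> = \<theta>[folded \<theta>0_def] and \<theta>N = \<theta>N[folded fun_cong[OF \<theta>0_def]]
  define j where "j y = (base y, rep (base y) (g y))" for y
  have jI: "j y \<in> ?I" if "y \<in> Y" for y using that base g by (auto simp: j_def)
  have j_inj: "inj_on j Y"
  proof (rule inj_onI, rule ccontr)
    fix y y' assume y: "y \<in> Y" "y' \<in> Y" "j y = j y'" "y \<noteq> y'"
    then have b: "base y' = base y" by (simp add: j_def)
    then have "inv (g y) \<otimes> g y' \<in> K (base y)"
      using y g by (intro left_transversal.rep_eqD[OF rep]) (auto simp: j_def)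
    moreover have "inv (g y) \<otimes> g y' \<in> Z (base y)" using y b by (force simp: Z_def)
    ultimately show False using K(3) by blast
  qed
  define \<kappa> where "\<kappa> y = inv (rep (base y) (g y)) \<otimes> g y" for y
  have \<kappa>: "\<kappa> y \<in> K (base y)" if "y \<in> Y" for y
    unfolding \<kappa>_def using g that by (intro left_transversal.rep_coset[OF rep]) auto
  \<comment> \<open>The representative used by the induced action differs from \<open>g y\<close> by
    \<open>\<kappa> y\<close>, so the point \<open>y\<close> has the coordinate
    \<open>\<eta>' y\<close> in the block \<open>j y\<close>. With these coordinates
    \<open>key\<close> says that \<open>u\<close> moves the points of \<open>Y\<close> as
    prescribed.\<close>
  define \<eta>' where "\<eta>' y = \<sigma> (base y) (\<kappa> y) \<otimes>\<^bsub>F\<^esub> \<eta> y" for y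
  have \<eta>': "\<eta>' y \<in> H" if "y \<in> Y" for y
    unfolding \<eta>'_def
    using \<sigma>H[OF YF[OF base(1)[OF that]] \<kappa>[OF that]] \<eta>(1)[OF that] by (rule H.m_closed)
  have key: "p u (j y) = j y' \<and> c u (j y) \<otimes>\<^bsub>F\<^esub> \<eta>' y = \<eta>' y' \<otimes>\<^bsub>F\<^esub> h"
    if u: "u \<in> \<Delta>" and y: "y \<in> Y" "y' \<in> Y" and h: "h \<in> H" and eq: "\<pi> u \<otimes>\<^bsub>F\<^esub> y = y' \<otimes>\<^bsub>F\<^esub> h" for u y y' h
  proof -
    have uU: "u \<in> carrier U" using u \<Delta> by auto
    define a where "a = base y"
    have yF: "y \<in> carrier F" "y' \<in> carrier F" "h \<in> carrier F" "a \<in> carrier F"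
      "\<eta> y \<in> carrier F" "\<eta> y' \<in> carrier F"
      using y YF h base \<eta> by (auto simp: a_def)
    have "rel y' y"
      unfolding rel_def using uU h yF by (intro bexI[of _ u]) (simp_all add: eq F.inv_cancel_left)
    then have b: "base y' = a" unfolding a_def using y by (intro base_eq)
    have gg: "g y \<in> carrier U" "g y' \<in> carrier U" using g y by auto
    define l where "l = inv (g y') \<otimes> u \<otimes> g y"
    have lU: "l \<in> carrier U" using gg uU by (simp add: l_def)
    have ul: "u \<otimes> g y = g y' \<otimes> l" using gg uU by (simp add: l_def U.group_simps)
    have \<pi>l: "inv\<^bsub>F\<^esub> a \<otimes>\<^bsub>F\<^esub> (\<pi> l \<otimes>\<^bsub>F\<^esub> a) = \<eta> y' \<otimes>\<^bsub>F\<^esub> h \<otimes>\<^bsub>F\<^esub> inv\<^bsub>F\<^esub> \<eta> y"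
    proof -
      have "\<pi> u \<otimes>\<^bsub>F\<^esub> (\<pi> (g y) \<otimes>\<^bsub>F\<^esub> (a \<otimes>\<^bsub>F\<^esub> \<eta> y)) = \<pi> (g y') \<otimes>\<^bsub>F\<^esub> (a \<otimes>\<^bsub>F\<^esub> \<eta> y') \<otimes>\<^bsub>F\<^esub> h"
        using eq \<eta>(2)[OF y(1)] \<eta>(2)[OF y(2)] b by (simp add: a_def)
      then have "inv\<^bsub>F\<^esub> (\<pi> (g y')) \<otimes>\<^bsub>F\<^esub> (\<pi> u \<otimes>\<^bsub>F\<^esub> (\<pi> (g y) \<otimes>\<^bsub>F\<^esub> (a \<otimes>\<^bsub>F\<^esub> \<eta> y))) \<otimes>\<^bsub>F\<^esub> inv\<^bsub>F\<^esub> \<eta> y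
          = inv\<^bsub>F\<^esub> (\<pi> (g y')) \<otimes>\<^bsub>F\<^esub> (\<pi> (g y') \<otimes>\<^bsub>F\<^esub> (a \<otimes>\<^bsub>F\<^esub> \<eta> y') \<otimes>\<^bsub>F\<^esub> h) \<otimes>\<^bsub>F\<^esub> inv\<^bsub>F\<^esub> \<eta> y" by simp
      then have "\<pi> l \<otimes>\<^bsub>F\<^esub> a = a \<otimes>\<^bsub>F\<^esub> (\<eta> y' \<otimes>\<^bsub>F\<^esub> h \<otimes>\<^bsub>F\<^esub> inv\<^bsub>F\<^esub> \<eta> y)"
        using yF gg uU by (simp add: l_def F.group_simps)
      then show ?thesis using yF by (simp add: F.inv_cancel_left)
    qed
    have "l \<in> S a"
      unfolding S_def using u y h \<eta>(1) by (auto simp: \<pi>l l_def[symmetric] intro!: rev_image_eqI[of "(u, y, y')"])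
    then have lL: "l \<in> L a" using SL by blast
    then have lK: "l \<in> K a" using K(2) by blast
    have "rep a (u \<otimes> rep a (g y)) = rep a (u \<otimes> g y)"
      using left_transversal.rep_mult_rep[OF rep] uU gg by blast
    also have "\<dots> = rep a (g y')"
      unfolding ul using lU lK gg
      by (intro left_transversal.rep_eqI[OF rep, symmetric]) (simp_all add: U.inv_cancel_left)
    finally have rep_eq: "rep a (u \<otimes> rep a (g y)) = rep a (g y')" .
    have "left_transversal.cocyc U (rep a) u (rep a (g y)) \<otimes> \<kappa> y = \<kappa> y' \<otimes> l"
    proof -
      have "left_transversal.cocyc U (rep a) u (rep a (g y)) \<otimes> \<kappa> y = inv (rep a (g y')) \<otimes> (u \<otimes> g y)"
        using uU gg repc by (simp add: left_transversal.cocyc_def[OF rep] rep_eq \<kappa>_def a_def[symmetric] U.group_simps)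
      then show ?thesis using lU gg repc by (simp add: ul \<kappa>_def b U.m_assoc)
    qed
    then have "\<sigma> a (left_transversal.cocyc U (rep a) u (rep a (g y))) \<otimes>\<^bsub>F\<^esub> \<sigma> a (\<kappa> y) = \<sigma> a (\<kappa> y') \<otimes>\<^bsub>F\<^esub> \<sigma> a l"
      using \<sigma>m[OF yF(4)] \<kappa>[OF y(1)] \<kappa>[OF y(2)] lK uU gg repc left_transversal.cocyc_closed[OF rep]
      by (metis a_def b)
    moreover have "\<sigma> a l = \<eta> y' \<otimes>\<^bsub>F\<^esub> h \<otimes>\<^bsub>F\<^esub> inv\<^bsub>F\<^esub> \<eta> y"
      using lL by (simp add: \<sigma>_def \<rho>(2) \<pi>l)
    moreover have "\<sigma> a (left_transversal.cocyc U (rep a) u (rep a (g y))) \<in> carrier F"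
      "\<sigma> a (\<kappa> y) \<in> carrier F" "\<sigma> a (\<kappa> y') \<in> carrier F"
      using \<sigma>H[OF yF(4)] \<kappa>[OF y(1)] \<kappa>[OF y(2)] uU gg repc left_transversal.cocyc_closed[OF rep] H.mem_carrier
      by (simp_all add: a_def[symmetric] b)
    ultimately have "\<sigma> a (left_transversal.cocyc U (rep a) u (rep a (g y))) \<otimes>\<^bsub>F\<^esub> \<eta>' y = \<eta>' y' \<otimes>\<^bsub>F\<^esub> h"
      using yF by (simp add: \<eta>'_def a_def[symmetric] b F.group_simps flip: F.m_assoc) (simp add: F.group_simps)
    then show ?thesis by (simp add: p_def c_def j_def a_def[symmetric] b rep_eq)
  qed
  define j' where "j' = inv_into Y j"
  have j'j: "j' (j y) = y" if "y \<in> Y" for y using j_inj that by (simp add: j'_def)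
  \<comment> \<open>The size \<open>n\<close> must accommodate the labels \<open>e y\<close>, which
    are below \<open>m\<close>, and all the blocks in \<open>?I\<close>. Every larger size works as
    well, so that one size can serve all vertex groups.\<close>
  have "\<exists>\<theta>\<in>hom U (wreath {..<n} ?M). (\<forall>x\<in>N. \<theta> x = \<one>\<^bsub>wreath {..<n} ?M\<^esub>) \<and>
    (\<forall>u\<in>\<Delta>. \<forall>y\<in>Y. \<forall>y'\<in>Y. \<forall>h\<in>H. \<pi> u \<otimes>\<^bsub>F\<^esub> y = y' \<otimes>\<^bsub>F\<^esub> h \<longrightarrow>
      fst (\<theta> u) (e y) = e y' \<and> snd (\<theta> u) (e y) = h)" if n: "n \<ge> max m (card ?I)" for n
  proof -
    have "inj_on (e \<circ> j') (j ` Y)" using e(1) by (auto simp: inj_on_def j'j)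
    moreover have "(e \<circ> j') ` j ` Y \<subseteq> {..<n}" using e(2) n by (auto simp: j'j)
    ultimately obtain b where b: "inj_on b ?I" "b ` ?I \<subseteq> {..<n}" "\<And>x. x \<in> j ` Y \<Longrightarrow> b x = (e \<circ> j') x"
      using inj_on_extend[OF fin, of "j ` Y" "e \<circ> j'" "{..<n}"] jI n by (auto simp: image_subset_iff)
    have bj: "b (j y) = e y" if "y \<in> Y" for y using b(3) that j'j by simp
    \<comment> \<open>Moving the base point of the block \<open>j y\<close> to \<open>y\<close>
      itself gives \<open>y\<close> the coordinate one, and the cocycle value there becomes
      \<open>h\<close>.\<close>
    define d where "d i = (if i \<in> j ` Y then inv\<^bsub>?M\<^esub> \<eta>' (j' i) else \<one>\<^bsub>?M\<^esub>)" for i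
    have d: "d i \<in> carrier ?M" for i
      using \<eta>' M.inv_closed by (auto simp: d_def j'j)
    obtain \<theta>' where \<theta>': "\<theta>' \<in> hom U (wreath {..<n} ?M)"
      "\<And>u i. u \<in> carrier U \<Longrightarrow> i \<in> ?I \<Longrightarrow> fst (\<theta>' u) (b i) = b (fst (\<theta>0 u) i)"
      "\<And>u i. u \<in> carrier U \<Longrightarrow> i \<in> ?I \<Longrightarrow>
        snd (\<theta>' u) (b i) = d (fst (\<theta>0 u) i) \<otimes>\<^bsub>?M\<^esub> snd (\<theta>0 u) i \<otimes>\<^bsub>?M\<^esub> inv\<^bsub>?M\<^esub> d i"
      "\<And>u. u \<in> carrier U \<Longrightarrow> \<theta>0 u = \<one>\<^bsub>wreath ?I ?M\<^esub> \<Longrightarrow> \<theta>' u = \<one>\<^bsub>wreath {..<n} ?M\<^esub>"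
      using wreath_transport[OF \<open>group U\<close> gM \<theta> b(1,2), of d] d by blast
    show ?thesis
    proof (intro bexI[OF _ \<theta>'(1)] conjI ballI impI)
      show "\<theta>' x = \<one>\<^bsub>wreath {..<n} ?M\<^esub>" if "x \<in> N" for x
        using \<theta>'(4)[OF _ \<theta>N] that by simp
      fix u y y' h assume *: "u \<in> \<Delta>" "y \<in> Y" "y' \<in> Y" "h \<in> H" "\<pi> u \<otimes>\<^bsub>F\<^esub> y = y' \<otimes>\<^bsub>F\<^esub> h"
      have uU: "u \<in> carrier U" using * \<Delta> by auto
      note k = key[OF *]
      have 1: "fst (\<theta>0 u) (j y) = j y'" "snd (\<theta>0 u) (j y) = c u (j y)" using k jI[OF *(2)] by (auto simp: \<theta>0_def)
      show "fst (\<theta>' u) (e y) = e y'"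
        using \<theta>'(2)[OF uU jI[OF *(2)]] * by (simp only: 1 bj)
      have "d (j y') = inv\<^bsub>F\<^esub> \<eta>' y'" "inv\<^bsub>?M\<^esub> d (j y) = \<eta>' y"
        using * \<eta>' M.inv_inv[of "\<eta>' y"] by (simp_all add: d_def j'j M_inv)
      then have "snd (\<theta>' u) (e y) = inv\<^bsub>F\<^esub> \<eta>' y' \<otimes>\<^bsub>F\<^esub> c u (j y) \<otimes>\<^bsub>F\<^esub> \<eta>' y"
        using \<theta>'(3)[OF uU jI[OF *(2)]] * by (simp only: 1 bj) simp
      moreover have "c u (j y) \<in> carrier F"
        using 1(2) wreath_closed(2)[OF hom_in_carrier[OF \<theta> uU] jI[OF *(2)]] H.mem_carrier by simp
      ultimately show "snd (\<theta>' u) (e y) = h"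
        using k \<eta>'[OF *(2)] \<eta>'[OF *(3)] *(4) by (simp add: F.m_assoc F.inv_cancel_left)
    qed
  qed
  then show ?thesis by blast
qed

section \<open>Following words: from local completions to a retraction modulo
  \<open>N\<close>\<close>

definition action_on :: "('g, 'm) monoid_scheme \<Rightarrow> ('g \<Rightarrow> 'x \<Rightarrow> 'x) \<Rightarrow> 'x set \<Rightarrow> bool" where
  "action_on G act X \<longleftrightarrow> (\<forall>z\<in>X. act \<one>\<^bsub>G\<^esub> z = z) \<and>
     (\<forall>g\<in>carrier G. \<forall>h\<in>carrier G. \<forall>z\<in>X. act (g \<otimes>\<^bsub>G\<^esub> h) z = act g (act h z))"

text \<open>\<open>\<iota>\<close> places points of \<open>F\<close> in \<open>X\<close>. The
  predicate says that at the point \<open>p\<close> the action of \<open>g\<close> on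
  \<open>X\<close> imitates left translation by \<open>\<pi> g\<close> in \<open>F\<close>.\<close>

definition traces :: "('f, 'n) monoid_scheme \<Rightarrow> ('g \<Rightarrow> 'f) \<Rightarrow> ('g \<Rightarrow> 'x \<Rightarrow> 'x) \<Rightarrow> 'x set \<Rightarrow>
    ('f \<Rightarrow> 'x) \<Rightarrow> 'g \<Rightarrow> 'f \<Rightarrow> bool" where
  "traces F \<pi> act X \<iota> g p \<longleftrightarrow>
     \<iota> p \<in> X \<and> \<iota> (\<pi> g \<otimes>\<^bsub>F\<^esub> p) \<in> X \<and> act g (\<iota> p) = \<iota> (\<pi> g \<otimes>\<^bsub>F\<^esub> p)"

text \<open>The instances needed are the ones along a word in the generators that represents \<open>g\<close>.\<close>

lemma (in group) generate_traces:
  fixes F :: "('f, 'n) monoid_scheme"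
  assumes g: "g \<in> generate G S" and S: "S \<subseteq> carrier G" and "group F" and \<pi>: "\<pi> \<in> hom G F"
    and x: "x \<in> carrier F"
  shows "\<exists>E. finite E \<and> E \<subseteq> S \<times> carrier F \<and> (\<forall>(act :: 'a \<Rightarrow> 'x \<Rightarrow> 'x) X \<iota>. action_on G act X \<longrightarrow>
    (\<forall>(s, p)\<in>E. traces F \<pi> act X \<iota> s p) \<longrightarrow> \<iota> x \<in> X \<longrightarrow> traces F \<pi> act X \<iota> g x)"
  using g x
proof (induction g arbitrary: x)
  interpret F: group F by fact
  interpret \<pi>: group_hom G F \<pi> using \<pi> by unfold_locales
  {
    case one
    then show ?case by (intro exI[of _ "{}"]) (simp add: traces_def action_on_def)
  next
    case (incl s)
    then show ?case by (intro exI[of _ "{(s, x)}"]) auto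
  next
    case (inv s)
    have s: "s \<in> carrier G" using inv S by auto
    \<comment> \<open>The letter \<open>inv s\<close> at \<open>x\<close> is the letter
      \<open>s\<close> at \<open>?p\<close>, read backwards.\<close>
    let ?p = "inv\<^bsub>F\<^esub> \<pi> s \<otimes>\<^bsub>F\<^esub> x"
    have x: "\<pi> s \<otimes>\<^bsub>F\<^esub> ?p = x" "\<pi> (inv s) \<otimes>\<^bsub>F\<^esub> x = ?p"
      using s inv by (simp_all add: F.inv_cancel_left)
    have "traces F \<pi> act X \<iota> (inv s) x" if act: "action_on G act X" and tr: "traces F \<pi> act X \<iota> s ?p"
      for act :: "'a \<Rightarrow> 'x \<Rightarrow> 'x" and X \<iota>
    proof -
      have tr': "\<iota> ?p \<in> X" "\<iota> x \<in> X" "act s (\<iota> ?p) = \<iota> x" using tr by (simp_all only: traces_def x)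
      have "act (inv s) (act s (\<iota> ?p)) = act (inv s \<otimes> s) (\<iota> ?p)"
        using act tr'(1) s inv_closed[OF s] unfolding action_on_def by metis
      also have "\<dots> = \<iota> ?p" using act tr'(1) s by (simp add: action_on_def)
      finally show ?thesis using tr' unfolding traces_def x(2) by simp
    qed
    then show ?case using inv s by (intro exI[of _ "{(s, ?p)}"]) auto
  next
    case (eng g h)
    have gh: "g \<in> carrier G" "h \<in> carrier G" using eng generate_in_carrier[OF S] by auto
    then have hx: "\<pi> h \<otimes>\<^bsub>F\<^esub> x \<in> carrier F" using eng.prems by simp
    obtain E1 where E1: "finite E1" "E1 \<subseteq> S \<times> carrier F"
      "\<forall>(act :: 'a \<Rightarrow> 'x \<Rightarrow> 'x) X \<iota>. action_on G act X \<longrightarrow> (\<forall>(s, p)\<in>E1. traces F \<pi> act X \<iota> s p) \<longrightarrow>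
        \<iota> (\<pi> h \<otimes>\<^bsub>F\<^esub> x) \<in> X \<longrightarrow> traces F \<pi> act X \<iota> g (\<pi> h \<otimes>\<^bsub>F\<^esub> x)"
      using eng.IH(1)[OF hx] by (elim exE conjE)
    obtain E2 where E2: "finite E2" "E2 \<subseteq> S \<times> carrier F"
      "\<forall>(act :: 'a \<Rightarrow> 'x \<Rightarrow> 'x) X \<iota>. action_on G act X \<longrightarrow> (\<forall>(s, p)\<in>E2. traces F \<pi> act X \<iota> s p) \<longrightarrow>
        \<iota> x \<in> X \<longrightarrow> traces F \<pi> act X \<iota> h x"
      using eng.IH(2)[OF eng.prems] by (elim exE conjE)
    have a: "\<pi> (g \<otimes> h) \<otimes>\<^bsub>F\<^esub> x = \<pi> g \<otimes>\<^bsub>F\<^esub> (\<pi> h \<otimes>\<^bsub>F\<^esub> x)"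
      using gh eng.prems by (simp add: F.m_assoc)
    show ?case
    proof (intro exI[of _ "E1 \<union> E2"] conjI allI impI)
      show "finite (E1 \<union> E2)" "E1 \<union> E2 \<subseteq> S \<times> carrier F" using E1 E2 by auto
      fix act :: "'a \<Rightarrow> 'x \<Rightarrow> 'x" and X \<iota>
      assume act: "action_on G act X" and E: "\<forall>(s, p)\<in>E1 \<union> E2. traces F \<pi> act X \<iota> s p" and x: "\<iota> x \<in> X"
      have 2: "traces F \<pi> act X \<iota> h x"
        by (rule E2(3)[rule_format]) (use act E x in auto)
      have 1: "traces F \<pi> act X \<iota> g (\<pi> h \<otimes>\<^bsub>F\<^esub> x)"
        by (rule E1(3)[rule_format]) (use act E 2[unfolded traces_def] in auto)
      have "act (g \<otimes> h) (\<iota> x) = act g (act h (\<iota> x))"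
        using act gh x by (simp add: action_on_def)
      then show "traces F \<pi> act X \<iota> (g \<otimes> h) x"
        using 1 2 by (simp add: traces_def a del: \<pi>.hom_mult)
    qed
  }
qed

text \<open>The right cosets of the stabiliser are separated by the images of \<open>i\<close> under
  the inverses of group elements, which lie in the finite set \<open>I\<close>.\<close>

lemma (in group) wreath_stabilizer_finite_index:
  assumes "group M" and \<Theta>: "\<Theta> \<in> hom G (wreath I M)" and I: "finite I" "i \<in> I"
  shows "finite_index G {g \<in> carrier G. fst (\<Theta> g) i = i}"
proof -
  interpret W: group "wreath I M" by (rule group_wreath) fact
  interpret \<Theta>: group_hom G "wreath I M" \<Theta> using \<Theta> by unfold_locales
  have inv: "fst (\<Theta> x) (fst (\<Theta> (inv x)) i) = i" if "x \<in> carrier G" for x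
    using wreath_hom_pointwise(1)[OF \<Theta> that inv_closed[OF that] I(2)] that I
    by (simp add: wreath_one del: \<Theta>.hom_inv)
  have inv': "fst (\<Theta> (inv x)) i = i" if "x \<in> carrier G" "fst (\<Theta> x) i = i" for x
    using wreath_hom_pointwise(1)[OF \<Theta> inv_closed[OF that(1)] that(1) I(2)] that I
    by (simp add: wreath_one del: \<Theta>.hom_inv)
  show ?thesis
  proof (rule finite_indexI[where f = "\<lambda>g. fst (\<Theta> (inv g)) i"])
    show "subgroup {g \<in> carrier G. fst (\<Theta> g) i = i} G"
      by (rule subgroupI) (auto simp: inv' wreath_hom_pointwise(1)[OF \<Theta> _ _ I(2)] wreath_one simp del: \<Theta>.hom_inv \<Theta>.hom_mult
        intro!: exI[of _ \<one>])
    have "(\<lambda>g. fst (\<Theta> (inv g)) i) ` carrier G \<subseteq> I"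
      using wreath_closed(1)[OF \<Theta>.hom_closed[OF inv_closed] I(2)] by blast
    then show "finite ((\<lambda>g. fst (\<Theta> (inv g)) i) ` carrier G)" using I(1) by (rule finite_subset)
    show "x \<otimes> inv y \<in> {g \<in> carrier G. fst (\<Theta> g) i = i}"
      if "x \<in> carrier G" "y \<in> carrier G" "fst (\<Theta> (inv x)) i = fst (\<Theta> (inv y)) i" for x y
      using that inv[OF that(1)] by (simp add: wreath_hom_pointwise(1)[OF \<Theta> _ _ I(2)] del: \<Theta>.hom_inv \<Theta>.hom_mult)
  qed
qed

text \<open>
  The data that a graph of groups whose edge groups all coincide with a normal subgroup \<open>N\<close>
  provides: the subgroups \<open>U v\<close> and the elements \<open>t j\<close> are the vertex groups and the stable
  letters outside the maximal tree.
\<close>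

locale normal_amalgam = normal N G for N and G (structure) +
  fixes V :: "'v set" and U :: "'v \<Rightarrow> 'a set" and J :: "'j set" and t :: "'j \<Rightarrow> 'a"
  assumes V: "finite V" "V \<noteq> {}"
    and U_subgroup: "v \<in> V \<Longrightarrow> subgroup (U v) G"
    and N_le: "v \<in> V \<Longrightarrow> N \<subseteq> U v"
    and U_LR: "v \<in> V \<Longrightarrow> property_LR (G\<lparr>carrier := U v\<rparr>)"
    and t_closed: "j \<in> J \<Longrightarrow> t j \<in> carrier G"
    and gen: "generate G ((\<Union>v\<in>V. U v) \<union> t ` J) = carrier G"
    and N_fg: "fg_subgroup G N"
begin

text \<open>The universal property, for one target \<open>W\<close>, of the amalgam of the
  \<open>U v\<close> along \<open>N\<close> with letters \<open>t j\<close> that normalise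
  \<open>N\<close>: homomorphisms that agree on \<open>N\<close>, and elements \<open>s j\<close>
  that conjugate as \<open>t j\<close> does, extend jointly. It is a predicate on \<open>W\<close>
  and not an axiom of the locale because the targets have different types.\<close>

definition extends_to :: "'w monoid \<Rightarrow> bool" where
  "extends_to W \<longleftrightarrow> (\<forall>\<theta> \<theta>N s.
     (\<forall>v\<in>V. \<theta> v \<in> hom (G\<lparr>carrier := U v\<rparr>) W \<and> (\<forall>n\<in>N. \<theta> v n = \<theta>N n)) \<longrightarrow>
     (\<forall>j\<in>J. s j \<in> carrier W \<and> (\<forall>n\<in>N. s j \<otimes>\<^bsub>W\<^esub> \<theta>N (inv (t j) \<otimes> n \<otimes> t j) = \<theta>N n \<otimes>\<^bsub>W\<^esub> s j)) \<longrightarrow>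
     (\<exists>\<Theta>\<in>hom G W. (\<forall>v\<in>V. \<forall>u\<in>U v. \<Theta> u = \<theta> v u) \<and> (\<forall>j\<in>J. \<Theta> (t j) = s j)))"

lemma N_fg_U:
  assumes "v \<in> V" shows "fg_subgroup (G\<lparr>carrier := U v\<rparr>) N"
proof -
  obtain S where S: "finite S" "S \<subseteq> N" "generate G S = N" using N_fg by (auto simp: fg_subgroup_def)
  have "generate (G\<lparr>carrier := U v\<rparr>) S = N"
    using generate_consistent[of S "U v"] S N_le[OF assms] U_subgroup[OF assms] by auto
  then show ?thesis
    unfolding fg_subgroup_def
    using S subgroup_incl[OF subgroup_axioms U_subgroup[OF assms] N_le[OF assms]] by blast
qed

lemma U_closed: "v \<in> V \<Longrightarrow> u \<in> U v \<Longrightarrow> u \<in> carrier G"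
  using subgroup.mem_carrier[OF U_subgroup] by simp

lemma conj_N:
  assumes "g \<in> carrier G" "n \<in> N"
  shows "g \<otimes> n \<otimes> inv g \<in> N" "inv g \<otimes> n \<otimes> g \<in> N"
  using assms inv_op_closed1 inv_op_closed2 by auto

text \<open>A point of \<open>F\<close> is recorded as the block of its coset together with a
  coordinate in the image of \<open>H\<close>. Spelling the finitely many generators of
  \<open>H\<close> in the generators of \<open>G\<close> meets only finitely many points. If an
  action on finitely many blocks agrees with left translation there, each generator of
  \<open>H\<close> fixes the block of the unit and acts on it through \<open>\<pi>\<close>. As
  \<open>\<pi>\<close> kills \<open>N\<close>, the actions of the \<open>U v\<close> can be taken
  trivial on \<open>N\<close>, and then they combine with any choice of images for the
  letters.\<close>

proposition retraction_modulo:
  fixes F :: "('f, 'n) monoid_scheme"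
  assumes F: "group F" and \<pi>: "\<pi> \<in> hom G F" and \<pi>N: "\<And>n. n \<in> N \<Longrightarrow> \<pi> n = \<one>\<^bsub>F\<^esub>"
    and H: "fg_subgroup G H"
    and ext: "\<And>n. extends_to (wreath {..<n :: nat} (F\<lparr>carrier := \<pi> ` H\<rparr>))"
  obtains K \<rho> where "finite_index G K" "H \<subseteq> K"
    "\<rho> \<in> hom (G\<lparr>carrier := K\<rparr>) (F\<lparr>carrier := \<pi> ` H\<rparr>)" "\<And>h. h \<in> H \<Longrightarrow> \<rho> h = \<pi> h"
proof -
  interpret F: group F by fact
  interpret \<pi>: group_hom G F \<pi> using \<pi> by unfold_locales
  define Hb where "Hb = \<pi> ` H"
  have H_sub: "subgroup H G" using H by (simp add: fg_subgroup_def)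
  have Hb: "subgroup Hb F" unfolding Hb_def using H_sub by (rule \<pi>.subgroup_img_is_subgroup)
  interpret Hb: subgroup Hb F by (rule Hb)
  let ?M = "F\<lparr>carrier := Hb\<rparr>"
  have gM: "group ?M" by (rule F.subgroup_imp_group) (rule Hb)
  interpret M: group ?M by (rule gM)
  obtain SH where SH: "finite SH" "SH \<subseteq> H" "generate G SH = H"
    using H by (auto simp: fg_subgroup_def)
  define S where "S = (\<Union>v\<in>V. U v) \<union> t ` J"
  have S: "S \<subseteq> carrier G" using U_closed t_closed by (auto simp: S_def)
  let ?follows = "\<lambda>g E. \<forall>(act :: 'a \<Rightarrow> nat \<times> 'f \<Rightarrow> nat \<times> 'f) X \<iota>. action_on G act X \<longrightarrow>
    (\<forall>(s, p)\<in>E. traces F \<pi> act X \<iota> s p) \<longrightarrow> \<iota> \<one>\<^bsub>F\<^esub> \<in> X \<longrightarrow> traces F \<pi> act X \<iota> g \<one>\<^bsub>F\<^esub>"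
  have "\<exists>E. finite E \<and> E \<subseteq> S \<times> carrier F \<and> ?follows g E" if "g \<in> SH" for g
  proof (rule generate_traces[OF _ S F \<pi> F.one_closed])
    show "g \<in> generate G S"
      using that SH gen subgroup.mem_carrier[OF H_sub] by (auto simp: S_def)
  qed
  then obtain E' where E': "\<And>g. g \<in> SH \<Longrightarrow> finite (E' g)" "\<And>g. g \<in> SH \<Longrightarrow> E' g \<subseteq> S \<times> carrier F"
    "\<And>g. g \<in> SH \<Longrightarrow> ?follows g (E' g)" by metis
  define E where "E = (\<Union>g\<in>SH. E' g)"
  have E: "finite E" "E \<subseteq> S \<times> carrier F" using E' SH by (auto simp: E_def)
  \<comment> \<open>The starting points and end points of the instances in \<open>E\<close>, and the
    unit, from which the words are followed.\<close>
  define Pts where "Pts = insert \<one>\<^bsub>F\<^esub> (snd ` E \<union> (\<lambda>(s, p). \<pi> s \<otimes>\<^bsub>F\<^esub> p) ` E)"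
  have "\<pi> a \<otimes>\<^bsub>F\<^esub> p \<in> carrier F" if "(a, p) \<in> E" for a p
  proof -
    have "a \<in> carrier G" "p \<in> carrier F" using that E S by auto
    then show ?thesis by simp
  qed
  then have Pts: "finite Pts" "Pts \<subseteq> carrier F"
    using E by (auto simp: Pts_def)
  \<comment> \<open>The condition on \<open>q\<close> depends only on the coset of \<open>p\<close>,
    so this selects one representative in \<open>Pts\<close> for each coset that meets
    \<open>Pts\<close>.\<close>
  define y where "y p = (SOME q. q \<in> Pts \<and> inv\<^bsub>F\<^esub> q \<otimes>\<^bsub>F\<^esub> p \<in> Hb)" for p
  have y: "y p \<in> Pts" "inv\<^bsub>F\<^esub> (y p) \<otimes>\<^bsub>F\<^esub> p \<in> Hb" if "p \<in> Pts" for p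
    using someI[of "\<lambda>q. q \<in> Pts \<and> inv\<^bsub>F\<^esub> q \<otimes>\<^bsub>F\<^esub> p \<in> Hb" p] that Pts Hb.one_closed
    by (auto simp: y_def subset_iff)
  have yF: "y p \<in> carrier F" if "p \<in> Pts" for p using y that Pts by auto
  have y_eq: "y p = y q" if "p \<in> carrier F" "q \<in> carrier F" "inv\<^bsub>F\<^esub> p \<otimes>\<^bsub>F\<^esub> q \<in> Hb" for p q
  proof -
    have "inv\<^bsub>F\<^esub> x \<otimes>\<^bsub>F\<^esub> p \<in> Hb \<longleftrightarrow> inv\<^bsub>F\<^esub> x \<otimes>\<^bsub>F\<^esub> q \<in> Hb" if x: "x \<in> carrier F" for x
    proof
      assume "inv\<^bsub>F\<^esub> x \<otimes>\<^bsub>F\<^esub> p \<in> Hb"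
      then have "(inv\<^bsub>F\<^esub> x \<otimes>\<^bsub>F\<^esub> p) \<otimes>\<^bsub>F\<^esub> (inv\<^bsub>F\<^esub> p \<otimes>\<^bsub>F\<^esub> q) \<in> Hb" using \<open>inv\<^bsub>F\<^esub> p \<otimes>\<^bsub>F\<^esub> q \<in> Hb\<close> by blast
      then show "inv\<^bsub>F\<^esub> x \<otimes>\<^bsub>F\<^esub> q \<in> Hb" using \<open>p \<in> carrier F\<close> \<open>q \<in> carrier F\<close> x by (simp add: F.group_simps)
    next
      assume "inv\<^bsub>F\<^esub> x \<otimes>\<^bsub>F\<^esub> q \<in> Hb"
      then have "(inv\<^bsub>F\<^esub> x \<otimes>\<^bsub>F\<^esub> q) \<otimes>\<^bsub>F\<^esub> inv\<^bsub>F\<^esub> (inv\<^bsub>F\<^esub> p \<otimes>\<^bsub>F\<^esub> q) \<in> Hb" using \<open>inv\<^bsub>F\<^esub> p \<otimes>\<^bsub>F\<^esub> q \<in> Hb\<close> by blast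
      then show "inv\<^bsub>F\<^esub> x \<otimes>\<^bsub>F\<^esub> p \<in> Hb" using \<open>p \<in> carrier F\<close> \<open>q \<in> carrier F\<close> x by (simp add: F.group_simps)
    qed
    then have "(x \<in> Pts \<and> inv\<^bsub>F\<^esub> x \<otimes>\<^bsub>F\<^esub> p \<in> Hb) = (x \<in> Pts \<and> inv\<^bsub>F\<^esub> x \<otimes>\<^bsub>F\<^esub> q \<in> Hb)" for x using Pts by blast
    then show ?thesis by (simp add: y_def)
  qed
  have y_y: "y (y p) = y p" if "p \<in> Pts" for p
    using y_eq[of "y p" p] y yF that Pts by auto
  define Y where "Y = y ` Pts"
  have Y: "finite Y" "Y \<subseteq> carrier F" using Pts yF by (auto simp: Y_def)
  have Y_inj: "z = z'" if "z \<in> Y" "z' \<in> Y" "inv\<^bsub>F\<^esub> z \<otimes>\<^bsub>F\<^esub> z' \<in> Hb" for z z'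
    using y_eq[of z z'] that Y y_y by (auto simp: Y_def yF)
  obtain e where e: "bij_betw e Y {0..<card Y}" using ex_bij_betw_finite_nat[OF Y(1)] by auto
  then have e_inj: "inj_on e Y" and e_img: "e ` Y \<subseteq> {..<card Y}" by (auto simp: bij_betw_def)
  let ?W = "\<lambda>n. wreath {..<n :: nat} ?M"
  define ok where "ok v n \<theta> \<longleftrightarrow> (\<forall>x\<in>N. \<theta> x = \<one>\<^bsub>?W n\<^esub>) \<and>
    (\<forall>u\<in>fst ` E \<inter> U v. \<forall>z\<in>Y. \<forall>z'\<in>Y. \<forall>h\<in>Hb. \<pi> u \<otimes>\<^bsub>F\<^esub> z = z' \<otimes>\<^bsub>F\<^esub> h \<longrightarrow>
      fst (\<theta> u) (e z) = e z' \<and> snd (\<theta> u) (e z) = h)" for v n \<theta>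
  have "\<exists>n0. \<forall>n\<ge>n0. \<exists>\<theta>\<in>hom (G\<lparr>carrier := U v\<rparr>) (?W n). ok v n \<theta>" if v: "v \<in> V" for v
    unfolding ok_def
  proof (rule local_extension[where U = "G\<lparr>carrier := U v\<rparr>" and \<Delta> = "fst ` E \<inter> U v" and \<pi> = \<pi>])
    show "group (G\<lparr>carrier := U v\<rparr>)" using U_subgroup[OF v] by (rule subgroup_imp_group)
    show "\<pi> \<in> hom (G\<lparr>carrier := U v\<rparr>) F" using U_closed[OF v] by (auto simp: hom_def)
    show "fg_subgroup (G\<lparr>carrier := U v\<rparr>) N" by (rule N_fg_U[OF v])
    show "inv\<^bsub>G\<lparr>carrier := U v\<rparr>\<^esub> u \<otimes>\<^bsub>G\<lparr>carrier := U v\<rparr>\<^esub> n \<otimes>\<^bsub>G\<lparr>carrier := U v\<rparr>\<^esub> u \<in> N"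
      if "u \<in> carrier (G\<lparr>carrier := U v\<rparr>)" "n \<in> N" for u n
      using that conj_N(2)[of u n] U_closed[OF v] by (simp add: m_inv_consistent[OF U_subgroup[OF v]])
  qed (use F U_LR[OF v] \<pi>N Hb Y Y_inj E e_inj e_img in auto)
  then obtain n0 where n0: "\<And>v n. v \<in> V \<Longrightarrow> n \<ge> n0 v \<Longrightarrow> \<exists>\<theta>\<in>hom (G\<lparr>carrier := U v\<rparr>) (?W n). ok v n \<theta>"
    by metis
  \<comment> \<open>One number of blocks that is beyond the thresholds of all vertex groups and
    leaves room for the labels of \<open>Y\<close>.\<close>
  define n where "n = Max (insert (card Y) (n0 ` V))"
  have n: "card Y \<le> n" "\<And>v. v \<in> V \<Longrightarrow> n0 v \<le> n"
    unfolding n_def using V by (auto intro!: Max_ge simp del: Max_insert)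
  obtain \<theta> where \<theta>: "\<And>v. v \<in> V \<Longrightarrow> \<theta> v \<in> hom (G\<lparr>carrier := U v\<rparr>) (?W n)" "\<And>v. v \<in> V \<Longrightarrow> ok v n (\<theta> v)"
    using n0[OF _ n(2)] by metis
  have eY: "e z \<in> {..<n}" if "z \<in> Y" for z using that e_img n by fastforce
  have "\<exists>s. s \<in> carrier (?W n) \<and> (\<forall>z\<in>Y. \<forall>z'\<in>Y. \<forall>h\<in>Hb. \<pi> (t j) \<otimes>\<^bsub>F\<^esub> z = z' \<otimes>\<^bsub>F\<^esub> h \<longrightarrow>
      fst s (e z) = e z' \<and> snd s (e z) = h)" if j: "j \<in> J" for j
  proof -
    have tj: "\<pi> (t j) \<in> carrier F" using t_closed[OF j] by simp
    \<comment> \<open>The letter \<open>t j\<close> prescribes a partial injection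
      \<open>nx\<close>, on those cosets represented in \<open>Y\<close> whose translate is again
      represented in \<open>Y\<close>. Since \<open>N\<close> acts trivially, every completion of it
      to an element of the wreath product is admissible.\<close>
    define D where "D = {z \<in> Y. \<exists>z'\<in>Y. inv\<^bsub>F\<^esub> z' \<otimes>\<^bsub>F\<^esub> (\<pi> (t j) \<otimes>\<^bsub>F\<^esub> z) \<in> Hb}"
    define nx where "nx z = (SOME z'. z' \<in> Y \<and> inv\<^bsub>F\<^esub> z' \<otimes>\<^bsub>F\<^esub> (\<pi> (t j) \<otimes>\<^bsub>F\<^esub> z) \<in> Hb)" for z
    have nx: "nx z \<in> Y" "inv\<^bsub>F\<^esub> (nx z) \<otimes>\<^bsub>F\<^esub> (\<pi> (t j) \<otimes>\<^bsub>F\<^esub> z) \<in> Hb" if "z \<in> D" for z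
    proof -
      have "nx z \<in> Y \<and> inv\<^bsub>F\<^esub> (nx z) \<otimes>\<^bsub>F\<^esub> (\<pi> (t j) \<otimes>\<^bsub>F\<^esub> z) \<in> Hb"
        unfolding nx_def by (rule someI_ex) (use that in \<open>auto simp: D_def\<close>)
      then show "nx z \<in> Y" "inv\<^bsub>F\<^esub> (nx z) \<otimes>\<^bsub>F\<^esub> (\<pi> (t j) \<otimes>\<^bsub>F\<^esub> z) \<in> Hb" by auto
    qed
    have DY: "D \<subseteq> Y" by (auto simp: D_def)
    have nx_eq: "nx z = z'" if "z \<in> D" "z' \<in> Y" "inv\<^bsub>F\<^esub> z' \<otimes>\<^bsub>F\<^esub> (\<pi> (t j) \<otimes>\<^bsub>F\<^esub> z) \<in> Hb" for z z'
    proof (rule Y_inj)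
      have c: "nx z \<in> carrier F" "z' \<in> carrier F" "z \<in> carrier F" using that nx DY Y by auto
      have "(inv\<^bsub>F\<^esub> (nx z) \<otimes>\<^bsub>F\<^esub> (\<pi> (t j) \<otimes>\<^bsub>F\<^esub> z)) \<otimes>\<^bsub>F\<^esub> inv\<^bsub>F\<^esub> (inv\<^bsub>F\<^esub> z' \<otimes>\<^bsub>F\<^esub> (\<pi> (t j) \<otimes>\<^bsub>F\<^esub> z)) \<in> Hb"
        using nx that by blast
      then show "inv\<^bsub>F\<^esub> (nx z) \<otimes>\<^bsub>F\<^esub> z' \<in> Hb" using c tj by (simp add: F.group_simps)
    qed (use that nx in auto)
    have nx_inj: "inj_on nx D"
    proof (rule inj_onI)
      fix z z' assume z: "z \<in> D" "z' \<in> D" "nx z = nx z'"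
      have c: "nx z' \<in> carrier F" "z' \<in> carrier F" "z \<in> carrier F" using z nx DY Y by auto
      have "inv\<^bsub>F\<^esub> (inv\<^bsub>F\<^esub> (nx z') \<otimes>\<^bsub>F\<^esub> (\<pi> (t j) \<otimes>\<^bsub>F\<^esub> z)) \<otimes>\<^bsub>F\<^esub> (inv\<^bsub>F\<^esub> (nx z') \<otimes>\<^bsub>F\<^esub> (\<pi> (t j) \<otimes>\<^bsub>F\<^esub> z')) \<in> Hb"
        using nx(2)[OF z(1)] nx(2)[OF z(2)] z(3) by auto
      then have "inv\<^bsub>F\<^esub> z \<otimes>\<^bsub>F\<^esub> z' \<in> Hb" using c tj by (simp add: F.group_simps)
      then show "z = z'" using Y_inj z DY by blast
    qed
    define e' where "e' = inv_into Y e"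
    have e'e: "e' (e z) = z" if "z \<in> Y" for z using e_inj that by (simp add: e'_def)
    obtain s where s: "s \<in> carrier (?W n)" "\<And>i. i \<in> e ` D \<Longrightarrow> fst s i = e (nx (e' i)) \<and>
        snd s i = inv\<^bsub>F\<^esub> (nx (e' i)) \<otimes>\<^bsub>F\<^esub> (\<pi> (t j) \<otimes>\<^bsub>F\<^esub> e' i)"
    proof (rule wreath_partial_extend[OF gM, of "{..<n}" "e ` D" "\<lambda>i. e (nx (e' i))"
          "\<lambda>i. inv\<^bsub>F\<^esub> (nx (e' i)) \<otimes>\<^bsub>F\<^esub> (\<pi> (t j) \<otimes>\<^bsub>F\<^esub> e' i)"])
      show "e ` D \<subseteq> {..<n}" using eY DY by blast
      show "inj_on (\<lambda>i. e (nx (e' i))) (e ` D)"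
      proof (rule inj_onI)
        fix i i' assume "i \<in> e ` D" "i' \<in> e ` D" and eq: "e (nx (e' i)) = e (nx (e' i'))"
        then obtain z z' where z: "z \<in> D" "z' \<in> D" "i = e z" "i' = e z'" by auto
        then have "nx z = nx z'" using eq e_inj nx DY by (auto simp: e'e subset_iff dest: inj_onD)
        then show "i = i'" using z nx_inj by (auto dest: inj_onD)
      qed
      show "(\<lambda>i. e (nx (e' i))) ` e ` D \<subseteq> {..<n}" using eY DY nx by (auto simp: e'e subset_iff)
      show "inv\<^bsub>F\<^esub> (nx (e' i)) \<otimes>\<^bsub>F\<^esub> (\<pi> (t j) \<otimes>\<^bsub>F\<^esub> e' i) \<in> carrier ?M" if "i \<in> e ` D" for i
        using that nx(2) DY by (auto simp: e'e subset_iff)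
    qed simp_all
    have "fst s (e z) = e z' \<and> snd s (e z) = h"
      if z: "z \<in> Y" "z' \<in> Y" "h \<in> Hb" "\<pi> (t j) \<otimes>\<^bsub>F\<^esub> z = z' \<otimes>\<^bsub>F\<^esub> h" for z z' h
    proof -
      have h: "inv\<^bsub>F\<^esub> z' \<otimes>\<^bsub>F\<^esub> (\<pi> (t j) \<otimes>\<^bsub>F\<^esub> z) = h"
        using z Y Hb.mem_carrier by (simp add: F.inv_cancel_left subset_iff)
      with z(3) have zH: "inv\<^bsub>F\<^esub> z' \<otimes>\<^bsub>F\<^esub> (\<pi> (t j) \<otimes>\<^bsub>F\<^esub> z) \<in> Hb" by (simp only:)
      then have D: "z \<in> D" using z(1,2) by (auto simp: D_def)
      then have "nx z = z'" using nx_eq zH z(2) by blast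
      then show ?thesis using s(2)[of "e z"] D h by (simp add: e'e z)
    qed
    then show ?thesis using s(1) by blast
  qed
  then obtain s where s: "\<And>j. j \<in> J \<Longrightarrow> s j \<in> carrier (?W n)"
    "\<And>j z z' h. j \<in> J \<Longrightarrow> z \<in> Y \<Longrightarrow> z' \<in> Y \<Longrightarrow> h \<in> Hb \<Longrightarrow> \<pi> (t j) \<otimes>\<^bsub>F\<^esub> z = z' \<otimes>\<^bsub>F\<^esub> h \<Longrightarrow>
      fst (s j) (e z) = e z' \<and> snd (s j) (e z) = h" by metis
  interpret W: group "?W n" by (rule group_wreath) (rule gM)
  have \<theta>1: "\<theta> v x = \<one>\<^bsub>?W n\<^esub>" if "v \<in> V" "x \<in> N" for v x
    using \<theta>(2)[OF that(1), unfolded ok_def] that(2) by blast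
  have "\<exists>\<Theta>\<in>hom G (?W n). (\<forall>v\<in>V. \<forall>u\<in>U v. \<Theta> u = \<theta> v u) \<and> (\<forall>j\<in>J. \<Theta> (t j) = s j)"
    using ext[of n, unfolded extends_to_def, folded Hb_def, rule_format, of \<theta> "\<lambda>_. \<one>\<^bsub>?W n\<^esub>" s] \<theta>(1) \<theta>1 s
    by simp
  then obtain \<Theta> where \<Theta>: "\<Theta> \<in> hom G (?W n)" "\<And>v u. v \<in> V \<Longrightarrow> u \<in> U v \<Longrightarrow> \<Theta> u = \<theta> v u"
    "\<And>j. j \<in> J \<Longrightarrow> \<Theta> (t j) = s j" by blast
  interpret \<Theta>: group_hom G "?W n" \<Theta> using \<Theta>(1) by unfold_locales
  note \<Theta>_cl = wreath_closed[OF \<Theta>.hom_closed]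
  have \<Theta>E: "fst (\<Theta> a) (e z) = e z' \<and> snd (\<Theta> a) (e z) = h"
    if "a \<in> fst ` E" "z \<in> Y" "z' \<in> Y" "h \<in> Hb" "\<pi> a \<otimes>\<^bsub>F\<^esub> z = z' \<otimes>\<^bsub>F\<^esub> h" for a z z' h
  proof -
    have "a \<in> S" using that E by auto
    then consider (U) v where "v \<in> V" "a \<in> U v" | (t) j where "j \<in> J" "a = t j"
      by (auto simp: S_def)
    then show ?thesis
    proof cases
      case U
      then show ?thesis using \<theta>(2)[OF U(1), unfolded ok_def] \<Theta>(2)[OF U] that by simp
    next
      case t
      then show ?thesis using s(2)[OF t(1) that(2,3,4)] \<Theta>(3)[OF t(1)] that by simp
    qed
  qed
  define act where "act g = (\<lambda>(i, x). (fst (\<Theta> g) i, snd (\<Theta> g) i \<otimes>\<^bsub>F\<^esub> x))" for g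
  define X where "X = {..<n} \<times> Hb"
  define \<iota> where "\<iota> p = (e (y p), inv\<^bsub>F\<^esub> (y p) \<otimes>\<^bsub>F\<^esub> p)" for p
  have \<iota>X: "\<iota> p \<in> X" if "p \<in> Pts" for p
    using that y eY by (auto simp: \<iota>_def X_def Y_def)
  have onePts: "\<one>\<^bsub>F\<^esub> \<in> Pts" by (simp add: Pts_def)
  have "\<forall>z\<in>X. act \<one> z = z"
    using Hb.mem_carrier by (auto simp: act_def X_def wreath_one)
  moreover have "\<forall>g\<in>carrier G. \<forall>h\<in>carrier G. \<forall>z\<in>X. act (g \<otimes> h) z = act g (act h z)"
    using Hb.mem_carrier \<Theta>_cl(2) \<Theta>_cl(1)
    by (auto simp: act_def X_def wreath_hom_pointwise[OF \<Theta>(1)] F.m_assoc simp del: \<Theta>.hom_mult)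
  ultimately have act: "action_on G act X" by (simp add: action_on_def)
  have act_E: "\<forall>(a, p)\<in>E. traces F \<pi> act X \<iota> a p"
  proof (intro ballI, clarify)
    fix a p assume ap: "(a, p) \<in> E"
    let ?q = "\<pi> a \<otimes>\<^bsub>F\<^esub> p"
    have pq: "p \<in> Pts" "?q \<in> Pts"
      using ap by (force simp: Pts_def)+
    have aG: "a \<in> carrier G" using ap E S by auto
    have c: "p \<in> carrier F" "?q \<in> carrier F" "y p \<in> carrier F" "y ?q \<in> carrier F"
      using pq Pts yF by auto
    let ?h = "inv\<^bsub>F\<^esub> (y ?q) \<otimes>\<^bsub>F\<^esub> ?q \<otimes>\<^bsub>F\<^esub> inv\<^bsub>F\<^esub> (inv\<^bsub>F\<^esub> (y p) \<otimes>\<^bsub>F\<^esub> p)"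
    have "?h \<in> Hb" using y(2)[OF pq(1)] y(2)[OF pq(2)] by blast
    moreover have "\<pi> a \<otimes>\<^bsub>F\<^esub> y p = y ?q \<otimes>\<^bsub>F\<^esub> ?h" using c aG by (simp add: F.group_simps)
    ultimately have "fst (\<Theta> a) (e (y p)) = e (y ?q) \<and> snd (\<Theta> a) (e (y p)) = ?h"
      using ap pq by (intro \<Theta>E) (force simp: Y_def)+
    then show "traces F \<pi> act X \<iota> a p"
      using \<iota>X pq c aG by (simp add: traces_def act_def \<iota>_def F.group_simps)
  qed
  define i0 where "i0 = e (y \<one>\<^bsub>F\<^esub>)"
  \<comment> \<open>The coordinate of the unit in its block. The unit need not be the representative
    of its own coset, whence the conjugation by \<open>x0\<close> in \<open>?A\<close> and in
    \<open>\<rho>\<close>.\<close>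
  define x0 where "x0 = inv\<^bsub>F\<^esub> (y \<one>\<^bsub>F\<^esub>)"
  have i0: "i0 \<in> {..<n}" using eY onePts by (auto simp: i0_def Y_def)
  have x0: "x0 \<in> Hb" "x0 \<in> carrier F" using y(2)[OF onePts] yF[OF onePts] by (auto simp: x0_def)
  \<comment> \<open>The elements that act on the block \<open>i0\<close> as \<open>\<pi>\<close>
    predicts form a subgroup, so it suffices to test the generators of \<open>H\<close>.\<close>
  let ?A = "{g \<in> carrier G. fst (\<Theta> g) i0 = i0 \<and> snd (\<Theta> g) i0 = x0 \<otimes>\<^bsub>F\<^esub> \<pi> g \<otimes>\<^bsub>F\<^esub> inv\<^bsub>F\<^esub> x0}"
  have "g \<in> ?A" if g: "g \<in> SH" for g
  proof -
    have gH: "g \<in> H" "g \<in> carrier G" "\<pi> g \<in> Hb" using g SH subgroup.mem_carrier[OF H_sub] by (auto simp: Hb_def)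
    have "traces F \<pi> act X \<iota> g \<one>\<^bsub>F\<^esub>"
      by (rule E'(3)[OF g, rule_format, OF act]) (use act_E \<iota>X[OF onePts] g in \<open>auto simp: E_def\<close>)
    moreover have "y (\<pi> g) = y \<one>\<^bsub>F\<^esub>" using gH by (intro y_eq) auto
    moreover have c: "snd (\<Theta> g) i0 \<in> carrier F" using \<Theta>_cl(2)[OF gH(2) i0] Hb.subset by auto
    ultimately have eq: "fst (\<Theta> g) i0 = i0" "snd (\<Theta> g) i0 \<otimes>\<^bsub>F\<^esub> x0 = x0 \<otimes>\<^bsub>F\<^esub> \<pi> g"
      using gH x0 by (auto simp: traces_def act_def \<iota>_def i0_def[symmetric] x0_def[symmetric])
    have "snd (\<Theta> g) i0 = (snd (\<Theta> g) i0 \<otimes>\<^bsub>F\<^esub> x0) \<otimes>\<^bsub>F\<^esub> inv\<^bsub>F\<^esub> x0"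
      using c x0 by (simp add: F.group_simps)
    then show ?thesis using gH eq by simp
  qed
  moreover have "subgroup ?A G"
  proof (rule subgroupI)
    show "?A \<noteq> {}" using x0 i0 by (auto simp: wreath_one intro!: exI[of _ \<one>])
    fix a b assume a: "a \<in> ?A" and b: "b \<in> ?A"
    then show "a \<otimes> b \<in> ?A"
      using x0 i0 by (auto simp: wreath_hom_pointwise[OF \<Theta>(1) _ _ i0] F.group_simps simp del: \<Theta>.hom_mult)
    have "fst (\<Theta> (inv a)) i0 = i0" "snd (\<Theta> (inv a)) i0 \<otimes>\<^bsub>F\<^esub> (x0 \<otimes>\<^bsub>F\<^esub> \<pi> a \<otimes>\<^bsub>F\<^esub> inv\<^bsub>F\<^esub> x0) = \<one>\<^bsub>F\<^esub>"
      using wreath_hom_pointwise[OF \<Theta>(1), of "inv a" a i0] a i0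
      by (simp_all add: wreath_one del: \<Theta>.hom_mult \<Theta>.hom_inv)
    moreover have "snd (\<Theta> (inv a)) i0 \<in> carrier F" using \<Theta>_cl(2)[of "inv a"] i0 a by simp
    ultimately have "snd (\<Theta> (inv a)) i0 = inv\<^bsub>F\<^esub> (x0 \<otimes>\<^bsub>F\<^esub> \<pi> a \<otimes>\<^bsub>F\<^esub> inv\<^bsub>F\<^esub> x0)"
      using a x0 by (intro F.inv_equality[symmetric]) auto
    then show "inv a \<in> ?A" using a x0 \<open>fst (\<Theta> (inv a)) i0 = i0\<close>
      by (simp add: F.group_simps del: \<Theta>.hom_inv)
  qed auto
  ultimately have HA: "H \<subseteq> ?A"
    using generate_subgroup_incl[of SH ?A] SH by auto
  define K where "K = {g \<in> carrier G. fst (\<Theta> g) i0 = i0}"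
  define \<rho> where "\<rho> g = inv\<^bsub>F\<^esub> x0 \<otimes>\<^bsub>F\<^esub> snd (\<Theta> g) i0 \<otimes>\<^bsub>F\<^esub> x0" for g
  show thesis
  proof (rule that)
    show "finite_index G K"
      unfolding K_def using wreath_stabilizer_finite_index[OF gM \<Theta>(1) _ i0] by simp
    show "H \<subseteq> K" using HA by (auto simp: K_def)
    show "\<rho> \<in> hom (G\<lparr>carrier := K\<rparr>) (F\<lparr>carrier := \<pi> ` H\<rparr>)"
      unfolding Hb_def[symmetric]
    proof (rule homI)
      fix g assume "g \<in> carrier (G\<lparr>carrier := K\<rparr>)"
      then have "snd (\<Theta> g) i0 \<in> Hb" using \<Theta>_cl(2)[of g i0] i0 by (auto simp: K_def)
      then show "\<rho> g \<in> carrier ?M" using x0 by (auto simp: \<rho>_def)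
    next
      fix g h assume "g \<in> carrier (G\<lparr>carrier := K\<rparr>)" "h \<in> carrier (G\<lparr>carrier := K\<rparr>)"
      then have gh: "g \<in> carrier G" "h \<in> carrier G" "fst (\<Theta> h) i0 = i0" by (auto simp: K_def)
      have c: "snd (\<Theta> g) i0 \<in> carrier F" "snd (\<Theta> h) i0 \<in> carrier F"
        using \<Theta>_cl(2)[of g i0] \<Theta>_cl(2)[of h i0] gh i0 by auto
      then show "\<rho> (g \<otimes>\<^bsub>G\<lparr>carrier := K\<rparr>\<^esub> h) = \<rho> g \<otimes>\<^bsub>?M\<^esub> \<rho> h"
        using gh x0 by (simp add: \<rho>_def wreath_hom_pointwise[OF \<Theta>(1) _ _ i0] F.group_simps del: \<Theta>.hom_mult)
    qed
    show "\<rho> h = \<pi> h" if "h \<in> H" for h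
      using HA that x0 by (auto simp: \<rho>_def F.group_simps)
  qed
qed

end

section \<open>A wreath product representation faithful on the edge group\<close>

lemma to_Out_eqD:
  assumes "N \<lhd> G" and g: "g \<in> carrier G" "g' \<in> carrier G" and eq: "to_Out G N g = to_Out G N g'"
  shows "\<exists>n\<in>N. \<forall>x\<in>N. g' \<otimes>\<^bsub>G\<^esub> x \<otimes>\<^bsub>G\<^esub> inv\<^bsub>G\<^esub> g' = n \<otimes>\<^bsub>G\<^esub> (g \<otimes>\<^bsub>G\<^esub> x \<otimes>\<^bsub>G\<^esub> inv\<^bsub>G\<^esub> g) \<otimes>\<^bsub>G\<^esub> inv\<^bsub>G\<^esub> n"
proof -
  interpret N: normal N G by fact
  let ?N = "G\<lparr>carrier := N\<rparr>"
  let ?A = "AutoGroup ?N"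
  have gN: "group ?N" using N.is_subgroup N.subgroup_imp_group by blast
  interpret I: normal "Inn ?N" ?A using gN by (rule Inn_normal)
  have cA: "conj_act G N x \<in> carrier ?A" if "x \<in> carrier G" for x
    using conj_act_hom[OF assms(1)] that by (rule hom_in_carrier)
  have "conj_act G N g' \<in> Inn ?N #>\<^bsub>?A\<^esub> conj_act G N g'"
    using cA[OF g(2)] I.subgroup_axioms by (rule I.rcos_self)
  then have "conj_act G N g' \<in> Inn ?N #>\<^bsub>?A\<^esub> conj_act G N g"
    using eq by (simp add: to_Out_def)
  then obtain n where n: "n \<in> N" "conj_act G N g' = conj_act ?N N n \<otimes>\<^bsub>?A\<^esub> conj_act G N g"
    by (auto simp: r_coset_def Inn_def)
  have nA: "conj_act ?N N n \<in> carrier ?A"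
    using n(1) I.subset by (auto simp: Inn_def)
  have "g' \<otimes>\<^bsub>G\<^esub> x \<otimes>\<^bsub>G\<^esub> inv\<^bsub>G\<^esub> g' = n \<otimes>\<^bsub>G\<^esub> (g \<otimes>\<^bsub>G\<^esub> x \<otimes>\<^bsub>G\<^esub> inv\<^bsub>G\<^esub> g) \<otimes>\<^bsub>G\<^esub> inv\<^bsub>G\<^esub> n" if x: "x \<in> N" for x
  proof -
    have "conj_act ?N N n \<in> Bij N" "conj_act G N g \<in> Bij N"
      using nA cA[OF g(1)] by (auto simp: AutoGroup_def auto_def)
    then have "conj_act G N g' x = conj_act ?N N n (conj_act G N g x)"
      unfolding n(2) using x by (simp add: AutoGroup_def BijGroup_def compose_def)
    moreover have "g \<otimes>\<^bsub>G\<^esub> x \<otimes>\<^bsub>G\<^esub> inv\<^bsub>G\<^esub> g \<in> N" using x g N.inv_op_closed2 by blast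
    ultimately show ?thesis
      using x n(1) by (simp add: conj_act_def N.m_inv_consistent[OF N.subgroup_axioms])
  qed
  then show ?thesis using n(1) by blast
qed

text \<open>
  The index set below is \<open>Q \<times> (\<Pi> v. U v / K v)\<close>, where \<open>Q\<close> is the image of \<open>G\<close> in \<open>Out N\<close> and
  \<open>K v\<close> retracts onto \<open>N\<close>.  The group \<open>U v\<close> permutes the factor \<open>U v / K v\<close>; on the block
  \<open>(q, f)\<close> the subgroup \<open>N\<close> then acts by left multiplication twisted by an automorphism of class
  \<open>q (f v)\<^sup>-\<^sup>1\<close>.  Since \<open>Q\<close> is a group, each class occurs equally often for each \<open>v\<close>, so that after a
  conjugation \<open>N\<close> acts in the same way for all \<open>v\<close>.
\<close>

proposition (in normal_amalgam) wreath_representation: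
  assumes fin: "finite (to_Out G N ` carrier G)"
    and ext: "\<And>I :: (('a \<Rightarrow> 'a) set \<times> ('v \<Rightarrow> 'a)) set. extends_to (wreath I (G\<lparr>carrier := N\<rparr>))"
  obtains I :: "(('a \<Rightarrow> 'a) set \<times> ('v \<Rightarrow> 'a)) set" and \<phi>
  where "finite I" "\<phi> \<in> hom G (wreath I (G\<lparr>carrier := N\<rparr>))" "inj_on \<phi> N"
proof -
  have nG: "N \<lhd> G" by (rule normal_axioms)
  let ?M = "G\<lparr>carrier := N\<rparr>"
  have gM: "group ?M" using subgroup_axioms by (rule subgroup_imp_group)
  interpret M: group ?M by (rule gM)
  define \<kappa> where "\<kappa> = to_Out G N"
  define Q where "Q = \<kappa> ` carrier G"
  have \<kappa>Q: "\<kappa> x \<in> Q" if "x \<in> carrier G" for x using that by (simp add: Q_def)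
  have finQ: "finite Q" using fin by (simp add: Q_def \<kappa>_def)
  interpret In: normal "Inn ?M" "AutoGroup ?M" using gM by (rule Inn_normal)
  have "group (Out ?M)" unfolding Out_def by (rule In.factorgroup_is_group)
  moreover have "\<kappa> \<in> hom G (Out ?M)" unfolding \<kappa>_def using nG by (rule to_Out_hom)
  ultimately interpret \<kappa>: group_hom G "Out ?M" \<kappa>
    by (simp add: group_hom_def group_hom_axioms_def is_group)
  have "\<exists>x. x \<in> carrier G \<and> \<kappa> x = q" if "q \<in> Q" for q using that by (auto simp: Q_def)
  then obtain r where r: "\<And>q. q \<in> Q \<Longrightarrow> r q \<in> carrier G" "\<And>q. q \<in> Q \<Longrightarrow> \<kappa> (r q) = q" by metis
  have "\<exists>K \<rho>. finite_index (G\<lparr>carrier := U v\<rparr>) K \<and> N \<subseteq> K \<and> \<rho> \<in> hom (G\<lparr>carrier := K\<rparr>) ?M \<and> (\<forall>n\<in>N. \<rho> n = n)"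
    if "v \<in> V" for v
    using U_LR[OF that] N_fg_U[OF that] by (simp add: property_LR_def virtual_retract_def)
  then obtain K \<rho> where K: "\<And>v. v \<in> V \<Longrightarrow> finite_index (G\<lparr>carrier := U v\<rparr>) (K v)" "\<And>v. v \<in> V \<Longrightarrow> N \<subseteq> K v"
    and \<rho>: "\<And>v. v \<in> V \<Longrightarrow> \<rho> v \<in> hom (G\<lparr>carrier := K v\<rparr>) ?M" "\<And>v n. v \<in> V \<Longrightarrow> n \<in> N \<Longrightarrow> \<rho> v n = n"
    by metis
  have gU: "group (G\<lparr>carrier := U v\<rparr>)" if "v \<in> V" for v using U_subgroup[OF that] by (rule subgroup_imp_group)
  have "\<exists>rep. left_transversal (K v) (G\<lparr>carrier := U v\<rparr>) rep" if v: "v \<in> V" for v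
    using group.left_transversal_exists[OF gU[OF v] K(1)[OF v]] by blast
  then obtain rep where rep: "\<And>v. v \<in> V \<Longrightarrow> left_transversal (K v) (G\<lparr>carrier := U v\<rparr>) (rep v)" by metis
  define R where "R v = rep v ` U v" for v
  define I where "I = Q \<times> PiE V R"
  have repU: "rep v u \<in> U v" if "v \<in> V" "u \<in> U v" for v u
    using left_transversal.rep_closed[OF rep[OF that(1)], of u] that by simp
  have rep_rep: "rep v (rep v u) = rep v u" if "v \<in> V" "u \<in> U v" for v u
    using left_transversal.rep_rep[OF rep[OF that(1)], of u] that by simp
  have RU: "x \<in> U v \<and> rep v x = x" if "v \<in> V" "x \<in> R v" for v x
    using that repU rep_rep by (auto simp: R_def)
  have Um: "x \<otimes> y \<in> U v" "inv x \<in> U v" "\<one> \<in> U v" if "v \<in> V" "x \<in> U v" "y \<in> U v" for v x y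
    using that U_subgroup[OF that(1)] by (auto simp: subgroup.m_closed subgroup.m_inv_closed subgroup.one_closed)
  have finI: "finite I"
  proof -
    have "finite (R v)" if "v \<in> V" for v
      using left_transversal.rep_finite[OF rep[OF that]] by (simp add: R_def)
    then show ?thesis unfolding I_def using finQ V by (intro finite_cartesian_product finite_PiE) auto
  qed
  have neI: "I \<noteq> {}"
  proof -
    have "PiE V R \<noteq> {}" using Um(3) U_subgroup subgroup.one_closed
      by (fastforce simp: PiE_eq_empty_iff R_def)
    then show ?thesis using one_closed by (auto simp: I_def Q_def)
  qed
  let ?W = "wreath I ?M"
  interpret W: group ?W by (rule group_wreath) (rule gM)
  \<comment> \<open>The common form of the action of \<open>N\<close>: no block is moved, and on the
    block \<open>(q, f)\<close> an element acts as its conjugate under \<open>r q\<close>, that is,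
    through an automorphism of the class \<open>q\<close>.\<close>
  define \<theta>N where "\<theta>N n = (id :: _ \<Rightarrow> ('a \<Rightarrow> 'a) set \<times> ('v \<Rightarrow> 'a), \<lambda>i\<in>I. r (fst i) \<otimes> n \<otimes> inv (r (fst i)))" for n
  have \<theta>N: "\<theta>N n \<in> carrier ?W" if "n \<in> N" for n
    using that r conj_N by (auto simp: \<theta>N_def wreath_carrier permutes_id I_def)

  \<comment> \<open>\<open>w\<close> sends the block \<open>(q, f)\<close> to the block of the class
    of \<open>r q \<otimes> inv (d f)\<close>, and turns conjugation by this element into
    conjugation by the chosen representative of its class. The two differ by an inner automorphism,
    and an element of \<open>N\<close> that induces it is the coordinate of \<open>w\<close>. The
    case \<open>d f = f v\<close> serves the vertex groups, the case \<open>d f = t j\<close> the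
    letters.\<close>
  have "\<exists>w. w \<in> carrier ?W \<and> (\<forall>q\<in>Q. \<forall>f\<in>PiE V R. fst w (q, f) = (\<kappa> (r q \<otimes> inv (d f)), f) \<and>
      (\<forall>n\<in>N. (r (\<kappa> (r q \<otimes> inv (d f))) \<otimes> n \<otimes> inv (r (\<kappa> (r q \<otimes> inv (d f))))) \<otimes> snd w (q, f)
         = snd w (q, f) \<otimes> ((r q \<otimes> inv (d f)) \<otimes> n \<otimes> inv (r q \<otimes> inv (d f)))))"
    if d: "\<And>f. f \<in> PiE V R \<Longrightarrow> d f \<in> carrier G" for d
  proof -
    define g where "g = (\<lambda>(q, f). r q \<otimes> inv (d f))"
    have g: "g i \<in> carrier G" if "i \<in> I" for i using that r d by (auto simp: I_def g_def)
    have "\<exists>m. m \<in> N \<and> (\<forall>x\<in>N. r (\<kappa> (g i)) \<otimes> x \<otimes> inv (r (\<kappa> (g i))) = m \<otimes> (g i \<otimes> x \<otimes> inv (g i)) \<otimes> inv m)"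
      if i: "i \<in> I" for i
    proof -
      have "\<kappa> (g i) \<in> Q" using g[OF i] by (auto simp: Q_def)
      then have "r (\<kappa> (g i)) \<in> carrier G" "\<kappa> (g i) = \<kappa> (r (\<kappa> (g i)))" using r by auto
      then show ?thesis
        using to_Out_eqD[OF nG g[OF i], of "r (\<kappa> (g i))", folded \<kappa>_def] unfolding Bex_def by blast
    qed
    then obtain \<nu> where \<nu>: "\<And>i. i \<in> I \<Longrightarrow> \<nu> i \<in> N" "\<And>i x. i \<in> I \<Longrightarrow> x \<in> N \<Longrightarrow>
      r (\<kappa> (g i)) \<otimes> x \<otimes> inv (r (\<kappa> (g i))) = \<nu> i \<otimes> (g i \<otimes> x \<otimes> inv (g i)) \<otimes> inv (\<nu> i)" by metis
    \<comment> \<open>For a fixed \<open>f\<close> the classes undergo a right translation in the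
      group of outer automorphisms.\<close>
    have inj: "inj_on (\<lambda>i. (\<kappa> (g i), snd i)) I"
    proof (rule inj_onI, clarify)
      fix q f q' f' assume *: "(q, f) \<in> I" "(q', f') \<in> I" "\<kappa> (g (q, f)) = \<kappa> (g (q', f'))" "snd (q, f) = snd (q', f')"
      have c: "r q \<in> carrier G" "r q' \<in> carrier G" "d f \<in> carrier G" "f' = f"
        using * r d by (auto simp: I_def)
      have "\<kappa> (g (q, f) \<otimes> d f) = \<kappa> (g (q', f) \<otimes> d f)" using * c g by simp
      then have "\<kappa> (r q) = \<kappa> (r q')" using c by (simp add: g_def m_assoc)
      then show "q = q' \<and> f = f'" using * r by (auto simp: I_def)
    qed
    have img: "(\<lambda>i. (\<kappa> (g i), snd i)) ` I \<subseteq> I" using g by (auto simp: I_def Q_def)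
    have "\<nu> i \<in> carrier ?M" if "i \<in> I" for i using \<nu>(1)[OF that] by simp
    then obtain w where w: "w \<in> carrier ?W" "\<And>i. i \<in> I \<Longrightarrow> fst w i = (\<kappa> (g i), snd i) \<and> snd w i = \<nu> i"
      using wreath_partial_extend[OF gM finI subset_refl inj img, of \<nu>] by blast
    show ?thesis
    proof (intro exI[of _ w] conjI ballI)
      show "w \<in> carrier ?W" by (rule w)
      fix q f assume "q \<in> Q" "f \<in> PiE V R"
      then have i: "(q, f) \<in> I" by (simp add: I_def)
      show "fst w (q, f) = (\<kappa> (r q \<otimes> inv (d f)), f)" using w(2)[OF i] by (simp add: g_def)
      fix n assume n: "n \<in> N"
      have "r (\<kappa> (g (q, f))) \<otimes> n \<otimes> inv (r (\<kappa> (g (q, f)))) \<otimes> \<nu> (q, f) = \<nu> (q, f) \<otimes> (g (q, f) \<otimes> n \<otimes> inv (g (q, f)))"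
        using \<nu>[OF i] n g[OF i] by (simp add: group_simps mem_carrier)
      then show "r (\<kappa> (r q \<otimes> inv (d f))) \<otimes> n \<otimes> inv (r (\<kappa> (r q \<otimes> inv (d f)))) \<otimes> snd w (q, f)
         = snd w (q, f) \<otimes> ((r q \<otimes> inv (d f)) \<otimes> n \<otimes> inv (r q \<otimes> inv (d f)))"
        using w(2)[OF i] by (simp add: g_def)
    qed
  qed
  then have ex_w: "\<exists>w. w \<in> carrier ?W \<and> (\<forall>q\<in>Q. \<forall>f\<in>PiE V R. fst w (q, f) = (\<kappa> (r q \<otimes> inv (d f)), f) \<and>
      (\<forall>n\<in>N. (r (\<kappa> (r q \<otimes> inv (d f))) \<otimes> n \<otimes> inv (r (\<kappa> (r q \<otimes> inv (d f))))) \<otimes> snd w (q, f)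
         = snd w (q, f) \<otimes> ((r q \<otimes> inv (d f)) \<otimes> n \<otimes> inv (r q \<otimes> inv (d f)))))"
    if "\<And>f. f \<in> PiE V R \<Longrightarrow> d f \<in> carrier G" for d using that by blast

  have "\<exists>\<theta>\<in>hom (G\<lparr>carrier := U v\<rparr>) ?W. \<forall>n\<in>N. \<theta> n = \<theta>N n" if v: "v \<in> V" for v
  proof -
    let ?U = "G\<lparr>carrier := U v\<rparr>"
    interpret T: left_transversal "K v" ?U "rep v" by (rule rep[OF v])
    have inv_U: "inv\<^bsub>?U\<^esub> x = inv x" if "x \<in> U v" for x using m_inv_consistent[OF U_subgroup[OF v] that] .
    have cocyc: "T.cocyc u x = inv (rep v (u \<otimes> x)) \<otimes> (u \<otimes> x)" if "u \<in> U v" "x \<in> U v" for u x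
      using that v by (simp add: T.cocyc_def inv_U repU Um)
    have \<rho>N: "\<rho> v k \<in> N" if "k \<in> K v" for k using \<rho>(1)[OF v] that by (auto simp: hom_def)
    have \<rho>m: "\<rho> v (k \<otimes> l) = \<rho> v k \<otimes> \<rho> v l" if "k \<in> K v" "l \<in> K v" for k l
      using \<rho>(1)[OF v] that by (auto simp: hom_def)
    have cK: "T.cocyc u x \<in> K v" if "u \<in> U v" "x \<in> U v" for u x using T.cocyc_closed[of u x] that by simp
    have fv: "f v \<in> U v" "rep v (f v) = f v" if "f \<in> PiE V R" for f using that RU[OF v] v by auto
    \<comment> \<open>The action induced from \<open>\<rho> v\<close>, taking place in the
      coordinate \<open>v\<close> of \<open>f\<close> and with values conjugated by
      \<open>r q\<close>; the class and the other coordinates of \<open>f\<close> do not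
      move.\<close>
    define p where "p u = (\<lambda>(q :: ('a \<Rightarrow> 'a) set, f). (q, f(v := rep v (u \<otimes> f v))))" for u
    define c where "c u = (\<lambda>(q, f). r q \<otimes> \<rho> v (T.cocyc u (f v)) \<otimes> inv (r q))" for u
    let ?\<theta> = "\<lambda>u. (\<lambda>i. if i \<in> I then p u i else i, \<lambda>i\<in>I. c u i)"
    have rep_R: "rep v u \<in> R v" if "u \<in> U v" for u using that by (simp add: R_def)
    have \<theta>': "?\<theta> \<in> hom ?U ?W"
    proof (rule wreath_homI[OF gU[OF v] gM])
      show "p u i \<in> I" if "u \<in> carrier ?U" "i \<in> I" for u i
        using that fv v by (auto simp: p_def I_def PiE_iff extensional_def rep_R Um)
      show "c u i \<in> carrier ?M" if "u \<in> carrier ?U" "i \<in> I" for u i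
        using that fv r conj_N(1) by (auto simp: c_def I_def \<rho>N cK)
      show "p \<one>\<^bsub>?U\<^esub> i = i" if "i \<in> I" for i
        using that fv U_closed[OF v] by (auto simp: p_def I_def)
      show "p (u \<otimes>\<^bsub>?U\<^esub> w) i = p u (p w i)" if "u \<in> carrier ?U" "w \<in> carrier ?U" "i \<in> I" for u w i
        using that fv T.rep_mult_rep[of u] U_closed[OF v] v by (auto simp: p_def I_def m_assoc Um)
      show "c (u \<otimes>\<^bsub>?U\<^esub> w) i = c u (p w i) \<otimes>\<^bsub>?M\<^esub> c w i" if u: "u \<in> carrier ?U" "w \<in> carrier ?U" "i \<in> I" for u w i
      proof -
        obtain q f where i: "i = (q, f)" "q \<in> Q" "f \<in> PiE V R" using u by (auto simp: I_def)
        have 1: "T.cocyc (u \<otimes> w) (f v) = T.cocyc u (rep v (w \<otimes> f v)) \<otimes> T.cocyc w (f v)"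
          using T.cocyc_mult[of u w "f v"] u i fv by simp
        have 2: "T.cocyc u (rep v (w \<otimes> f v)) \<in> K v" "T.cocyc w (f v) \<in> K v"
          using u i fv v by (auto intro!: cK simp: repU Um)
        have "\<rho> v (T.cocyc u (rep v (w \<otimes> f v))) \<in> carrier G" "\<rho> v (T.cocyc w (f v)) \<in> carrier G"
          using \<rho>N[OF 2(1)] \<rho>N[OF 2(2)] by auto
        then show ?thesis using i r by (simp add: p_def c_def 1 \<rho>m[OF 2] group_simps)
      qed
    qed
    interpret \<theta>': group_hom ?U ?W ?\<theta> using \<theta>' gU[OF v] by (simp add: group_hom_def group_hom_axioms_def)
    obtain w where w: "w \<in> carrier ?W"
      "\<And>q f. q \<in> Q \<Longrightarrow> f \<in> PiE V R \<Longrightarrow> fst w (q, f) = (\<kappa> (r q \<otimes> inv (f v)), f)"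
      "\<And>q f n. q \<in> Q \<Longrightarrow> f \<in> PiE V R \<Longrightarrow> n \<in> N \<Longrightarrow>
        (r (\<kappa> (r q \<otimes> inv (f v))) \<otimes> n \<otimes> inv (r (\<kappa> (r q \<otimes> inv (f v))))) \<otimes> snd w (q, f)
         = snd w (q, f) \<otimes> ((r q \<otimes> inv (f v)) \<otimes> n \<otimes> inv (r q \<otimes> inv (f v)))"
      using ex_w[of "\<lambda>f. f v"] fv(1) U_closed[OF v] by blast
    have \<theta>N': "?\<theta> n = (id, \<lambda>i\<in>I. (r (fst i) \<otimes> inv (snd i v)) \<otimes> n \<otimes> inv (r (fst i) \<otimes> inv (snd i v)))"
      if n: "n \<in> N" for n
    proof -
      have nU: "n \<in> U v" using N_le[OF v] n by auto
      have *: "rep v (n \<otimes> x) = x" "T.cocyc n x = inv x \<otimes> n \<otimes> x" if x: "x \<in> U v" "rep v x = x" for x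
      proof -
        have xG: "x \<in> carrier G" "n \<in> carrier G" using x U_closed[OF v] n by auto
        have "inv x \<otimes> (n \<otimes> x) \<in> K v" using conj_N(2)[of x n] n xG K(2)[OF v] by (auto simp: m_assoc)
        then have "rep v x = rep v (n \<otimes> x)" using x nU v by (intro T.rep_eqI) (simp_all add: inv_U Um)
        then show "rep v (n \<otimes> x) = x" using x by simp
        then show "T.cocyc n x = inv x \<otimes> n \<otimes> x" using xG cocyc[OF nU x(1)] by (simp add: m_assoc)
      qed
      have "p n i = i \<and> c n i = (r (fst i) \<otimes> inv (snd i v)) \<otimes> n \<otimes> inv (r (fst i) \<otimes> inv (snd i v))"
        if i: "i \<in> I" for i
      proof -
        obtain q f where i: "i = (q, f)" "q \<in> Q" "f \<in> PiE V R" using i by (auto simp: I_def)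
        have G: "f v \<in> carrier G" "n \<in> carrier G" "r q \<in> carrier G" using fv i U_closed[OF v] n r by auto
        have "\<rho> v (inv (f v) \<otimes> n \<otimes> f v) = inv (f v) \<otimes> n \<otimes> f v"
          using \<rho>(2)[OF v] conj_N(2)[OF G(1) n] by blast
        then show ?thesis using i fv[OF i(3)] * G by (simp add: p_def c_def group_simps)
      qed
      then show ?thesis by (auto simp: fun_eq_iff)
    qed
    define \<theta> where "\<theta> u = w \<otimes>\<^bsub>?W\<^esub> ?\<theta> u \<otimes>\<^bsub>?W\<^esub> inv\<^bsub>?W\<^esub> w" for u
    have "\<theta> \<in> hom ?U ?W"
    proof (rule homI)
      show "\<theta> u \<in> carrier ?W" if "u \<in> carrier ?U" for u
        using w(1) \<theta>'.hom_closed[OF that] unfolding \<theta>_def by simp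
      show "\<theta> (u \<otimes>\<^bsub>?U\<^esub> u') = \<theta> u \<otimes>\<^bsub>?W\<^esub> \<theta> u'" if "u \<in> carrier ?U" "u' \<in> carrier ?U" for u u'
        using w(1) \<theta>'.hom_closed[OF that(1)] \<theta>'.hom_closed[OF that(2)]
        unfolding \<theta>_def \<theta>'.hom_mult[OF that] by (simp add: W.group_simps)
    qed
    moreover have "\<theta> n = \<theta>N n" if n: "n \<in> N" for n
    proof -
      have nU: "n \<in> carrier ?U" using N_le[OF v] n by auto
      have "w \<otimes>\<^bsub>?W\<^esub> ?\<theta> n = \<theta>N n \<otimes>\<^bsub>?W\<^esub> w"
      proof (rule wreath_eqI[OF W.m_closed[OF w(1) \<theta>'.hom_closed[OF nU]] W.m_closed[OF \<theta>N[OF n] w(1)]])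
        fix i assume "i \<in> I"
        then obtain q f where i: "i = (q, f)" "q \<in> Q" "f \<in> PiE V R" by (auto simp: I_def)
        have iI: "(q, f) \<in> I" using i by (simp add: I_def)
        have "f v \<in> carrier G" using fv(1)[OF i(3)] U_closed[OF v] by simp
        then have iI': "(\<kappa> (r q \<otimes> inv (f v)), f) \<in> I"
          unfolding I_def using i r by (intro SigmaI \<kappa>Q) auto
        show "fst (w \<otimes>\<^bsub>?W\<^esub> ?\<theta> n) i = fst (\<theta>N n \<otimes>\<^bsub>?W\<^esub> w) i"
          unfolding \<theta>N'[OF n] by (simp add: wreath_mult \<theta>N_def)
        show "snd (w \<otimes>\<^bsub>?W\<^esub> ?\<theta> n) i = snd (\<theta>N n \<otimes>\<^bsub>?W\<^esub> w) i"
          unfolding \<theta>N'[OF n] using w(3)[OF i(2,3) n] iI iI' w(2)[OF i(2,3)]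
          by (simp add: wreath_mult \<theta>N_def i(1))
      qed
      then show ?thesis
        using w(1) \<theta>N[OF n] unfolding \<theta>_def by (simp add: W.m_assoc)
    qed
    ultimately show ?thesis by blast
  qed
  then obtain \<theta> where \<theta>: "\<And>v. v \<in> V \<Longrightarrow> \<theta> v \<in> hom (G\<lparr>carrier := U v\<rparr>) ?W"
    "\<And>v n. v \<in> V \<Longrightarrow> n \<in> N \<Longrightarrow> \<theta> v n = \<theta>N n" by metis
  have "\<exists>s. s \<in> carrier ?W \<and> (\<forall>n\<in>N. s \<otimes>\<^bsub>?W\<^esub> \<theta>N (inv (t j) \<otimes> n \<otimes> t j) = \<theta>N n \<otimes>\<^bsub>?W\<^esub> s)" if j: "j \<in> J" for j
  proof -
    have tj: "t j \<in> carrier G" using t_closed[OF j] .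
    obtain w where w: "w \<in> carrier ?W"
      "\<And>q f. q \<in> Q \<Longrightarrow> f \<in> PiE V R \<Longrightarrow> fst w (q, f) = (\<kappa> (r q \<otimes> inv (t j)), f)"
      "\<And>q f n. q \<in> Q \<Longrightarrow> f \<in> PiE V R \<Longrightarrow> n \<in> N \<Longrightarrow>
        (r (\<kappa> (r q \<otimes> inv (t j))) \<otimes> n \<otimes> inv (r (\<kappa> (r q \<otimes> inv (t j))))) \<otimes> snd w (q, f)
         = snd w (q, f) \<otimes> ((r q \<otimes> inv (t j)) \<otimes> n \<otimes> inv (r q \<otimes> inv (t j)))"
      using ex_w[of "\<lambda>f. t j"] tj by blast
    have "w \<otimes>\<^bsub>?W\<^esub> \<theta>N (inv (t j) \<otimes> n \<otimes> t j) = \<theta>N n \<otimes>\<^bsub>?W\<^esub> w" if n: "n \<in> N" for n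
    proof (rule wreath_eqI[OF W.m_closed[OF w(1) \<theta>N] W.m_closed[OF \<theta>N[OF n] w(1)]])
      show "inv (t j) \<otimes> n \<otimes> t j \<in> N" using conj_N(2)[OF tj n] .
      fix i assume "i \<in> I"
      then obtain q f where i: "i = (q, f)" "q \<in> Q" "f \<in> PiE V R" by (auto simp: I_def)
      have iI: "(q, f) \<in> I" using i by (simp add: I_def)
      have iI': "(\<kappa> (r q \<otimes> inv (t j)), f) \<in> I"
        unfolding I_def using i r tj by (intro SigmaI \<kappa>Q) auto
      show "fst (w \<otimes>\<^bsub>?W\<^esub> \<theta>N (inv (t j) \<otimes> n \<otimes> t j)) i = fst (\<theta>N n \<otimes>\<^bsub>?W\<^esub> w) i"
        by (simp add: wreath_mult \<theta>N_def)
      have "r q \<otimes> (inv (t j) \<otimes> n \<otimes> t j) \<otimes> inv (r q) = (r q \<otimes> inv (t j)) \<otimes> n \<otimes> inv (r q \<otimes> inv (t j))"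
        using tj r[OF i(2)] n by (simp add: group_simps mem_carrier)
      then show "snd (w \<otimes>\<^bsub>?W\<^esub> \<theta>N (inv (t j) \<otimes> n \<otimes> t j)) i = snd (\<theta>N n \<otimes>\<^bsub>?W\<^esub> w) i"
        using w(3)[OF i(2,3) n] iI iI' w(2)[OF i(2,3)]
        by (simp add: wreath_mult \<theta>N_def i(1))
    qed
    then show ?thesis using w(1) by blast
  qed
  then obtain s where s: "\<And>j. j \<in> J \<Longrightarrow> s j \<in> carrier ?W"
    "\<And>j n. j \<in> J \<Longrightarrow> n \<in> N \<Longrightarrow> s j \<otimes>\<^bsub>?W\<^esub> \<theta>N (inv (t j) \<otimes> n \<otimes> t j) = \<theta>N n \<otimes>\<^bsub>?W\<^esub> s j" by metis
  have "\<exists>\<Theta>\<in>hom G ?W. (\<forall>v\<in>V. \<forall>u\<in>U v. \<Theta> u = \<theta> v u) \<and> (\<forall>j\<in>J. \<Theta> (t j) = s j)"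
    using ext[of I, unfolded extends_to_def, rule_format, of \<theta> \<theta>N s] \<theta> s by simp
  then obtain \<Theta> where \<Theta>: "\<Theta> \<in> hom G ?W" "\<And>v u. v \<in> V \<Longrightarrow> u \<in> U v \<Longrightarrow> \<Theta> u = \<theta> v u" by blast
  have "inj_on \<Theta> N"
  proof (rule inj_onI)
    fix n n' assume n: "n \<in> N" "n' \<in> N" "\<Theta> n = \<Theta> n'"
    obtain v where v: "v \<in> V" using V by auto
    have "\<theta>N n = \<theta>N n'" using n \<Theta>(2)[OF v] \<theta>(2)[OF v] N_le[OF v] by (metis subsetD)
    moreover obtain q f where "(q, f) \<in> I" using neI by auto
    moreover from this have rq: "r q \<in> carrier G" using r by (auto simp: I_def)
    ultimately have "r q \<otimes> n \<otimes> inv (r q) = r q \<otimes> n' \<otimes> inv (r q)"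
      by (auto simp: \<theta>N_def fun_eq_iff restrict_def dest: spec[of _ "(q, f)"] split: if_splits)
    then show "n = n'" using rq n(1,2)[THEN mem_carrier] by simp
  qed
  then show thesis using that finI \<Theta>(1) by blast
qed

section \<open>Complements in virtually abelian groups\<close>

text \<open>For an abelian group \<open>G\<close> this says that the quotient by \<open>B\<close> is
  a torsion group.\<close>

definition cotorsion :: "('a, 'b) monoid_scheme \<Rightarrow> 'a set \<Rightarrow> bool" where
  "cotorsion G B \<longleftrightarrow> subgroup B G \<and> (\<forall>g\<in>carrier G. \<exists>n>0. g [^]\<^bsub>G\<^esub> (n::nat) \<in> B)"

text \<open>
  For abelian groups the following property holds for finitely generated ones and, unlike finite
  generation, passes trivially to subgroups of finite index.
\<close>

definition cotorsion_finite :: "('a, 'b) monoid_scheme \<Rightarrow> bool" where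
  "cotorsion_finite G \<longleftrightarrow> (\<forall>B. cotorsion G B \<longrightarrow> finite_index G B)"

definition torsion_free :: "('a, 'b) monoid_scheme \<Rightarrow> 'a set \<Rightarrow> bool" where
  "torsion_free G B \<longleftrightarrow> (\<forall>b\<in>B. \<forall>n>0. b [^]\<^bsub>G\<^esub> (n::nat) = \<one>\<^bsub>G\<^esub> \<longrightarrow> b = \<one>\<^bsub>G\<^esub>)"

text \<open>Two different powers of \<open>g\<close> lie in the same one of the finitely many
  cosets.\<close>

lemma (in group) finite_index_pow:
  assumes "finite_index G K" "g \<in> carrier G"
  shows "\<exists>n>0. g [^] (n::nat) \<in> K"
proof -
  have K: "subgroup K G" using assms(1) by (rule finite_index_subgroup)
  have "finite (range (\<lambda>n::nat. K #> g [^] n))"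
    by (rule finite_subset[OF _ finite_index_cosets[OF assms(1)]]) (use assms(2) in auto)
  then have "\<not> inj (\<lambda>n::nat. K #> g [^] n)" using finite_imageD infinite_UNIV_nat by blast
  then obtain m n :: nat where "m \<noteq> n" "K #> g [^] m = K #> g [^] n" by (auto simp: inj_def)
  then obtain m n :: nat where mn: "m < n" "K #> g [^] n = K #> g [^] m" by (metis nat_neq_iff)
  have "g [^] n \<otimes> inv (g [^] m) \<in> K" using rcos_eqD[OF K _ _ mn(2)] assms(2) by simp
  moreover have "g [^] n = g [^] (n - m) \<otimes> g [^] m" using mn(1) assms(2) by (simp add: nat_pow_mult)
  ultimately have "g [^] (n - m) \<in> K" using assms(2) by (simp add: m_assoc)
  then show ?thesis using mn(1) by (intro exI[of _ "n - m"]) simp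
qed

text \<open>Each element of \<open>G\<close> has a power in \<open>K\<close> and then a further
  power in \<open>B\<close>, so a cotorsion subgroup of \<open>K\<close> is already cotorsion in
  \<open>G\<close>.\<close>

lemma (in group) cotorsion_finite_restrict:
  assumes "cotorsion_finite G" "finite_index G K"
  shows "cotorsion_finite (G\<lparr>carrier := K\<rparr>)"
  unfolding cotorsion_finite_def
proof (intro allI impI)
  fix B assume B: "cotorsion (G\<lparr>carrier := K\<rparr>) B"
  have K: "subgroup K G" using assms(2) by (rule finite_index_subgroup)
  have BK: "B \<subseteq> K" and BG: "subgroup B G"
    using B incl_subgroup[OF K] subgroup.subset by (fastforce simp: cotorsion_def)+
  have "\<exists>n>0. g [^] (n::nat) \<in> B" if g: "g \<in> carrier G" for g
  proof -
    obtain n :: nat where n: "n > 0" "g [^] n \<in> K" using finite_index_pow[OF assms(2) g] by auto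
    then obtain m :: nat where m: "m > 0" "(g [^] n) [^] m \<in> B"
      using B by (auto simp: cotorsion_def nat_pow_consistent[symmetric])
    then show ?thesis using n g by (intro exI[of _ "n * m"]) (simp add: nat_pow_pow)
  qed
  then have "finite_index G B" using assms(1) BG by (auto simp: cotorsion_finite_def cotorsion_def)
  then have "finite_index (G\<lparr>carrier := K\<rparr>) (B \<inter> K)" using K by (rule finite_index_restrict)
  then show "finite_index (G\<lparr>carrier := K\<rparr>) B" using BK by (simp add: Int_absorb2)
qed

lemma (in comm_group) adjoin_subgroup:
  assumes a: "a \<in> carrier G" and B: "subgroup B G"
  shows "subgroup {a [^] (k::int) \<otimes> b | k b. b \<in> B} G"
proof (rule subgroupI)
  note [simp] = subgroup.mem_carrier[OF B]
  show "{a [^] (k::int) \<otimes> b | k b. b \<in> B} \<noteq> {}" using subgroup.one_closed[OF B] by auto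
  show "{a [^] (k::int) \<otimes> b | k b. b \<in> B} \<subseteq> carrier G" using a by auto
  fix x assume "x \<in> {a [^] (k::int) \<otimes> b | k b. b \<in> B}"
  then obtain k :: int and b where x: "x = a [^] k \<otimes> b" "b \<in> B" by auto
  have "inv x = a [^] (- k) \<otimes> inv b" using x a by (simp add: int_pow_neg inv_mult)
  then show "inv x \<in> {a [^] (k::int) \<otimes> b | k b. b \<in> B}"
    using subgroup.m_inv_closed[OF B x(2)] by blast
  fix y assume "y \<in> {a [^] (k::int) \<otimes> b | k b. b \<in> B}"
  then obtain l :: int and c where y: "y = a [^] l \<otimes> c" "c \<in> B" by auto
  have "x \<otimes> y = a [^] (k + l) \<otimes> (b \<otimes> c)" using x y a by (simp add: int_pow_mult m_ac)
  then show "x \<otimes> y \<in> {a [^] (k::int) \<otimes> b | k b. b \<in> B}"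
    using subgroup.m_closed[OF B x(2) y(2)] by blast
qed

text \<open>The generators are adjoined to \<open>B\<close> one by one, keeping a finite set
  \<open>F\<close> of translates of \<open>B\<close> that covers the subgroup \<open>C\<close>
  obtained. If the \<open>n\<close>-th power of a generator \<open>s\<close> is in \<open>B\<close>,
  the new translates are the old ones multiplied by the powers of \<open>s\<close> with exponents
  from \<open>0\<close> to \<open>n - 1\<close>.\<close>

lemma (in comm_group) fg_cotorsion_finite:
  assumes S: "finite S" "S \<subseteq> carrier G" "generate G S = carrier G"
  shows "cotorsion_finite G"
  unfolding cotorsion_finite_def
proof (intro allI impI)
  fix B assume "cotorsion G B"
  then have B: "subgroup B G" and tor: "\<And>g. g \<in> carrier G \<Longrightarrow> \<exists>n>0. g [^] (n::nat) \<in> B"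
    by (auto simp: cotorsion_def)
  have "\<exists>C F. subgroup C G \<and> B \<subseteq> C \<and> S' \<subseteq> C \<and> finite F \<and> F \<subseteq> carrier G \<and> (\<forall>x\<in>C. \<exists>z\<in>F. x \<otimes> inv z \<in> B)"
    if "finite S'" "S' \<subseteq> carrier G" for S'
    using that
  proof (induction S')
    case empty
    then show ?case using B subgroup.mem_carrier[OF B]
      by (intro exI[of _ B] exI[of _ "{\<one>}"]) auto
  next
    case (insert s S')
    then obtain C F where C: "subgroup C G" "B \<subseteq> C" "S' \<subseteq> C"
      and F: "finite F" "F \<subseteq> carrier G" "\<And>x. x \<in> C \<Longrightarrow> \<exists>z\<in>F. x \<otimes> inv z \<in> B" by auto
    have s: "s \<in> carrier G" using insert by auto
    obtain n :: nat where n: "n > 0" "s [^] n \<in> B" using tor[OF s] by auto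
    let ?C = "{s [^] (k::int) \<otimes> b | k b. b \<in> C}"
    let ?F = "(\<lambda>(i :: int, z). s [^] i \<otimes> z) ` ({0..<int n} \<times> F)"
    have h1: "B \<subseteq> ?C" using C subgroup.mem_carrier[OF C(1)] by (force intro: exI[of _ 0])
    have h2: "insert s S' \<subseteq> ?C"
    proof -
      have "s = s [^] (1::int) \<otimes> \<one>" using s by simp
      then have "s \<in> ?C" using subgroup.one_closed[OF C(1)] by blast
      moreover have "S' \<subseteq> ?C" using C subgroup.mem_carrier[OF C(1)] by (force intro: exI[of _ 0])
      ultimately show ?thesis by auto
    qed
    have h3: "\<exists>z\<in>?F. x \<otimes> inv z \<in> B" if xC: "x \<in> ?C" for x
    proof -
      obtain k :: int and c where x: "x = s [^] k \<otimes> c" "c \<in> C" using xC by auto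
      obtain z where z: "z \<in> F" "c \<otimes> inv z \<in> B" using F(3)[OF x(2)] by auto
      have cz: "c \<in> carrier G" "z \<in> carrier G" using x z F subgroup.mem_carrier[OF C(1)] by auto
      let ?q = "k div int n" and ?i = "k mod int n"
      have "s [^] k = s [^] (int n * ?q + ?i)" by simp
      also have "\<dots> = (s [^] n) [^] ?q \<otimes> s [^] ?i"
        unfolding int_pow_mult[OF s] using s by (simp add: int_pow_pow[symmetric] int_pow_int)
      finally have "x \<otimes> inv (s [^] ?i \<otimes> z) = (s [^] n) [^] ?q \<otimes> (c \<otimes> inv z)"
        using x(1) s cz by (simp add: inv_mult m_ac inv_cancel_left)
      moreover have "(s [^] n) [^] ?q \<in> B" using subgroup_int_pow_closed[OF B n(2)] .
      ultimately have "x \<otimes> inv (s [^] ?i \<otimes> z) \<in> B" using z subgroup.m_closed[OF B] by simp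
      moreover have "s [^] ?i \<otimes> z \<in> ?F" using n z by (auto intro!: image_eqI[of _ _ "(?i, z)"])
      ultimately show ?thesis by blast
    qed
    have h4: "subgroup ?C G" using s C(1) by (rule adjoin_subgroup)
    have h5: "finite ?F" "?F \<subseteq> carrier G" using F s by auto
    show ?case by (rule exI[of _ ?C], rule exI[of _ ?F]) (intro conjI ballI h1 h2 h3 h4 h5)
  qed
  from this[OF S(1,2)] obtain C F where C: "subgroup C G" "S \<subseteq> C"
    and F: "finite F" "F \<subseteq> carrier G" "\<And>x. x \<in> C \<Longrightarrow> \<exists>z\<in>F. x \<otimes> inv z \<in> B" by blast
  have CG: "carrier G \<subseteq> C" using generate_subgroup_incl[OF C(2,1)] S by simp
  then have "\<exists>z. z \<in> F \<and> x \<otimes> inv z \<in> B" if "x \<in> carrier G" for x using F(3) that by blast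
  then obtain f where f: "\<And>x. x \<in> carrier G \<Longrightarrow> f x \<in> F" "\<And>x. x \<in> carrier G \<Longrightarrow> x \<otimes> inv (f x) \<in> B" by metis
  show "finite_index G B"
  proof (rule finite_indexI[OF B, of f])
    show "finite (f ` carrier G)" using f F by (auto intro: finite_subset)
    show "x \<otimes> inv y \<in> B" if xy: "x \<in> carrier G" "y \<in> carrier G" "f x = f y" for x y
    proof -
      have "f y \<in> carrier G" using f F xy by auto
      moreover have "(x \<otimes> inv (f x)) \<otimes> inv (y \<otimes> inv (f y)) \<in> B"
        by (intro subgroup.m_closed[OF B] subgroup.m_inv_closed[OF B] f xy)
      ultimately show ?thesis using xy by (simp add: group_simps)
    qed
  qed
qed

text \<open>By the cocycle identity the values \<open>cocyc s t\<close> on the generators generate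
  the values on all group elements. The transversal is not normalised, so an element of
  \<open>K\<close> equals its cocycle value at \<open>rep \<one>\<close> only up to conjugation by
  \<open>rep \<one>\<close>, which is therefore added to the generators.\<close>

lemma (in group) schreier_fg:
  assumes S: "finite S" "S \<subseteq> carrier G" "generate G S = carrier G" and K: "finite_index G K"
  obtains S' where "finite S'" "S' \<subseteq> K" "generate G S' = K"
proof -
  obtain rep where "left_transversal K G rep" using K by (rule left_transversal_exists)
  then interpret T: left_transversal K G rep .
  let ?R = "rep ` carrier G"
  define S' where "S' = insert (rep \<one>) ((\<lambda>(s, t). T.cocyc s t) ` (S \<times> ?R))"
  have r1: "rep \<one> \<in> K" using T.rep_coset[of \<one>] T.m_inv_closed[of "inv (rep \<one>)"] by simp
  have S': "finite S'" "S' \<subseteq> K"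
    using S T.rep_finite r1 by (auto simp: S'_def intro!: T.cocyc_closed)
  have S'G: "S' \<subseteq> carrier G" using S' T.subset by auto
  have R: "t \<in> carrier G \<and> rep t = t" if "t \<in> ?R" for t using that by auto
  have coc: "\<forall>t\<in>?R. T.cocyc g t \<in> generate G S'" if "g \<in> generate G S" for g
    using that
  proof (induction g)
    case one
    then show ?case using generate.one by (auto simp: T.cocyc_def)
  next
    case (incl s)
    then show ?case by (auto simp: S'_def intro!: generate.incl)
  next
    case (inv s)
    have s: "s \<in> carrier G" using inv S by auto
    show ?case
    proof
      fix t assume t: "t \<in> ?R"
      let ?t = "rep (inv s \<otimes> t)"
      have tG: "t \<in> carrier G" "rep t = t" using R[OF t] by auto
      have "T.cocyc (s \<otimes> inv s) t = T.cocyc s ?t \<otimes> T.cocyc (inv s) t"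
        using s tG by (intro T.cocyc_mult) auto
      moreover have "T.cocyc (s \<otimes> inv s) t = \<one>" using s tG by (simp add: T.cocyc_def)
      moreover have c: "T.cocyc s ?t \<in> carrier G" "T.cocyc (inv s) t \<in> carrier G"
        using s tG T.mem_carrier[OF T.cocyc_closed] by auto
      ultimately have "T.cocyc (inv s) t = inv (T.cocyc s ?t)" using inv_equality
        by (metis inv_inv inv_closed)
      moreover have "T.cocyc s ?t \<in> S'" using inv s tG by (auto simp: S'_def)
      ultimately show "T.cocyc (inv s) t \<in> generate G S'" by (simp add: generate.inv)
    qed
  next
    case (eng g h)
    have gh: "g \<in> carrier G" "h \<in> carrier G" using eng S(3) by auto
    show ?case
    proof
      fix t assume t: "t \<in> ?R"
      have tG: "t \<in> carrier G" using R[OF t] by simp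
      have "rep (h \<otimes> t) \<in> ?R" using gh tG by simp
      then show "T.cocyc (g \<otimes> h) t \<in> generate G S'"
        unfolding T.cocyc_mult[OF gh tG] using eng.IH t by (intro generate.eng) auto
    qed
  qed
  have "k \<in> generate G S'" if k: "k \<in> K" for k
  proof -
    have kG: "k \<in> carrier G" using k by simp
    have "rep (k \<otimes> rep \<one>) = rep \<one>"
      using k r1 kG by (intro T.rep_eqI[symmetric]) auto
    then have "k = rep \<one> \<otimes> T.cocyc k (rep \<one>) \<otimes> inv (rep \<one>)"
      using kG by (simp add: T.cocyc_def group_simps)
    moreover have "T.cocyc k (rep \<one>) \<in> generate G S'" using coc[of k] kG S(3) by auto
    moreover have "rep \<one> \<in> S'" by (simp add: S'_def)
    ultimately show ?thesis by (metis generate.eng generate.incl generate.inv)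
  qed
  moreover have "generate G S' \<subseteq> K" using generate_subgroup_incl[OF S'(2) T.subgroup_axioms] .
  ultimately show thesis using that S' by blast
qed

text \<open>Zorn's lemma gives a maximal \<open>B\<close> among the subgroups that meet
  \<open>D\<close> trivially. If no positive power of \<open>a\<close> were a product of elements of
  \<open>B\<close> and \<open>D\<close>, the subgroup generated by \<open>B\<close> and
  \<open>a\<close> would still meet \<open>D\<close> trivially, and maximality would put
  \<open>a\<close> into \<open>B\<close>.\<close>

lemma (in comm_group) complement_up_to_torsion:
  assumes D: "subgroup D G"
  obtains B where "subgroup B G" "B \<inter> D = {\<one>}"
    "\<And>a. a \<in> carrier G \<Longrightarrow> \<exists>n>0. \<exists>b\<in>B. \<exists>d\<in>D. a [^] (n::nat) = b \<otimes> d"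
proof -
  let ?P = "{B. subgroup B G \<and> B \<inter> D = {\<one>}}"
  have "\<exists>M\<in>?P. \<forall>X\<in>?P. M \<subseteq> X \<longrightarrow> X = M"
  proof (rule subset_Zorn_nonempty)
    have "{\<one>} \<in> ?P" using triv_subgroup subgroup.one_closed[OF D] by auto
    then show "?P \<noteq> {}" by blast
    fix C assume C: "C \<noteq> {}" "subset.chain ?P C"
    then have CP: "subgroup X G" "X \<inter> D = {\<one>}" if "X \<in> C" for X
      using that by (auto simp: subset.chain_def)
    have "subgroup (\<Union>C) G"
    proof (rule subgroupI)
      show "\<Union>C \<subseteq> carrier G" using CP(1) subgroup.subset by blast
      show "\<Union>C \<noteq> {}" using C CP(2) by blast
      show "inv a \<in> \<Union>C" if a: "a \<in> \<Union>C" for a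
      proof -
        obtain X where X: "a \<in> X" "X \<in> C" using a by auto
        then show ?thesis using subgroup.m_inv_closed[OF CP(1)[OF X(2)] X(1)] by blast
      qed
      fix a b assume "a \<in> \<Union>C" "b \<in> \<Union>C"
      then obtain X Y where XY: "a \<in> X" "X \<in> C" "b \<in> Y" "Y \<in> C" by auto
      then have "X \<subseteq> Y \<or> Y \<subseteq> X" using C(2) by (auto simp: subset.chain_def)
      then show "a \<otimes> b \<in> \<Union>C"
      proof
        assume "X \<subseteq> Y"
        then show ?thesis using XY subgroup.m_closed[OF CP(1)[OF XY(4)], of a b] by blast
      next
        assume "Y \<subseteq> X"
        then show ?thesis using XY subgroup.m_closed[OF CP(1)[OF XY(2)], of a b] by blast
      qed
    qed
    moreover have "\<Union>C \<inter> D = {\<one>}" using C(1) CP(2) by auto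
    ultimately show "\<Union>C \<in> ?P" by simp
  qed
  then obtain B where B: "subgroup B G" "B \<inter> D = {\<one>}"
    and max: "\<And>X. subgroup X G \<Longrightarrow> X \<inter> D = {\<one>} \<Longrightarrow> B \<subseteq> X \<Longrightarrow> X = B" by auto
  show thesis
  proof (rule that[OF B])
    fix a assume a: "a \<in> carrier G"
    show "\<exists>n>0. \<exists>b\<in>B. \<exists>d\<in>D. a [^] (n::nat) = b \<otimes> d"
    proof (rule ccontr)
      assume "\<not> ?thesis"
      then have no: "a [^] n \<noteq> b \<otimes> d" if "n > 0" "b \<in> B" "d \<in> D" for n :: nat and b d
        using that by blast
      let ?X = "{a [^] (k::int) \<otimes> b | k b. b \<in> B}"
      have Bc: "b \<in> carrier G" if "b \<in> B" for b using that subgroup.mem_carrier[OF B(1)] by simp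
      have Dc: "d \<in> carrier G" if "d \<in> D" for d using that subgroup.mem_carrier[OF D] by simp
      have BX: "B \<subseteq> ?X"
      proof
        fix b assume b: "b \<in> B"
        then have "b = a [^] (0::int) \<otimes> b" using Bc by simp
        then show "b \<in> ?X" using b by blast
      qed
      have sub: "subgroup ?X G" using a B(1) by (rule adjoin_subgroup)
      have "x = \<one>" if x: "x \<in> ?X" "x \<in> D" for x
      proof -
        obtain k :: int and b where kb: "x = a [^] k \<otimes> b" "b \<in> B" using x by auto
        have "k = 0"
        proof (rule ccontr)
          assume "k \<noteq> 0"
          then consider "k > 0" | "k < 0" by linarith
          then show False
          proof cases
            case 1
            have xb: "x = b \<otimes> a [^] k"
              unfolding kb(1) using a Bc[OF kb(2)] by (intro m_comm) auto
            have "a [^] k = inv b \<otimes> x"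
              unfolding xb using a Bc[OF kb(2)] by (simp add: inv_cancel_left)
            moreover have "a [^] nat k = a [^] k" using 1 by (intro pow_nat) auto
            ultimately have "a [^] nat k = inv b \<otimes> x" by simp
            then show False
              using no[OF _ subgroup.m_inv_closed[OF B(1) kb(2)] x(2), of "nat k"] 1 by simp
          next
            case 2
            have "a [^] nat (- k) = a [^] (- k)" using 2 by (intro pow_nat) auto
            also have "\<dots> = inv (a [^] k)" using a by (rule int_pow_neg)
            also have "\<dots> = b \<otimes> inv x"
              unfolding kb(1) using kb(2) a Bc by (simp add: group_simps)
            finally show False
              using no[OF _ kb(2) subgroup.m_inv_closed[OF D x(2)], of "nat (- k)"] 2 by simp
          qed
        qed
        then have "x \<in> B \<inter> D" using kb x Bc by simp
        then show ?thesis using B(2) by simp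
      qed
      then have "?X \<inter> D = {\<one>}"
        using subgroup.one_closed[OF sub] subgroup.one_closed[OF D] by blast
      then have "?X = B" using max[OF sub _ BX] by simp
      moreover have "a = a [^] (1::int) \<otimes> \<one>" using a by simp
      then have "a \<in> ?X" using subgroup.one_closed[OF B(1)] by blast
      ultimately have "a \<in> B" by simp
      then show False using no[OF _ _ subgroup.one_closed[OF D], of 1 a] a by simp
    qed
  qed
qed

text \<open>A complement up to torsion of the torsion subgroup is torsion-free. It contains a power
  of every element, because the torsion factor dies in a further power, and so it is
  cotorsion.\<close>

lemma (in comm_group) torsion_free_finite_index:
  assumes "cotorsion_finite G"
  obtains B where "finite_index G B" "torsion_free G B"
proof -
  let ?D = "{a \<in> carrier G. \<exists>n>0. a [^] (n::nat) = \<one>}"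
  have D: "subgroup ?D G"
  proof (rule subgroupI)
    fix a assume "a \<in> ?D"
    then obtain n :: nat where a: "a \<in> carrier G" "n > 0" "a [^] n = \<one>" by auto
    then have "inv a [^] n = \<one>" by (simp add: nat_pow_inv)
    then show "inv a \<in> ?D" using a by auto
    fix b assume "b \<in> ?D"
    then obtain m :: nat where b: "b \<in> carrier G" "m > 0" "b [^] m = \<one>" by auto
    have "a [^] (n * m) = \<one>" using a nat_pow_pow[of a n m] by simp
    moreover have "b [^] (n * m) = \<one>" using b nat_pow_pow[of b m n] by (simp add: mult.commute)
    ultimately have "(a \<otimes> b) [^] (n * m) = \<one>" using a b by (simp add: nat_pow_distrib)
    then show "a \<otimes> b \<in> ?D" using a b by (auto intro!: exI[of _ "n * m"])
  qed (auto intro!: exI[of _ \<one>] exI[of _ 1])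
  define E where "E = ?D"
  obtain B where "subgroup B G" "B \<inter> E = {\<one>}"
    "\<And>a. a \<in> carrier G \<Longrightarrow> \<exists>n>0. \<exists>b\<in>B. \<exists>d\<in>E. a [^] (n::nat) = b \<otimes> d"
    using complement_up_to_torsion[OF D[folded E_def]] by blast
  note B = this[unfolded E_def]
  have "cotorsion G B"
    unfolding cotorsion_def
  proof (intro conjI ballI B(1))
    fix a assume a: "a \<in> carrier G"
    obtain n b d where n: "n > 0" "b \<in> B" "d \<in> ?D" "a [^] (n::nat) = b \<otimes> d" using B(3)[OF a] by blast
    then obtain m :: nat where m: "m > 0" "d [^] m = \<one>" by auto
    have bd: "b \<in> carrier G" "d \<in> carrier G" using n subgroup.mem_carrier[OF B(1)] by auto
    have "a [^] (n * m) = (b \<otimes> d) [^] m" using a n by (simp add: nat_pow_pow flip: n(4))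
    also have "\<dots> = b [^] m" using bd m by (simp add: nat_pow_distrib)
    also have "\<dots> \<in> B"
      using subgroup_int_pow_closed[OF B(1) n(2), of "int m"] by (simp add: int_pow_int)
    finally show "\<exists>n>0. a [^] (n::nat) \<in> B" using n m by (intro exI[of _ "n * m"]) simp
  qed
  then have "finite_index G B" using assms by (simp add: cotorsion_finite_def)
  moreover have "torsion_free G B"
    unfolding torsion_free_def using B(2) subgroup.mem_carrier[OF B(1)] by blast
  ultimately show thesis by (rule that)
qed

text \<open>The functions from \<open>I\<close> to \<open>B\<close> form a subgroup \<open>A\<close>
  of finite index that inherits its properties from \<open>B\<close> coordinatewise. As
  \<open>B\<close> is not assumed normal in \<open>M\<close>, neither need \<open>A\<close> be
  normal, so a normal subgroup \<open>Q\<close> of finite index inside \<open>A\<close> is taken at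
  the end: commutativity and torsion-freeness pass to subgroups, and \<open>cotorsion_finite\<close>
  passes to subgroups of finite index.\<close>

lemma wreath_torsion_free_base:
  fixes M :: "('m, 'z) monoid_scheme" and I :: "'i set"
  assumes "group M" and I: "finite I" and B: "finite_index M B" "comm_group (M\<lparr>carrier := B\<rparr>)"
    "torsion_free M B" "cotorsion_finite (M\<lparr>carrier := B\<rparr>)"
  obtains A where "A \<lhd> wreath I M" "finite_index (wreath I M) A"
    "comm_group (wreath I M\<lparr>carrier := A\<rparr>)" "torsion_free (wreath I M) A"
    "cotorsion_finite (wreath I M\<lparr>carrier := A\<rparr>)"
proof -
  let ?W = "wreath I M"
  interpret M: group M by fact
  interpret W: group ?W by (rule group_wreath) fact
  interpret B: subgroup B M using B(1) by (rule finite_index_subgroup)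
  interpret MB: comm_group "M\<lparr>carrier := B\<rparr>" by (rule B(2))
  have B_comm: "x \<otimes>\<^bsub>M\<^esub> y = y \<otimes>\<^bsub>M\<^esub> x" if "x \<in> B" "y \<in> B" for x y
    using MB.m_comm[of x y] that by simp
  define A where "A = {w \<in> carrier ?W. fst w = id \<and> (\<forall>i\<in>I. snd w i \<in> B)}"
  have A_mult: "snd (x \<otimes>\<^bsub>?W\<^esub> y) i = snd x i \<otimes>\<^bsub>M\<^esub> snd y i" if "y \<in> A" "i \<in> I" for x y i
    using that by (simp add: wreath_mult A_def)
  have A_inv: "inv\<^bsub>?W\<^esub> w = (id, \<lambda>i\<in>I. inv\<^bsub>M\<^esub> snd w i)" if w: "w \<in> A" for w
  proof (rule W.inv_equality)
    have c: "\<And>i. i \<in> I \<Longrightarrow> snd w i \<in> carrier M" using w by (auto simp: A_def)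
    then show "(id, \<lambda>i\<in>I. inv\<^bsub>M\<^esub> snd w i) \<otimes>\<^bsub>?W\<^esub> w = \<one>\<^bsub>?W\<^esub>"
      using w by (auto simp: wreath_mult wreath_one A_def)
    show "(id, \<lambda>i\<in>I. inv\<^bsub>M\<^esub> snd w i) \<in> carrier ?W"
      using c by (auto simp: wreath_carrier permutes_id)
  qed (use w in \<open>simp add: A_def\<close>)
  have A_sub: "subgroup A ?W"
  proof (rule W.subgroupI)
    have "\<one>\<^bsub>?W\<^esub> \<in> A" using W.one_closed by (simp add: A_def wreath_one)
    then show "A \<noteq> {}" by blast
    show "inv\<^bsub>?W\<^esub> w \<in> A" if "w \<in> A" for w
      using W.inv_closed[of w] that A_inv[OF that] by (auto simp: A_def)
    show "x \<otimes>\<^bsub>?W\<^esub> y \<in> A" if "x \<in> A" "y \<in> A" for x y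
      using that W.m_closed[of x y] by (auto simp: A_def wreath_mult)
  qed (auto simp: A_def)
  have A_fi: "finite_index ?W A"
  proof (rule W.finite_indexI[OF A_sub, where f = "\<lambda>w. \<lambda>i\<in>I. (fst w i, B #>\<^bsub>M\<^esub> snd w i)"])
    have "(\<lambda>i\<in>I. (fst w i, B #>\<^bsub>M\<^esub> snd w i)) \<in> I \<rightarrow>\<^sub>E I \<times> (\<lambda>x. B #>\<^bsub>M\<^esub> x) ` carrier M"
      if "w \<in> carrier ?W" for w using wreath_closed[OF that] by auto
    then show "finite ((\<lambda>w. \<lambda>i\<in>I. (fst w i, B #>\<^bsub>M\<^esub> snd w i)) ` carrier ?W)"
      by (intro finite_subset[OF _ finite_PiE[OF I finite_cartesian_product[OF I M.finite_index_cosets[OF B(1)]]]]) blast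
    fix x y assume x: "x \<in> carrier ?W" and y: "y \<in> carrier ?W"
      and eq: "(\<lambda>i\<in>I. (fst x i, B #>\<^bsub>M\<^esub> snd x i)) = (\<lambda>i\<in>I. (fst y i, B #>\<^bsub>M\<^esub> snd y i))"
    have eq': "fst x i = fst y i" "B #>\<^bsub>M\<^esub> snd x i = B #>\<^bsub>M\<^esub> snd y i" if "i \<in> I" for i
      using fun_cong[OF eq, of i] that by auto
    define z where "z = x \<otimes>\<^bsub>?W\<^esub> inv\<^bsub>?W\<^esub> y"
    have z: "z \<in> carrier ?W" "x = z \<otimes>\<^bsub>?W\<^esub> y" using x y by (simp_all add: z_def W.m_assoc)
    have *: "fst z j = j \<and> snd z j \<in> B" if j: "j \<in> I" for j
    proof -
      have "fst y permutes I" using y by (simp add: wreath_carrier)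
      then obtain i where i: "i \<in> I" "j = fst y i" using j permutes_image by blast
      have "fst x i = fst z j" "snd x i = snd z j \<otimes>\<^bsub>M\<^esub> snd y i"
        using i by (subst z(2), simp add: wreath_mult)+
      moreover have "snd x i \<otimes>\<^bsub>M\<^esub> inv\<^bsub>M\<^esub> snd y i \<in> B"
        using M.rcos_eqD[OF B.subgroup_axioms _ _ eq'(2)] wreath_closed[OF x] wreath_closed[OF y] i by blast
      ultimately show ?thesis
        using i eq'(1) wreath_closed(2)[OF z(1) j] wreath_closed(2)[OF y i(1)] by (simp add: M.m_assoc)
    qed
    then have "fst z = id"
      using z(1) by (auto simp: wreath_carrier fun_eq_iff permutes_def)
    then show "x \<otimes>\<^bsub>?W\<^esub> inv\<^bsub>?W\<^esub> y \<in> A" using * z(1) by (simp add: A_def z_def[symmetric])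
  qed
  have gA: "group (?W\<lparr>carrier := A\<rparr>)" using A_sub by (rule W.subgroup_imp_group)
  have A_comm: "x \<otimes>\<^bsub>?W\<^esub> y = y \<otimes>\<^bsub>?W\<^esub> x" if "x \<in> A" "y \<in> A" for x y
    using that B_comm by (auto simp: A_def wreath_mult fun_eq_iff)
  have A_pow: "w [^]\<^bsub>?W\<^esub> n \<in> A \<and> (\<forall>i\<in>I. snd (w [^]\<^bsub>?W\<^esub> n) i = snd w i [^]\<^bsub>M\<^esub> n)" if w: "w \<in> A" for w and n :: nat
  proof (induction n)
    case 0
    then show ?case using subgroup.one_closed[OF A_sub] by (simp add: wreath_one)
  next
    case (Suc n)
    then show ?case using subgroup.m_closed[OF A_sub _ w] A_mult[OF w] by simp
  qed
  have A_tf: "torsion_free ?W A"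
    unfolding torsion_free_def
  proof (intro ballI allI impI)
    fix w and n :: nat assume w: "w \<in> A" "0 < n" "w [^]\<^bsub>?W\<^esub> n = \<one>\<^bsub>?W\<^esub>"
    have "snd w i = \<one>\<^bsub>M\<^esub>" if i: "i \<in> I" for i
    proof -
      have "snd w i [^]\<^bsub>M\<^esub> n = \<one>\<^bsub>M\<^esub>" using A_pow[OF w(1), of n] w(3) i by (simp add: wreath_one)
      moreover have "snd w i \<in> B" using w(1) i by (simp add: A_def)
      ultimately show ?thesis using B(3) w(2) by (auto simp: torsion_free_def)
    qed
    then show "w = \<one>\<^bsub>?W\<^esub>"
      using w(1) by (intro wreath_eqI[of _ I M]) (auto simp: A_def wreath_one W.one_closed[unfolded wreath_one])
  qed
  have "cotorsion_finite (?W\<lparr>carrier := A\<rparr>)"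
    unfolding cotorsion_finite_def
  proof (intro allI impI)
    fix C assume C: "cotorsion (?W\<lparr>carrier := A\<rparr>) C"
    interpret A: group "?W\<lparr>carrier := A\<rparr>" by (rule gA)
    interpret C: subgroup C "?W\<lparr>carrier := A\<rparr>" using C by (simp add: cotorsion_def)
    \<comment> \<open>\<open>e i\<close> embeds \<open>B\<close> as the coordinate \<open>i\<close>.
      A cotorsion subgroup \<open>C\<close> of \<open>A\<close> cuts out a cotorsion subgroup
      \<open>C' i\<close> of \<open>B\<close> in each coordinate, and \<open>C\<close> contains the
      product of these finitely many subgroups.\<close>
    define e where "e i b = (id :: 'i \<Rightarrow> 'i, \<lambda>j\<in>I. if j = i then b else \<one>\<^bsub>M\<^esub>)" for i b
    have eA: "e i b \<in> A" if "b \<in> B" for i b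
      using that by (auto simp: e_def A_def wreath_carrier permutes_id)
    have e_hom: "group_hom (M\<lparr>carrier := B\<rparr>) (?W\<lparr>carrier := A\<rparr>) (e i)" for i
    proof (intro group_hom.intro group_hom_axioms.intro homI)
      show "e i b \<in> carrier (?W\<lparr>carrier := A\<rparr>)" if "b \<in> carrier (M\<lparr>carrier := B\<rparr>)" for b
        using eA that by simp
      show "e i (b \<otimes>\<^bsub>M\<lparr>carrier := B\<rparr>\<^esub> b') = e i b \<otimes>\<^bsub>?W\<lparr>carrier := A\<rparr>\<^esub> e i b'"
        if "b \<in> carrier (M\<lparr>carrier := B\<rparr>)" "b' \<in> carrier (M\<lparr>carrier := B\<rparr>)" for b b'
        using that by (auto simp: e_def wreath_mult)
    qed (rule MB.is_group, rule gA)
    define C' where "C' i = {b \<in> B. e i b \<in> C}" for i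
    have C'_fi: "finite_index (M\<lparr>carrier := B\<rparr>) (C' i)" for i
    proof -
      interpret e: group_hom "M\<lparr>carrier := B\<rparr>" "?W\<lparr>carrier := A\<rparr>" "e i" by (rule e_hom)
      have "cotorsion (M\<lparr>carrier := B\<rparr>) (C' i)"
        unfolding cotorsion_def
      proof (intro conjI ballI)
        show "subgroup (C' i) (M\<lparr>carrier := B\<rparr>)"
        proof (rule MB.subgroupI)
          show "C' i \<noteq> {}"
            using C.one_closed e.hom_one by (auto simp: C'_def intro!: exI[of _ "\<one>\<^bsub>M\<^esub>"])
          show "inv\<^bsub>M\<lparr>carrier := B\<rparr>\<^esub> b \<in> C' i" if "b \<in> C' i" for b
          proof -
            have b: "b \<in> carrier (M\<lparr>carrier := B\<rparr>)" "e i b \<in> C" using that by (auto simp: C'_def)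
            then have "e i (inv\<^bsub>M\<lparr>carrier := B\<rparr>\<^esub> b) \<in> C" using C.m_inv_closed[OF b(2)] by simp
            then show ?thesis using MB.inv_closed[OF b(1)] by (simp add: C'_def)
          qed
          show "b \<otimes>\<^bsub>M\<lparr>carrier := B\<rparr>\<^esub> b' \<in> C' i" if "b \<in> C' i" "b' \<in> C' i" for b b'
            using that C.m_closed[of "e i b" "e i b'"] e.hom_mult[of b b'] by (auto simp: C'_def)
        qed (auto simp: C'_def)
        fix b assume b: "b \<in> carrier (M\<lparr>carrier := B\<rparr>)"
        then obtain n :: nat where n: "n > 0" "e i b [^]\<^bsub>?W\<lparr>carrier := A\<rparr>\<^esub> n \<in> C"
          using C e.hom_closed[OF b] by (auto simp: cotorsion_def)
        then have "b [^]\<^bsub>M\<lparr>carrier := B\<rparr>\<^esub> n \<in> C' i"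
          using MB.nat_pow_closed[OF b, of n] e.hom_nat_pow[OF b, of n] by (simp add: C'_def)
        then show "\<exists>n>0. b [^]\<^bsub>M\<lparr>carrier := B\<rparr>\<^esub> (n::nat) \<in> C' i" using n by blast
      qed
      then show ?thesis using B(4) by (simp add: cotorsion_finite_def)
    qed
    have inC: "z \<in> C" if z: "z \<in> A" "\<And>i. i \<in> I \<Longrightarrow> snd z i \<in> C' i" for z
    proof -
      define part where "part S = (id :: 'i \<Rightarrow> 'i, \<lambda>j\<in>I. if j \<in> S then snd z j else \<one>\<^bsub>M\<^esub>)" for S
      have zc: "snd z j \<in> carrier M" if "j \<in> I" for j using z(1) that by (auto simp: A_def)
      have "part S \<in> C" if "finite S" "S \<subseteq> I" for S
        using that
      proof (induction S)
        case empty
        have "part {} = \<one>\<^bsub>?W\<^esub>" by (auto simp: part_def wreath_one)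
        then show ?case using C.one_closed by simp
      next
        case (insert i S)
        have "part (insert i S) = e i (snd z i) \<otimes>\<^bsub>?W\<^esub> part S"
          using insert zc by (auto simp: part_def e_def wreath_mult fun_eq_iff)
        moreover have "e i (snd z i) \<in> C" using z(2) insert by (auto simp: C'_def)
        moreover have "part S \<in> C" using insert by simp
        ultimately show ?case using C.m_closed[of "e i (snd z i)" "part S"] by simp
      qed
      from this[OF I subset_refl] have "part I \<in> C" .
      moreover have "part I = z"
        using z(1) by (intro wreath_eqI[of _ I M]) (auto simp: A_def wreath_carrier permutes_id part_def zc)
      ultimately show ?thesis by simp
    qed
    have C'_sub: "subgroup (C' i) (M\<lparr>carrier := B\<rparr>)" for i using C'_fi by (rule finite_index_subgroup)
    show "finite_index (?W\<lparr>carrier := A\<rparr>) C"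
    proof (rule A.finite_indexI[OF C.subgroup_axioms, where f = "\<lambda>w. \<lambda>i\<in>I. C' i #>\<^bsub>M\<^esub> snd w i"])
      have "finite ((\<lambda>x. C' i #>\<^bsub>M\<^esub> x) ` B)" for i
        using MB.finite_index_cosets[OF C'_fi, of i] by simp
      then have "finite (\<Pi>\<^sub>E i\<in>I. (\<lambda>x. C' i #>\<^bsub>M\<^esub> x) ` B)" using I by (intro finite_PiE) auto
      then show "finite ((\<lambda>w. \<lambda>i\<in>I. C' i #>\<^bsub>M\<^esub> snd w i) ` carrier (?W\<lparr>carrier := A\<rparr>))"
        by (rule finite_subset[rotated]) (auto simp: A_def)
      fix x y assume "x \<in> carrier (?W\<lparr>carrier := A\<rparr>)" "y \<in> carrier (?W\<lparr>carrier := A\<rparr>)"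
        and eq: "(\<lambda>i\<in>I. C' i #>\<^bsub>M\<^esub> snd x i) = (\<lambda>i\<in>I. C' i #>\<^bsub>M\<^esub> snd y i)"
      then have xy: "x \<in> A" "y \<in> A" by auto
      have iy: "inv\<^bsub>?W\<^esub> y \<in> A" using subgroup.m_inv_closed[OF A_sub xy(2)] .
      have "x \<otimes>\<^bsub>?W\<^esub> inv\<^bsub>?W\<^esub> y \<in> C"
      proof (rule inC)
        show "x \<otimes>\<^bsub>?W\<^esub> inv\<^bsub>?W\<^esub> y \<in> A" using subgroup.m_closed[OF A_sub xy(1) iy] .
        fix i assume i: "i \<in> I"
        have s: "snd x i \<in> B" "snd y i \<in> B" using xy i by (auto simp: A_def)
        have "C' i #>\<^bsub>M\<^esub> snd x i = C' i #>\<^bsub>M\<^esub> snd y i" using fun_cong[OF eq, of i] i by simp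
        then have "snd x i \<otimes>\<^bsub>M\<^esub> inv\<^bsub>M\<lparr>carrier := B\<rparr>\<^esub> snd y i \<in> C' i"
          using MB.rcos_eqD[OF C'_sub[of i], of "snd x i" "snd y i"] s by simp
        then show "snd (x \<otimes>\<^bsub>?W\<^esub> inv\<^bsub>?W\<^esub> y) i \<in> C' i"
          using A_mult[OF iy i] A_inv[OF xy(2)] i s by (simp add: M.m_inv_consistent[OF B.subgroup_axioms])
      qed
      then show "x \<otimes>\<^bsub>?W\<lparr>carrier := A\<rparr>\<^esub> inv\<^bsub>?W\<lparr>carrier := A\<rparr>\<^esub> y \<in> C"
        using xy by (simp add: W.m_inv_consistent[OF A_sub])
    qed
  qed
  note A_cf = this
  obtain Q where Q: "Q \<lhd> ?W" "finite_index ?W Q" "Q \<subseteq> A" using W.finite_index_normal_core[OF A_fi] by blast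
  have Q_sub: "subgroup Q ?W" using Q(2) by (rule finite_index_subgroup)
  show thesis
  proof (rule that[OF Q(1,2)])
    have "group (?W\<lparr>carrier := Q\<rparr>)" using Q_sub by (rule W.subgroup_imp_group)
    then show "comm_group (?W\<lparr>carrier := Q\<rparr>)"
      by (rule group.group_comm_groupI) (simp add: A_comm[OF subsetD[OF Q(3)] subsetD[OF Q(3)]])
    show "torsion_free ?W Q" using A_tf Q(3) by (auto simp: torsion_free_def)
    have "finite_index (?W\<lparr>carrier := A\<rparr>) (Q \<inter> A)" using W.finite_index_restrict[OF Q(2) A_sub] .
    then have "finite_index (?W\<lparr>carrier := A\<rparr>) Q" using Q(3) by (simp add: Int_absorb2)
    from group.cotorsion_finite_restrict[OF gA A_cf this]
    show "cotorsion_finite (?W\<lparr>carrier := Q\<rparr>)" by simp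
  qed
qed

section \<open>Complements that are invariant under conjugation\<close>

lemma (in group) finprod_conj:
  assumes "comm_group (G\<lparr>carrier := D\<rparr>)" "subgroup D G" and h: "h \<in> carrier G"
    and hD: "\<And>d. d \<in> D \<Longrightarrow> h \<otimes> d \<otimes> inv h \<in> D" and "finite T" "\<And>t. t \<in> T \<Longrightarrow> f t \<in> D"
  shows "finprod (G\<lparr>carrier := D\<rparr>) (\<lambda>t. h \<otimes> f t \<otimes> inv h) T = h \<otimes> finprod (G\<lparr>carrier := D\<rparr>) f T \<otimes> inv h"
  using assms(5,6)
proof (induction T)
  interpret D: comm_group "G\<lparr>carrier := D\<rparr>" by fact
  {
    case empty
    then show ?case using h by simp
  next
    case (insert t T)
    have "finprod (G\<lparr>carrier := D\<rparr>) f T \<in> D" using D.finprod_closed[of f T] insert by auto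
    then have "finprod (G\<lparr>carrier := D\<rparr>) f T \<in> carrier G" "f t \<in> carrier G"
      using insert subgroup.mem_carrier[OF assms(2)] by auto
    moreover have "finprod (G\<lparr>carrier := D\<rparr>) (\<lambda>t. h \<otimes> f t \<otimes> inv h) (insert t T)
      = (h \<otimes> f t \<otimes> inv h) \<otimes> (h \<otimes> finprod (G\<lparr>carrier := D\<rparr>) f T \<otimes> inv h)"
      using D.finprod_insert[of T t "\<lambda>t. h \<otimes> f t \<otimes> inv h"] insert hD by (simp add: Pi_iff)
    moreover have "finprod (G\<lparr>carrier := D\<rparr>) f (insert t T) = f t \<otimes> finprod (G\<lparr>carrier := D\<rparr>) f T"
      using D.finprod_insert[of T t f] insert by (simp add: Pi_iff)
    ultimately show ?case using h by (simp add: group_simps)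
  }
qed

text \<open>
  Maschke's argument: a complement \<open>B1\<close> of \<open>D\<close> up to finite index gives a projection \<open>r\<close> onto \<open>D\<close>;
  averaging \<open>r\<close> over coset representatives of \<open>H \<inter> A\<close> in \<open>H\<close> makes its kernel invariant under \<open>H\<close>.
\<close>

lemma (in group) invariant_complement:
  assumes A: "A \<lhd> G" "finite_index G A" "comm_group (G\<lparr>carrier := A\<rparr>)"
    "torsion_free G A" "cotorsion_finite (G\<lparr>carrier := A\<rparr>)"
    and D: "subgroup D G" "D \<subseteq> A" and H: "subgroup H G"
    and HD: "\<And>h d. h \<in> H \<Longrightarrow> d \<in> D \<Longrightarrow> h \<otimes> d \<otimes> inv h \<in> D"
  obtains B where "subgroup B G" "B \<subseteq> A" "\<And>h b. h \<in> H \<Longrightarrow> b \<in> B \<Longrightarrow> h \<otimes> b \<otimes> inv h \<in> B"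
    "B \<inter> D = {\<one>}" "finite_index G {b \<otimes> d | b d. b \<in> B \<and> d \<in> D}"
proof -
  interpret A: normal A G by (rule A(1))
  interpret D: subgroup D G by (rule D(1))
  interpret H: subgroup H G by (rule H)
  interpret AG: comm_group "G\<lparr>carrier := A\<rparr>" by (rule A(3))
  interpret HG: group "G\<lparr>carrier := H\<rparr>" using H by (rule subgroup_imp_group)
  have comm: "x \<otimes> y = y \<otimes> x" if "x \<in> A" "y \<in> A" for x y using AG.m_comm[of x y] that by simp
  have Dc: "comm_group (G\<lparr>carrier := D\<rparr>)"
    by (rule group.group_comm_groupI[OF subgroup_imp_group[OF D(1)]]) (use comm D in auto)
  interpret DG: comm_group "G\<lparr>carrier := D\<rparr>" by (rule Dc)
  have DA: "subgroup D (G\<lparr>carrier := A\<rparr>)" using D A.subgroup_axioms by (intro subgroup_incl) auto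
  obtain B1 where "subgroup B1 (G\<lparr>carrier := A\<rparr>)" "B1 \<inter> D = {\<one>\<^bsub>G\<lparr>carrier := A\<rparr>\<^esub>}"
    "\<And>a. a \<in> carrier (G\<lparr>carrier := A\<rparr>) \<Longrightarrow>
      \<exists>n>0. \<exists>b\<in>B1. \<exists>d\<in>D. a [^]\<^bsub>G\<lparr>carrier := A\<rparr>\<^esub> (n::nat) = b \<otimes>\<^bsub>G\<lparr>carrier := A\<rparr>\<^esub> d"
    using AG.complement_up_to_torsion[OF DA] by blast
  then have B1: "subgroup B1 (G\<lparr>carrier := A\<rparr>)" "B1 \<inter> D = {\<one>}"
    "\<And>a. a \<in> A \<Longrightarrow> \<exists>n>0. \<exists>b\<in>B1. \<exists>d\<in>D. a [^] (n::nat) = b \<otimes> d"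
    by (simp_all add: nat_pow_consistent[symmetric])
  have B1G: "subgroup B1 G" using incl_subgroup[OF A.subgroup_axioms B1(1)] .
  interpret B1: subgroup B1 G by (rule B1G)
  have B1A: "B1 \<subseteq> A" using subgroup.subset[OF B1(1)] by simp
  \<comment> \<open>The subgroup on which the projection \<open>r\<close> onto \<open>D\<close>
    along \<open>B1\<close> is defined; it contains a power of every element of
    \<open>A\<close>.\<close>
  define A1 where "A1 = {b \<otimes> d | b d. b \<in> B1 \<and> d \<in> D}"
  have A1A: "A1 \<subseteq> A" using B1A D by (auto simp: A1_def)
  have uniq: "d = d'" if "b \<in> B1" "b' \<in> B1" "d \<in> D" "d' \<in> D" "b \<otimes> d = b' \<otimes> d'" for b b' d d'
  proof -
    have "inv b' \<otimes> b = inv b' \<otimes> (b \<otimes> d) \<otimes> inv d" using that(1-4) by (simp add: group_simps)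
    also have "\<dots> = d' \<otimes> inv d" unfolding that(5) using that(1-4) by (simp add: group_simps)
    finally have "inv b' \<otimes> b = d' \<otimes> inv d" .
    then have "d' \<otimes> inv d \<in> B1 \<inter> D" using that by (metis B1.m_closed B1.m_inv_closed D.m_closed D.m_inv_closed IntI)
    then have "d' \<otimes> inv d = \<one>" using B1(2) by simp
    then have "d' \<otimes> inv d \<otimes> d = d" using that by simp
    then show ?thesis using that by (simp add: m_assoc)
  qed
  define r where "r a = (SOME d. d \<in> D \<and> (\<exists>b\<in>B1. a = b \<otimes> d))" for a
  have r_eq: "r (b \<otimes> d) = d" if bd: "b \<in> B1" "d \<in> D" for b d
  proof -
    have "r (b \<otimes> d) \<in> D \<and> (\<exists>b'\<in>B1. b \<otimes> d = b' \<otimes> r (b \<otimes> d))"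
      unfolding r_def by (rule someI[of _ d]) (use bd in auto)
    then show ?thesis using uniq bd by metis
  qed
  have rD: "r a \<in> D" if "a \<in> A1" for a using that r_eq by (auto simp: A1_def)
  have A1m: "a \<otimes> a' \<in> A1 \<and> r (a \<otimes> a') = r a \<otimes> r a'" if aa': "a \<in> A1" "a' \<in> A1" for a a'
  proof -
    obtain b d b' d' where bd: "b \<in> B1" "d \<in> D" "a = b \<otimes> d" "b' \<in> B1" "d' \<in> D" "a' = b' \<otimes> d'"
      using aa' by (auto simp: A1_def)
    have "d \<otimes> b' = b' \<otimes> d" using bd B1A D by (intro comm) auto
    then have "b \<otimes> (d \<otimes> b') \<otimes> d' = b \<otimes> (b' \<otimes> d) \<otimes> d'" by simp
    then have "a \<otimes> a' = (b \<otimes> b') \<otimes> (d \<otimes> d')" using bd by (simp add: m_assoc)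
    moreover have "b \<otimes> b' \<in> B1" "d \<otimes> d' \<in> D" using bd by auto
    ultimately show ?thesis using r_eq bd by (auto simp: A1_def)
  qed
  have A1_D: "d \<in> A1 \<and> r d = d" if d: "d \<in> D" for d
  proof -
    have "d = \<one> \<otimes> d" using d by simp
    then have "d \<in> A1" using d B1.one_closed unfolding A1_def by blast
    then show ?thesis using r_eq[OF B1.one_closed d] d by simp
  qed
  have A1i: "inv a \<in> A1" if a: "a \<in> A1" for a
  proof -
    obtain b d where bd: "b \<in> B1" "d \<in> D" "a = b \<otimes> d" using a by (auto simp: A1_def)
    have "inv b \<in> A" "inv d \<in> A" using bd B1A D A.m_inv_closed by auto
    then have "inv a = inv b \<otimes> inv d" using bd comm by (simp add: inv_mult_group)
    then show ?thesis using bd by (auto simp: A1_def)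
  qed
  have A1p: "a [^] (n::nat) \<in> A1" if a: "a \<in> A1" for a n
  proof (induction n)
    case 0
    then show ?case using A1_D[OF D.one_closed] by simp
  next
    case (Suc n)
    then show ?case using A1m[OF _ a] by simp
  qed
  have "finite_index (G\<lparr>carrier := H\<rparr>) (A \<inter> H)" using A(2) H by (rule finite_index_restrict)
  then obtain rep where "left_transversal (A \<inter> H) (G\<lparr>carrier := H\<rparr>) rep"
    by (rule HG.left_transversal_exists)
  then interpret T: left_transversal "A \<inter> H" "G\<lparr>carrier := H\<rparr>" rep .
  have inv_H: "inv\<^bsub>G\<lparr>carrier := H\<rparr>\<^esub> h = inv h" if "h \<in> H" for h using m_inv_consistent[OF H that] .
  define T where "T = rep ` H"
  have T: "finite T" "T \<subseteq> H" using T.rep_finite T.rep_closed by (auto simp: T_def)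
  have TG: "t \<in> carrier G" if "t \<in> T" for t using that T by auto
  have T_ne: "T \<noteq> {}" using H.one_closed unfolding T_def by blast
  have rep_T: "rep t = t" if "t \<in> T" for t using that T.rep_rep by (auto simp: T_def)
  have conjA: "inv g \<otimes> a \<otimes> g \<in> A" "g \<otimes> a \<otimes> inv g \<in> A" if "g \<in> carrier G" "a \<in> A" for g a
    using that A.inv_op_closed1 A.inv_op_closed2 by auto
  have conjD: "inv h \<otimes> d \<otimes> h \<in> D" if "h \<in> H" "d \<in> D" for h d
    using HD[of "inv h" d] that by simp
  \<comment> \<open>The elements at which the conjugates \<open>F t\<close> of the partial
    projection \<open>r\<close> are defined for all representatives \<open>t\<close>.\<close>
  define A2 where "A2 = {a \<in> A. \<forall>t\<in>T. inv t \<otimes> a \<otimes> t \<in> A1}"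
  define F where "F t a = t \<otimes> r (inv t \<otimes> a \<otimes> t) \<otimes> inv t" for t a
  define av where "av a = finprod (G\<lparr>carrier := D\<rparr>) (\<lambda>t. F t a) T" for a
  have FD: "F t a \<in> D" if "t \<in> T" "a \<in> A2" for t a
    using that HD rD T by (auto simp: F_def A2_def)
  have avD: "av a \<in> D" if "a \<in> A2" for a
    using DG.finprod_closed[of "\<lambda>t. F t a" T] FD that by (auto simp: av_def)
  have conj_mult: "inv t \<otimes> (a \<otimes> b) \<otimes> t = (inv t \<otimes> a \<otimes> t) \<otimes> (inv t \<otimes> b \<otimes> t)"
    if "t \<in> carrier G" "a \<in> carrier G" "b \<in> carrier G" for t a b
    using that by (simp add: group_simps)
  have A2m: "a \<otimes> b \<in> A2 \<and> av (a \<otimes> b) = av a \<otimes> av b" if ab: "a \<in> A2" "b \<in> A2" for a b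
  proof -
    have abA: "a \<in> A" "b \<in> A" using ab by (auto simp: A2_def)
    have 1: "inv t \<otimes> (a \<otimes> b) \<otimes> t \<in> A1 \<and> F t (a \<otimes> b) = F t a \<otimes> F t b" if t: "t \<in> T" for t
    proof -
      let ?a = "inv t \<otimes> a \<otimes> t" and ?b = "inv t \<otimes> b \<otimes> t"
      have c: "?a \<in> A1" "?b \<in> A1" using ab t by (auto simp: A2_def)
      have eq: "inv t \<otimes> (a \<otimes> b) \<otimes> t = ?a \<otimes> ?b" using TG[OF t] abA by (intro conj_mult) auto
      have rc: "r ?a \<in> carrier G" "r ?b \<in> carrier G" using rD[OF c(1)] rD[OF c(2)] by auto
      have "F t (a \<otimes> b) = t \<otimes> (r ?a \<otimes> r ?b) \<otimes> inv t" using A1m[OF c] by (simp only: F_def eq)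
      also have "\<dots> = F t a \<otimes> F t b" using rc TG[OF t] by (simp add: F_def group_simps)
      finally show ?thesis using A1m[OF c] eq by simp
    qed
    have "av (a \<otimes> b) = finprod (G\<lparr>carrier := D\<rparr>) (\<lambda>t. F t a \<otimes>\<^bsub>G\<lparr>carrier := D\<rparr>\<^esub> F t b) T"
      unfolding av_def using 1 FD[OF _ ab(1)] FD[OF _ ab(2)] by (intro DG.finprod_cong') auto
    also have "\<dots> = av a \<otimes>\<^bsub>G\<lparr>carrier := D\<rparr>\<^esub> av b"
      unfolding av_def using FD[OF _ ab(1)] FD[OF _ ab(2)] by (intro DG.finprod_multf) auto
    finally show ?thesis using 1 abA by (auto simp: A2_def)
  qed
  \<comment> \<open>The product \<open>av\<close> is not divided by the number of factors, so on
    \<open>D\<close> it is a power map and not the identity. It still has trivial kernel there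
    because \<open>A\<close> is torsion-free, and this is what makes \<open>B\<close> meet
    \<open>D\<close> trivially.\<close>
  have A2_D: "d \<in> A2 \<and> av d = d [^] card T" if d: "d \<in> D" for d
  proof -
    have 1: "inv t \<otimes> d \<otimes> t \<in> A1 \<and> F t d = d" if t: "t \<in> T" for t
      using A1_D[OF conjD[OF _ d], of t] t T d TG[OF t] by (auto simp: F_def group_simps)
    have "av d = finprod (G\<lparr>carrier := D\<rparr>) (\<lambda>t. d) T"
      unfolding av_def using 1 d by (intro DG.finprod_cong') auto
    also have "\<dots> = d [^] card T" using d DG.finprod_const[of d T] by (simp add: nat_pow_consistent[symmetric])
    finally show ?thesis using 1 d D by (auto simp: A2_def)
  qed
  have A2i: "inv a \<in> A2" if a: "a \<in> A2" for a
  proof -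
    have "inv t \<otimes> inv a \<otimes> t \<in> A1" if t: "t \<in> T" for t
    proof -
      have "inv (inv t \<otimes> a \<otimes> t) \<in> A1" using a t by (intro A1i) (auto simp: A2_def)
      then show ?thesis using a TG[OF t] by (auto simp: A2_def group_simps)
    qed
    then show ?thesis using a by (auto simp: A2_def)
  qed
  have A2_conj: "h \<otimes> a \<otimes> inv h \<in> A2 \<and> av (h \<otimes> a \<otimes> inv h) = h \<otimes> av a \<otimes> inv h" if h: "h \<in> H" and a: "a \<in> A2" for h a
  proof -
    have aA: "a \<in> A" "a \<in> carrier G" using a by (auto simp: A2_def)
    have hG: "h \<in> carrier G" using h by simp
    \<comment> \<open>Left translation by \<open>inv h\<close> permutes the cosets of
      \<open>A \<inter> H\<close> in \<open>H\<close>, and \<open>\<sigma>\<close> is this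
      permutation on representatives. The element \<open>x\<close> of \<open>A\<close> by which
      \<open>t\<close> differs from \<open>h \<otimes> \<sigma> t\<close> commutes with
      \<open>A\<close> and drops out of both conjugations, so conjugating by \<open>h\<close> merely
      permutes the factors of \<open>av\<close>.\<close>
    define \<sigma> where "\<sigma> t = rep (inv h \<otimes> t)" for t
    have hT: "inv h \<otimes> t \<in> H" if "t \<in> T" for t using that T h by auto
    have \<sigma>T: "\<sigma> t \<in> T" if "t \<in> T" for t using hT[OF that] by (auto simp: \<sigma>_def T_def)
    have \<sigma>_inj: "inj_on \<sigma> T"
    proof (rule inj_onI)
      fix t s assume ts: "t \<in> T" "s \<in> T" "\<sigma> t = \<sigma> s"
      then have "inv\<^bsub>G\<lparr>carrier := H\<rparr>\<^esub> (inv h \<otimes> t) \<otimes>\<^bsub>G\<lparr>carrier := H\<rparr>\<^esub> (inv h \<otimes> s) \<in> A \<inter> H"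
        using hT by (intro T.rep_eqD) (auto simp: \<sigma>_def)
      then have "inv\<^bsub>G\<lparr>carrier := H\<rparr>\<^esub> t \<otimes>\<^bsub>G\<lparr>carrier := H\<rparr>\<^esub> s \<in> A \<inter> H"
        using ts hT T hG TG by (simp add: inv_H subset_iff group_simps)
      then have "rep t = rep s" using ts T by (intro T.rep_eqI) auto
      then show "t = s" using rep_T ts by simp
    qed
    have \<sigma>_bij: "\<sigma> ` T = T" using endo_inj_surj[OF T(1) _ \<sigma>_inj] \<sigma>T by blast
    have 1: "inv t \<otimes> (h \<otimes> a \<otimes> inv h) \<otimes> t \<in> A1 \<and> F t (h \<otimes> a \<otimes> inv h) = h \<otimes> F (\<sigma> t) a \<otimes> inv h" if t: "t \<in> T" for t
    proof -
      define x where "x = inv (\<sigma> t) \<otimes> (inv h \<otimes> t)"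
      have sG: "\<sigma> t \<in> carrier G" "t \<in> carrier G" "\<sigma> t \<in> H" using \<sigma>T[OF t] T t by auto
      have "inv\<^bsub>G\<lparr>carrier := H\<rparr>\<^esub> (\<sigma> t) \<otimes>\<^bsub>G\<lparr>carrier := H\<rparr>\<^esub> (inv h \<otimes> t) \<in> A \<inter> H"
        unfolding \<sigma>_def using hT[OF t] by (intro T.rep_coset) simp
      then have xA: "x \<in> A" using sG(3) by (simp add: x_def inv_H)
      then have xG: "x \<in> carrier G" by simp
      have t_eq: "t = h \<otimes> \<sigma> t \<otimes> x" using sG hG by (simp add: x_def group_simps)
      let ?a = "inv (\<sigma> t) \<otimes> a \<otimes> \<sigma> t"
      have a': "?a \<in> A1" "?a \<in> A" "r ?a \<in> D" using a \<sigma>T[OF t] A1A rD by (auto simp: A2_def)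
      have "inv t \<otimes> (h \<otimes> a \<otimes> inv h) \<otimes> t = inv x \<otimes> ?a \<otimes> x"
        by (subst (1 2) t_eq) (use sG(1) hG xG aA in \<open>simp add: group_simps\<close>)
      also have "\<dots> = inv x \<otimes> (x \<otimes> ?a)" using comm[OF a'(2) xA] a'(2) xG by (simp add: m_assoc)
      also have "\<dots> = ?a" using xG a'(2) by (simp add: inv_cancel_left)
      finally have eq: "inv t \<otimes> (h \<otimes> a \<otimes> inv h) \<otimes> t = ?a" .
      have rG: "r ?a \<in> carrier G" "r ?a \<in> A" using a'(3) D by auto
      have "F t (h \<otimes> a \<otimes> inv h) = t \<otimes> r ?a \<otimes> inv t" by (simp only: F_def eq)
      also have "\<dots> = h \<otimes> \<sigma> t \<otimes> (x \<otimes> r ?a) \<otimes> inv x \<otimes> inv (\<sigma> t) \<otimes> inv h"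
        by (subst (1 2) t_eq) (use sG(1) hG xG rG(1) in \<open>simp add: group_simps del: inv_cancel_left\<close>)
      also have "\<dots> = h \<otimes> F (\<sigma> t) a \<otimes> inv h"
        unfolding comm[OF xA rG(2)] using sG(1) hG xG rG(1) by (simp add: F_def group_simps)
      finally show ?thesis using eq a'(1) by simp
    qed
    have FH: "h \<otimes> F t a \<otimes> inv h \<in> D" if "t \<in> T" for t using HD[OF h FD[OF that a]] .
    have "av (h \<otimes> a \<otimes> inv h) = finprod (G\<lparr>carrier := D\<rparr>) (\<lambda>t. h \<otimes> F (\<sigma> t) a \<otimes> inv h) T"
      unfolding av_def using 1 FH \<sigma>T by (intro DG.finprod_cong') auto
    also have "\<dots> = finprod (G\<lparr>carrier := D\<rparr>) (\<lambda>t. h \<otimes> F t a \<otimes> inv h) (\<sigma> ` T)"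
      using FH \<sigma>T by (intro DG.finprod_reindex[symmetric] \<sigma>_inj) auto
    also have "\<dots> = h \<otimes> av a \<otimes> inv h"
      unfolding \<sigma>_bij av_def by (rule finprod_conj[OF Dc D(1) hG HD[OF h] T(1) FD[OF _ a]])
    finally show ?thesis using 1 conjA(2)[OF hG aA(1)] by (auto simp: A2_def)
  qed
  have A2_pow: "\<exists>n>0. a [^] (n::nat) \<in> A2" if a: "a \<in> A" for a
  proof -
    have aG: "a \<in> carrier G" using a by simp
    have "\<exists>n. n > 0 \<and> (inv t \<otimes> a \<otimes> t) [^] (n::nat) \<in> A1" if t: "t \<in> T" for t
      using B1(3)[OF conjA(1)[OF TG[OF t] a]] unfolding A1_def by blast
    then obtain n :: "'a \<Rightarrow> nat" where n: "\<And>t. t \<in> T \<Longrightarrow> n t > 0"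
      "\<And>t. t \<in> T \<Longrightarrow> (inv t \<otimes> a \<otimes> t) [^] n t \<in> A1" by metis
    \<comment> \<open>The exponents that serve the single representatives are multiplied, so that
      one power of \<open>a\<close> serves them all.\<close>
    define k where "k = prod n T"
    have conj_pow: "inv t \<otimes> a [^] (m::nat) \<otimes> t = (inv t \<otimes> a \<otimes> t) [^] m" if t: "t \<in> carrier G" for t m
      using t aG by (induction m) (simp_all add: conj_mult)
    have "inv t \<otimes> a [^] k \<otimes> t \<in> A1" if t: "t \<in> T" for t
    proof -
      have "k = n t * prod n (T - {t})" using t T by (simp add: k_def prod.remove)
      then have "(inv t \<otimes> a \<otimes> t) [^] k = ((inv t \<otimes> a \<otimes> t) [^] n t) [^] prod n (T - {t})"
        using TG[OF t] aG by (simp add: nat_pow_pow)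
      then show ?thesis using A1p[OF n(2)[OF t]] conj_pow[OF TG[OF t]] by simp
    qed
    moreover have "a [^] k \<in> A" using AG.nat_pow_closed[of a k] a by (simp add: nat_pow_consistent[symmetric])
    moreover have "k > 0" using n T by (simp add: k_def prod_pos)
    ultimately show ?thesis by (auto simp: A2_def)
  qed
  define B where "B = {a \<in> A2. av a = \<one>}"
  have A2A: "A2 \<subseteq> A" by (auto simp: A2_def)
  have B_sub: "subgroup B G"
  proof (rule subgroupI)
    show "B \<subseteq> carrier G" using A2A by (auto simp: B_def)
    show "B \<noteq> {}" using A2_D[OF D.one_closed] by (auto simp: B_def)
    show "x \<otimes> y \<in> B" if "x \<in> B" "y \<in> B" for x y using that A2m by (auto simp: B_def)
    show "inv x \<in> B" if x: "x \<in> B" for x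
    proof -
      have x2: "x \<in> A2" "inv x \<in> A2" "av x = \<one>" "x \<in> carrier G" using x A2i A2A by (auto simp: B_def)
      have "av (x \<otimes> inv x) = av x \<otimes> av (inv x)" using A2m x2 by blast
      moreover have "av (x \<otimes> inv x) = \<one>" using A2_D[OF D.one_closed] x2 by simp
      moreover have "av (inv x) \<in> carrier G" using avD[OF x2(2)] by simp
      ultimately show ?thesis using x2 by (simp add: B_def)
    qed
  qed
  show thesis
  proof (rule that[OF B_sub])
    show BA: "B \<subseteq> A" using A2A by (auto simp: B_def)
    show "h \<otimes> b \<otimes> inv h \<in> B" if "h \<in> H" "b \<in> B" for h b
      using A2_conj[OF that(1)] that by (auto simp: B_def)
    show "B \<inter> D = {\<one>}"
    proof
      show "{\<one>} \<subseteq> B \<inter> D" using subgroup.one_closed[OF B_sub] by simp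
      have "card T > 0" using T T_ne by (simp add: card_gt_0_iff)
      then show "B \<inter> D \<subseteq> {\<one>}"
        using A2_D A(4) BA unfolding torsion_free_def by (auto simp: B_def)
    qed
    let ?BD = "{b \<otimes> d | b d. b \<in> B \<and> d \<in> D}"
    have BDA: "?BD \<subseteq> A" using BA D by auto
    have "subgroup ?BD G"
    proof (rule subgroupI)
      show "?BD \<subseteq> carrier G" using BDA A.subset by (rule subset_trans)
      show "?BD \<noteq> {}" using subgroup.one_closed[OF B_sub] D.one_closed by blast
      fix x assume "x \<in> ?BD"
      then obtain b d where x: "b \<in> B" "d \<in> D" "x = b \<otimes> d" by auto
      have "inv b \<in> A" "inv d \<in> A" using x BA D A.m_inv_closed by auto
      then have "inv x = inv b \<otimes> inv d"
        using x comm subgroup.mem_carrier[OF B_sub] by (simp add: inv_mult_group)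
      then show "inv x \<in> ?BD" using x subgroup.m_inv_closed[OF B_sub] by blast
      fix y assume "y \<in> ?BD"
      then obtain b' d' where y: "b' \<in> B" "d' \<in> D" "y = b' \<otimes> d'" by auto
      have "d \<otimes> b' = b' \<otimes> d" using x y BA D by (intro comm) auto
      then have "b \<otimes> (d \<otimes> b') \<otimes> d' = b \<otimes> (b' \<otimes> d) \<otimes> d'" by simp
      then have "x \<otimes> y = (b \<otimes> b') \<otimes> (d \<otimes> d')"
        using x y subgroup.mem_carrier[OF B_sub] by (simp add: m_assoc)
      then show "x \<otimes> y \<in> ?BD" using x y subgroup.m_closed[OF B_sub] by blast
    qed
    moreover have "\<exists>n>0. a [^] (n::nat) \<in> ?BD" if a: "a \<in> A" for a
    proof -
      obtain n :: nat where n: "n > 0" "a [^] n \<in> A2" using A2_pow[OF a] by auto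
      \<comment> \<open>Since \<open>av\<close> raises the element \<open>av ?c\<close> of
        \<open>D\<close> to the power \<open>?m\<close>, multiplying \<open>?c [^] ?m\<close> by the
        inverse of \<open>av ?c\<close> gives an element of the kernel \<open>B\<close>. Hence a
        positive power of \<open>a\<close> is a product of elements of \<open>B\<close> and
        \<open>D\<close>.\<close>
      let ?c = "a [^] n" and ?m = "card T"
      have pow: "?c [^] (k::nat) \<in> A2 \<and> av (?c [^] k) = av ?c [^] k" for k
        using n A2m A2_D[OF D.one_closed] by (induction k) auto
      have cD: "av ?c \<in> D" "av ?c \<in> carrier G" using avD[OF n(2)] by auto
      have iD: "inv (av ?c) \<in> D" using cD by blast
      have "av (?c [^] ?m \<otimes> inv (av ?c)) = av ?c [^] ?m \<otimes> inv (av ?c) [^] ?m"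
        using A2m[of "?c [^] ?m" "inv (av ?c)"] pow[of ?m] A2_D[OF iD] by simp
      also have "\<dots> = \<one>" using cD by (simp add: nat_pow_inv)
      finally have "?c [^] ?m \<otimes> inv (av ?c) \<in> B"
        using A2m[of "?c [^] ?m" "inv (av ?c)"] pow[of ?m] A2_D[OF iD] by (simp add: B_def)
      moreover have "a [^] (n * ?m) = (?c [^] ?m \<otimes> inv (av ?c)) \<otimes> av ?c"
        using a cD by (simp add: nat_pow_pow m_assoc)
      ultimately have "a [^] (n * ?m) \<in> ?BD" using cD(1) by blast
      moreover have "n * ?m > 0" using n T T_ne by (simp add: card_gt_0_iff)
      ultimately show ?thesis by blast
    qed
    ultimately have "cotorsion (G\<lparr>carrier := A\<rparr>) ?BD"
      using BDA subgroup_incl[OF _ A.subgroup_axioms]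
      by (simp add: cotorsion_def nat_pow_consistent[symmetric])
    then have "finite_index (G\<lparr>carrier := A\<rparr>) ?BD" using A(5) by (simp add: cotorsion_finite_def)
    then show "finite_index G ?BD" by (rule finite_index_trans[OF A(2)])
  qed
qed

section \<open>From retractions modulo \<open>N\<close> to retractions\<close>

text \<open>\<open>rel\<close> is the graph of the retraction. Two partners of the same
  \<open>k\<close> differ by an element of \<open>H \<inter> N\<close> whose image under
  \<open>\<phi>\<close> lies in \<open>B \<inter> D\<close>, and they agree because
  \<open>\<phi>\<close> is injective on \<open>N\<close>. Partners multiply because \<open>B\<close>
  is invariant under the image of \<open>H\<close>. An element of \<open>K\<close> may have no
  partner, but this failure is controlled by a coset of the finite index subgroup
  \<open>?BD\<close>.\<close>

lemma (in group) retract_from_retraction_modulo: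
  assumes N: "N \<lhd> G" and "group W" and \<phi>: "\<phi> \<in> hom G W" "inj_on \<phi> N"
    and A: "A \<lhd> W" "finite_index W A" "comm_group (W\<lparr>carrier := A\<rparr>)"
      "torsion_free W A" "cotorsion_finite (W\<lparr>carrier := A\<rparr>)"
    and "group F" and \<pi>: "\<pi> \<in> hom G F" "\<And>g. g \<in> carrier G \<Longrightarrow> \<pi> g = \<one>\<^bsub>F\<^esub> \<longleftrightarrow> g \<in> N"
    and H: "subgroup H G" and K: "finite_index G K" "H \<subseteq> K"
    and \<rho>: "\<rho> \<in> hom (G\<lparr>carrier := K\<rparr>) (F\<lparr>carrier := \<pi> ` H\<rparr>)" "\<And>h. h \<in> H \<Longrightarrow> \<rho> h = \<pi> h"
  shows "virtual_retract G H"
proof -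
  interpret N: normal N G by fact
  interpret W: group W by fact
  interpret F: group F by fact
  interpret \<phi>: group_hom G W \<phi> using \<phi> by unfold_locales
  interpret \<pi>: group_hom G F \<pi> using \<pi> by unfold_locales
  interpret H: subgroup H G by fact
  interpret A: normal A W by (rule A(1))
  interpret WA: comm_group "W\<lparr>carrier := A\<rparr>" by (rule A(3))
  interpret K: subgroup K G using K(1) by (rule finite_index_subgroup)
  define D where "D = \<phi> ` (H \<inter> N) \<inter> A"
  have HN: "subgroup (H \<inter> N) G" using H N.subgroup_axioms by (rule subgroups_Inter_pair)
  have D: "subgroup D W"
    unfolding D_def by (intro W.subgroups_Inter_pair \<phi>.subgroup_img_is_subgroup HN A.subgroup_axioms)
  have \<phi>H: "subgroup (\<phi> ` H) W" using H by (rule \<phi>.subgroup_img_is_subgroup)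
  have HD: "w \<otimes>\<^bsub>W\<^esub> d \<otimes>\<^bsub>W\<^esub> inv\<^bsub>W\<^esub> w \<in> D" if "w \<in> \<phi> ` H" "d \<in> D" for w d
  proof -
    obtain h n where hn: "h \<in> H" "w = \<phi> h" "n \<in> H" "n \<in> N" "d = \<phi> n" "d \<in> A"
      using \<open>w \<in> \<phi> ` H\<close> \<open>d \<in> D\<close> by (auto simp: D_def)
    have "h \<otimes> n \<otimes> inv h \<in> H \<inter> N" using hn N.inv_op_closed2 by auto
    moreover have "w \<otimes>\<^bsub>W\<^esub> d \<otimes>\<^bsub>W\<^esub> inv\<^bsub>W\<^esub> w = \<phi> (h \<otimes> n \<otimes> inv h)" using hn by simp
    moreover have "w \<otimes>\<^bsub>W\<^esub> d \<otimes>\<^bsub>W\<^esub> inv\<^bsub>W\<^esub> w \<in> A" using hn by (intro A.inv_op_closed2) auto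
    ultimately show ?thesis by (auto simp: D_def)
  qed
  have DA: "D \<subseteq> A" by (simp add: D_def)
  obtain B where B: "subgroup B W" "B \<subseteq> A" "\<And>w b. w \<in> \<phi> ` H \<Longrightarrow> b \<in> B \<Longrightarrow> w \<otimes>\<^bsub>W\<^esub> b \<otimes>\<^bsub>W\<^esub> inv\<^bsub>W\<^esub> w \<in> B"
    "B \<inter> D = {\<one>\<^bsub>W\<^esub>}" "finite_index W {b \<otimes>\<^bsub>W\<^esub> d | b d. b \<in> B \<and> d \<in> D}"
    using W.invariant_complement[OF A D DA \<phi>H HD] by blast
  interpret B: subgroup B W by (rule B(1))
  have B_conj: "\<phi> h \<otimes>\<^bsub>W\<^esub> b \<otimes>\<^bsub>W\<^esub> inv\<^bsub>W\<^esub> \<phi> h \<in> B" "inv\<^bsub>W\<^esub> \<phi> h \<otimes>\<^bsub>W\<^esub> b \<otimes>\<^bsub>W\<^esub> \<phi> h \<in> B" if "h \<in> H" "b \<in> B" for h b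
    using B(3)[OF imageI[OF that(1)] that(2)] B(3)[OF imageI[OF H.m_inv_closed[OF that(1)]] that(2)] that
    by simp_all
  have KG: "k \<in> carrier G" if "k \<in> K" for k using that by simp
  have \<rho>m: "\<rho> (k \<otimes> l) = \<rho> k \<otimes>\<^bsub>F\<^esub> \<rho> l" if "k \<in> K" "l \<in> K" for k l
    using \<rho>(1) that by (auto simp: hom_def)
  have \<rho>H: "\<rho> k \<in> \<pi> ` H" if "k \<in> K" for k using \<rho>(1) that by (auto simp: hom_def)
  have \<rho>F: "\<rho> k \<in> carrier F" if "k \<in> K" for k using \<rho>H[OF that] by auto
  have \<rho>i: "\<rho> (inv k) = inv\<^bsub>F\<^esub> \<rho> k" if k: "k \<in> K" for k
  proof (rule F.inv_equality[symmetric])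
    have "\<rho> (inv k) \<otimes>\<^bsub>F\<^esub> \<rho> k = \<rho> \<one>" using \<rho>m[of "inv k" k] k by simp
    also have "\<rho> \<one> = \<one>\<^bsub>F\<^esub>" using \<rho>(2)[OF H.one_closed] by simp
    finally show "\<rho> (inv k) \<otimes>\<^bsub>F\<^esub> \<rho> k = \<one>\<^bsub>F\<^esub>" .
  qed (use k \<rho>F in auto)
  define rel where "rel k h \<longleftrightarrow> h \<in> H \<and> \<rho> k = \<pi> h \<and> inv\<^bsub>W\<^esub> \<phi> h \<otimes>\<^bsub>W\<^esub> \<phi> k \<in> B" for k h
  have rel_unique: "h = h'" if k: "k \<in> K" and r: "rel k h" "rel k h'" for k h h'
  proof -
    have h: "h \<in> H" "h' \<in> H" "\<pi> h = \<pi> h'" using r by (auto simp: rel_def)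
    let ?n = "inv h \<otimes> h'"
    have "\<pi> ?n = \<one>\<^bsub>F\<^esub>" using h by simp
    then have n: "?n \<in> H \<inter> N" using \<pi>(2)[of ?n] h by simp
    have "(inv\<^bsub>W\<^esub> \<phi> h \<otimes>\<^bsub>W\<^esub> \<phi> k) \<otimes>\<^bsub>W\<^esub> inv\<^bsub>W\<^esub> (inv\<^bsub>W\<^esub> \<phi> h' \<otimes>\<^bsub>W\<^esub> \<phi> k) \<in> B"
      using r by (auto simp: rel_def)
    then have "\<phi> ?n \<in> B" using h k by (simp add: W.group_simps)
    then have "\<phi> ?n \<in> B \<inter> D" using n B(2) by (auto simp: D_def)
    then have "\<phi> ?n = \<phi> \<one>" using B(4) by simp
    then have "?n = \<one>" using \<phi>(2) n N.one_closed by (meson IntD2 inj_onD)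
    then have "h \<otimes> ?n = h" using h by simp
    then show ?thesis using h by (simp add: inv_cancel_left)
  qed
  have rel_mult: "rel (k \<otimes> l) (h \<otimes> h')" if k: "k \<in> K" "l \<in> K" and r: "rel k h" "rel l h'" for k l h h'
  proof -
    have h: "h \<in> H" "h' \<in> H" "\<rho> k = \<pi> h" "\<rho> l = \<pi> h'" using r by (auto simp: rel_def)
    have "(inv\<^bsub>W\<^esub> \<phi> h' \<otimes>\<^bsub>W\<^esub> (inv\<^bsub>W\<^esub> \<phi> h \<otimes>\<^bsub>W\<^esub> \<phi> k) \<otimes>\<^bsub>W\<^esub> \<phi> h') \<otimes>\<^bsub>W\<^esub> (inv\<^bsub>W\<^esub> \<phi> h' \<otimes>\<^bsub>W\<^esub> \<phi> l) \<in> B"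
      using r B_conj(2)[OF h(2)] by (auto simp: rel_def)
    then show ?thesis using h k \<rho>m by (simp add: rel_def W.group_simps)
  qed
  have rel_inv: "rel (inv k) (inv h)" if k: "k \<in> K" and r: "rel k h" for k h
  proof -
    have h: "h \<in> H" "\<rho> k = \<pi> h" using r by (auto simp: rel_def)
    have "\<phi> h \<otimes>\<^bsub>W\<^esub> inv\<^bsub>W\<^esub> (inv\<^bsub>W\<^esub> \<phi> h \<otimes>\<^bsub>W\<^esub> \<phi> k) \<otimes>\<^bsub>W\<^esub> inv\<^bsub>W\<^esub> \<phi> h \<in> B"
      using r B_conj(1)[OF h(1)] by (auto simp: rel_def)
    then show ?thesis using h k \<rho>i by (simp add: rel_def W.group_simps)
  qed
  have rel_self: "rel h h" if "h \<in> H" for h using that \<rho>(2) by (simp add: rel_def)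
  define L where "L = {k \<in> K. \<exists>h. rel k h}"
  have L_sub: "subgroup L G"
  proof (rule subgroupI)
    show "L \<noteq> {}" using rel_self[OF H.one_closed] K.one_closed unfolding L_def by blast
    show "inv k \<in> L" if "k \<in> L" for k using that rel_inv by (auto simp: L_def)
    show "k \<otimes> l \<in> L" if kl: "k \<in> L" "l \<in> L" for k l
    proof -
      obtain h h' where "k \<in> K" "l \<in> K" "rel k h" "rel l h'" using kl by (auto simp: L_def)
      then show ?thesis using rel_mult K.m_closed unfolding L_def by blast
    qed
  qed (use KG in \<open>auto simp: L_def\<close>)
  have L_subK: "subgroup L (G\<lparr>carrier := K\<rparr>)"
    using L_sub K.subgroup_axioms by (rule subgroup_incl) (auto simp: L_def)
  interpret KK: group "G\<lparr>carrier := K\<rparr>" by (rule subgroup_imp_group) (rule K.subgroup_axioms)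
  have "\<exists>h. h \<in> H \<and> \<rho> k = \<pi> h" if "k \<in> K" for k using \<rho>H[OF that] by auto
  then obtain \<eta> where \<eta>: "\<And>k. k \<in> K \<Longrightarrow> \<eta> k \<in> H" "\<And>k. k \<in> K \<Longrightarrow> \<rho> k = \<pi> (\<eta> k)" by metis
  let ?BD = "{b \<otimes>\<^bsub>W\<^esub> d | b d. b \<in> B \<and> d \<in> D}"
  \<comment> \<open>The discrepancy, seen in \<open>W\<close>, between \<open>k\<close> and an
    arbitrary lift \<open>\<eta> k\<close> of \<open>\<rho> k\<close> to \<open>H\<close>. A factor
    from \<open>D\<close> can be absorbed by changing the lift within \<open>H \<inter> N\<close>,
    so it is compared modulo \<open>?BD\<close>.\<close>
  define u where "u k = inv\<^bsub>W\<^esub> \<phi> (\<eta> k) \<otimes>\<^bsub>W\<^esub> \<phi> k" for k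
  have u: "u k \<in> carrier W" if "k \<in> K" for k using that \<eta>(1)[OF that] by (simp add: u_def)
  have "finite_index (G\<lparr>carrier := K\<rparr>) L"
  proof (rule KK.finite_indexI[OF L_subK, where f = "\<lambda>k. ?BD #>\<^bsub>W\<^esub> u k"])
    show "finite ((\<lambda>k. ?BD #>\<^bsub>W\<^esub> u k) ` carrier (G\<lparr>carrier := K\<rparr>))"
      by (rule finite_subset[OF _ W.finite_index_cosets[OF B(5)]]) (use u in auto)
    fix k l assume "k \<in> carrier (G\<lparr>carrier := K\<rparr>)" "l \<in> carrier (G\<lparr>carrier := K\<rparr>)"
      and eq: "?BD #>\<^bsub>W\<^esub> u k = ?BD #>\<^bsub>W\<^esub> u l"
    then have kl: "k \<in> K" "l \<in> K" by auto
    have "u k \<otimes>\<^bsub>W\<^esub> inv\<^bsub>W\<^esub> u l \<in> ?BD"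
      using W.rcos_eqD[OF finite_index_subgroup[OF B(5)] u[OF kl(1)] u[OF kl(2)] eq] .
    then obtain b d where bd: "b \<in> B" "d \<in> D" "u k \<otimes>\<^bsub>W\<^esub> inv\<^bsub>W\<^esub> u l = b \<otimes>\<^bsub>W\<^esub> d" by auto
    then obtain n where n: "n \<in> H" "n \<in> N" "d = \<phi> n" by (auto simp: D_def)
    \<comment> \<open>The obvious lift of \<open>\<rho> (k \<otimes> inv l)\<close>, corrected by
      the element \<open>n\<close> of \<open>H \<inter> N\<close> that represents the factor
      \<open>d\<close>.\<close>
    let ?h = "\<eta> k \<otimes> n \<otimes> inv (\<eta> l)"
    have h: "\<eta> k \<in> H" "\<eta> l \<in> H" "?h \<in> H" using \<eta>(1) kl n by auto
    have "\<pi> n = \<one>\<^bsub>F\<^esub>" using \<pi>(2)[of n] n by simp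
    then have "\<pi> (\<eta> k) \<otimes>\<^bsub>F\<^esub> inv\<^bsub>F\<^esub> \<pi> (\<eta> l) = \<pi> ?h" using h(1,2) n by simp
    moreover have "\<rho> (k \<otimes> inv l) = \<rho> k \<otimes>\<^bsub>F\<^esub> inv\<^bsub>F\<^esub> \<rho> l" using kl by (simp add: \<rho>m \<rho>i)
    ultimately have "\<rho> (k \<otimes> inv l) = \<pi> ?h" using \<eta>(2)[OF kl(1)] \<eta>(2)[OF kl(2)] by simp
    moreover have "inv\<^bsub>W\<^esub> \<phi> ?h \<otimes>\<^bsub>W\<^esub> \<phi> (k \<otimes> inv l) \<in> B"
    proof -
      have "b \<otimes>\<^bsub>W\<^esub> d = d \<otimes>\<^bsub>W\<^esub> b" using WA.m_comm[of b d] bd B(2) DA by auto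
      then have b: "inv\<^bsub>W\<^esub> \<phi> n \<otimes>\<^bsub>W\<^esub> (u k \<otimes>\<^bsub>W\<^esub> inv\<^bsub>W\<^esub> u l) = b"
        using bd n by (simp add: W.inv_cancel_left)
      have "inv\<^bsub>W\<^esub> \<phi> ?h \<otimes>\<^bsub>W\<^esub> \<phi> (k \<otimes> inv l)
        = \<phi> (\<eta> l) \<otimes>\<^bsub>W\<^esub> (inv\<^bsub>W\<^esub> \<phi> n \<otimes>\<^bsub>W\<^esub> (u k \<otimes>\<^bsub>W\<^esub> inv\<^bsub>W\<^esub> u l)) \<otimes>\<^bsub>W\<^esub> inv\<^bsub>W\<^esub> \<phi> (\<eta> l)"
        using h(1,2) n kl by (simp add: u_def W.group_simps)
      then show ?thesis unfolding b using B_conj(1)[OF h(2) bd(1)] by simp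
    qed
    ultimately have "rel (k \<otimes> inv l) ?h" using h(3) by (simp add: rel_def)
    then show "k \<otimes>\<^bsub>G\<lparr>carrier := K\<rparr>\<^esub> inv\<^bsub>G\<lparr>carrier := K\<rparr>\<^esub> l \<in> L"
      using kl by (auto simp: L_def m_inv_consistent[OF K.subgroup_axioms])
  qed
  then have "finite_index G L" by (rule finite_index_trans[OF K(1)])
  define \<sigma> where "\<sigma> k = (THE h. rel k h)" for k
  have \<sigma>: "\<sigma> k = h" if "k \<in> K" "rel k h" for k h
    unfolding \<sigma>_def using that rel_unique by blast
  show ?thesis
    unfolding virtual_retract_def
  proof (intro conjI exI[of _ L] exI[of _ \<sigma>] ballI H)
    show "finite_index G L" by fact
    show "H \<subseteq> L" using rel_self K(2) by (auto simp: L_def)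
    show "\<sigma> h = h" if "h \<in> H" for h using \<sigma> rel_self[OF that] K(2) that by blast
    show "\<sigma> \<in> hom (G\<lparr>carrier := L\<rparr>) (G\<lparr>carrier := H\<rparr>)"
    proof (rule homI)
      show "\<sigma> k \<in> carrier (G\<lparr>carrier := H\<rparr>)" if "k \<in> carrier (G\<lparr>carrier := L\<rparr>)" for k
        using that \<sigma> by (auto simp: L_def rel_def)
      fix k l assume "k \<in> carrier (G\<lparr>carrier := L\<rparr>)" "l \<in> carrier (G\<lparr>carrier := L\<rparr>)"
      then obtain h h' where "k \<in> K" "l \<in> K" "rel k h" "rel l h'" by (auto simp: L_def)
      then show "\<sigma> (k \<otimes>\<^bsub>G\<lparr>carrier := L\<rparr>\<^esub> l) = \<sigma> k \<otimes>\<^bsub>G\<lparr>carrier := H\<rparr>\<^esub> \<sigma> l"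
        using \<sigma> rel_mult K.m_closed by simp
    qed
  qed
qed

section \<open>Assembling the result for normal amalgams\<close>

lemma property_LR_iso:
  assumes "group A" "group B" and h: "h \<in> iso A B" and LR: "property_LR A"
  shows "property_LR B"
  unfolding property_LR_def
proof (intro allI impI)
  fix H assume H: "fg_subgroup B H"
  interpret A: group A by fact
  interpret B: group B by fact
  define g where "g = inv_into (carrier A) h"
  have g: "g \<in> iso B A" unfolding g_def using h by (rule A.iso_set_sym)
  interpret h: group_hom A B h using h by unfold_locales (auto simp: iso_def)
  interpret g: group_hom B A g using g by unfold_locales (auto simp: iso_def)
  have hg: "h (g b) = b" if "b \<in> carrier B" for b
    using h that by (simp add: g_def iso_def bij_betw_def f_inv_into_f)
  obtain S where S: "finite S" "S \<subseteq> H" "generate B S = H" and H_sub: "subgroup H B"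
    using H by (auto simp: fg_subgroup_def)
  have HB: "H \<subseteq> carrier B" using H_sub by (rule subgroup.subset)
  have "fg_subgroup A (g ` H)"
    unfolding fg_subgroup_def
    using g.subgroup_img_is_subgroup[OF H_sub] g.generate_img[of S] S HB
    by (intro conjI exI[of _ "g ` S"]) auto
  then obtain K \<rho> where K: "finite_index A K" "g ` H \<subseteq> K"
    and \<rho>: "\<rho> \<in> hom (A\<lparr>carrier := K\<rparr>) (A\<lparr>carrier := g ` H\<rparr>)" "\<forall>x\<in>g ` H. \<rho> x = x"
    using LR by (auto simp: property_LR_def virtual_retract_def)
  show "virtual_retract B H"
    unfolding virtual_retract_def
  proof (intro conjI exI[of _ "{b \<in> carrier B. g b \<in> K}"] exI[of _ "\<lambda>b. h (\<rho> (g b))"] ballI H_sub)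
    show "finite_index B {b \<in> carrier B. g b \<in> K}" using K(1) by (rule g.finite_index_vimage)
    show "H \<subseteq> {b \<in> carrier B. g b \<in> K}" using HB K(2) by auto
    show "h (\<rho> (g b)) = b" if "b \<in> H" for b using \<rho>(2) hg that HB by auto
    have \<rho>K: "\<rho> x \<in> g ` H" if "x \<in> K" for x using \<rho>(1) that by (auto simp: hom_def)
    show "(\<lambda>b. h (\<rho> (g b))) \<in> hom (B\<lparr>carrier := {b \<in> carrier B. g b \<in> K}\<rparr>) (B\<lparr>carrier := H\<rparr>)"
    proof (rule homI)
      show "h (\<rho> (g b)) \<in> carrier (B\<lparr>carrier := H\<rparr>)"
        if "b \<in> carrier (B\<lparr>carrier := {b \<in> carrier B. g b \<in> K}\<rparr>)" for b
        using \<rho>K[of "g b"] that hg HB by auto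
      fix b c assume bc: "b \<in> carrier (B\<lparr>carrier := {b \<in> carrier B. g b \<in> K}\<rparr>)"
        "c \<in> carrier (B\<lparr>carrier := {b \<in> carrier B. g b \<in> K}\<rparr>)"
      then have "\<rho> (g b) \<in> carrier A" "\<rho> (g c) \<in> carrier A" using \<rho>K HB by fastforce+
      moreover have "\<rho> (g b \<otimes>\<^bsub>A\<^esub> g c) = \<rho> (g b) \<otimes>\<^bsub>A\<^esub> \<rho> (g c)"
        using \<rho>(1) bc by (auto simp: hom_def)
      ultimately show "h (\<rho> (g (b \<otimes>\<^bsub>B\<lparr>carrier := {b \<in> carrier B. g b \<in> K}\<rparr>\<^esub> c))) =
          h (\<rho> (g b)) \<otimes>\<^bsub>B\<lparr>carrier := H\<rparr>\<^esub> h (\<rho> (g c))"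
        using bc by simp
    qed
  qed
qed

text \<open>Schreier generators make the abelian subgroup \<open>A\<close> of finite index finitely
  generated, hence \<open>cotorsion_finite\<close>; a complement of its torsion subgroup is then
  torsion-free of finite index.\<close>

lemma torsion_free_abelian_finite_index:
  assumes "group M" and "virtually_abelian M" and S: "finite S" "S \<subseteq> carrier M" "generate M S = carrier M"
  obtains B where "finite_index M B" "comm_group (M\<lparr>carrier := B\<rparr>)" "torsion_free M B"
    "cotorsion_finite (M\<lparr>carrier := B\<rparr>)"
proof -
  interpret M: group M by fact
  obtain A where A: "finite_index M A" "comm_group (M\<lparr>carrier := A\<rparr>)"
    using assms(2) by (auto simp: virtually_abelian_def)
  interpret A: comm_group "M\<lparr>carrier := A\<rparr>" by (rule A(2))
  have A_sub: "subgroup A M" using A(1) by (rule finite_index_subgroup)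
  obtain S' where S': "finite S'" "S' \<subseteq> A" "generate M S' = A"
    by (rule M.schreier_fg[OF S A(1)])
  have "generate (M\<lparr>carrier := A\<rparr>) S' = A" using M.generate_consistent[OF S'(2) A_sub] S'(3) by simp
  then have cf: "cotorsion_finite (M\<lparr>carrier := A\<rparr>)"
    using A.fg_cotorsion_finite[OF S'(1)] S'(2) by simp
  then obtain B where B: "finite_index (M\<lparr>carrier := A\<rparr>) B" "torsion_free (M\<lparr>carrier := A\<rparr>) B"
    by (rule A.torsion_free_finite_index)
  have BA: "B \<subseteq> A" using subgroup.subset[OF finite_index_subgroup[OF B(1)]] by simp
  have BM: "finite_index M B" using A(1) B(1) by (rule M.finite_index_trans)
  show thesis
  proof (rule that[OF BM])
    have "x \<otimes>\<^bsub>M\<^esub> y = y \<otimes>\<^bsub>M\<^esub> x" if "x \<in> B" "y \<in> B" for x y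
      using A.m_comm[of x y] that BA by auto
    then show "comm_group (M\<lparr>carrier := B\<rparr>)"
      by (intro group.group_comm_groupI M.subgroup_imp_group finite_index_subgroup[OF BM]) auto
    show "torsion_free M B" using B(2) by (simp add: torsion_free_def M.nat_pow_consistent[symmetric])
    show "cotorsion_finite (M\<lparr>carrier := B\<rparr>)" using A.cotorsion_finite_restrict[OF cf B(1)] by simp
  qed
qed

proposition (in normal_amalgam) property_LR_normal_amalgam:
  assumes va: "virtually_abelian (G\<lparr>carrier := N\<rparr>)" and fin: "finite (to_Out G N ` carrier G)"
    and ext1: "\<And>n H. subgroup H (G Mod N) \<Longrightarrow> extends_to (wreath {..<n :: nat} ((G Mod N)\<lparr>carrier := H\<rparr>))"
    and ext2: "\<And>I :: (('a \<Rightarrow> 'a) set \<times> ('v \<Rightarrow> 'a)) set. extends_to (wreath I (G\<lparr>carrier := N\<rparr>))"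
  shows "property_LR G"
  unfolding property_LR_def
proof (intro allI impI)
  fix H assume H: "fg_subgroup G H"
  have H_sub: "subgroup H G" using H by (simp add: fg_subgroup_def)
  let ?F = "G Mod N" and ?\<pi> = "\<lambda>g. N #> g" and ?M = "G\<lparr>carrier := N\<rparr>"
  have gF: "group ?F" by (rule factorgroup_is_group)
  have \<pi>: "?\<pi> \<in> hom G ?F" by (rule r_coset_hom_Mod)
  have \<pi>N: "N #> n = \<one>\<^bsub>?F\<^esub>" if "n \<in> N" for n
    using rcos_const[OF is_group that] by (simp add: FactGroup_def)
  have \<pi>_ker: "N #> g = \<one>\<^bsub>?F\<^esub> \<longleftrightarrow> g \<in> N" if "g \<in> carrier G" for g
    using rcos_self[OF that subgroup_axioms] \<pi>N by (auto simp: FactGroup_def)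
  have "group_hom G ?F ?\<pi>" by (intro group_hom.intro group_hom_axioms.intro is_group gF \<pi>)
  then have "subgroup (?\<pi> ` H) ?F" using H_sub by (rule group_hom.subgroup_img_is_subgroup)
  note ext1' = ext1[OF this]
  obtain K \<rho> where K: "finite_index G K" "H \<subseteq> K"
    and \<rho>: "\<rho> \<in> hom (G\<lparr>carrier := K\<rparr>) (?F\<lparr>carrier := ?\<pi> ` H\<rparr>)" "\<And>h. h \<in> H \<Longrightarrow> \<rho> h = N #> h"
    by (rule retraction_modulo[OF gF \<pi> \<pi>N H ext1']) (assumption, rule that)
  obtain I :: "(('a \<Rightarrow> 'a) set \<times> ('v \<Rightarrow> 'a)) set" and \<phi>
    where I: "finite I" and \<phi>: "\<phi> \<in> hom G (wreath I ?M)" "inj_on \<phi> N"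
    using wreath_representation[OF fin ext2] by blast
  have gM: "group ?M" using subgroup_axioms by (rule subgroup_imp_group)
  obtain S where S: "finite S" "S \<subseteq> N" "generate G S = N" using N_fg by (auto simp: fg_subgroup_def)
  then have "generate ?M S = carrier ?M" using generate_consistent[OF S(2) subgroup_axioms] by simp
  then obtain B where B: "finite_index ?M B" "comm_group (?M\<lparr>carrier := B\<rparr>)" "torsion_free ?M B"
    "cotorsion_finite (?M\<lparr>carrier := B\<rparr>)"
    using torsion_free_abelian_finite_index[OF gM va S(1)] S(2) by auto
  obtain A where A: "A \<lhd> wreath I ?M" "finite_index (wreath I ?M) A"
    "comm_group (wreath I ?M\<lparr>carrier := A\<rparr>)" "torsion_free (wreath I ?M) A"
    "cotorsion_finite (wreath I ?M\<lparr>carrier := A\<rparr>)"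
    using wreath_torsion_free_base[OF gM I B] by blast
  show "virtual_retract G H"
    using retract_from_retraction_modulo[OF normal_axioms group_wreath[OF gM] \<phi> A gF \<pi> \<pi>_ker H_sub K \<rho>] by blast
qed

section \<open>The fundamental group as a normal amalgam\<close>

context fundamental_group_setup
begin

text \<open>Connectedness makes every vertex an end of some edge, and inverting that edge if
  necessary makes it the tail. Through condition (a) every vertex group then contains
  \<open>N\<close>.\<close>

lemma arc_from_vertex:
  assumes "arcs \<Gamma> \<noteq> {}" "v \<in> verts \<Gamma>"
  obtains e where "e \<in> arcs \<Gamma>" "tail \<Gamma> e = v"
proof -
  obtain e where e: "e \<in> arcs \<Gamma>" using assms by auto
  show thesis
  proof (cases "tail \<Gamma> e = v")
    case True
    then show ?thesis using e that by blast
  next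
    case False
    have "v \<rightarrow>\<^sup>*\<^bsub>with_proj (mk_symmetric \<Gamma>)\<^esub> tail \<Gamma> e"
      using connected assms(2) e by (auto simp: connected_def strongly_connected_def mk_symmetric_def)
    then obtain w where "v \<rightarrow>\<^bsub>with_proj (mk_symmetric \<Gamma>)\<^esub> w"
      by (rule pre_digraph.converse_reachable_cases) (use False in auto)
    then obtain d where "d \<in> arcs \<Gamma>" "tail \<Gamma> d = v \<or> head \<Gamma> d = v"
      by (auto simp: mk_symmetric_def arcs_ends_def arc_to_ends_def)
    then show ?thesis using that[of d] that[of "bar d"] by auto
  qed
qed

lemma \<iota>_group_hom: "v \<in> verts \<Gamma> \<Longrightarrow> group_hom (Gv v) FG (\<iota> v)"
  by (simp add: group_hom_def group_hom_axioms_def group_Gv group_FG \<iota>_hom)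

lemma \<iota>_iso:
  assumes v: "v \<in> verts \<Gamma>"
  shows "\<iota> v \<in> iso (Gv v) (FG\<lparr>carrier := \<iota> v ` carrier (Gv v)\<rparr>)"
  using \<iota>_hom[OF v] \<iota>_inj[OF v] by (auto simp: iso_def bij_betw_def hom_def)

lemma \<iota>_subgroup: "v \<in> verts \<Gamma> \<Longrightarrow> subgroup (\<iota> v ` carrier (Gv v)) FG"
  using group_hom.img_is_subgroup[OF \<iota>_group_hom] .

lemma \<iota>_property_LR:
  assumes "v \<in> verts \<Gamma>" "property_LR (Gv v)"
  shows "property_LR (FG\<lparr>carrier := \<iota> v ` carrier (Gv v)\<rparr>)"
  using property_LR_iso[OF group_Gv[OF assms(1)] _ \<iota>_iso[OF assms(1)] assms(2)]
    group.subgroup_imp_group[OF group_FG \<iota>_subgroup[OF assms(1)]] by blast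

text \<open>Without edges nothing places \<open>N\<close> inside the vertex groups, so this case is
  treated separately: connectedness leaves a single vertex, whose group is the whole fundamental
  group.\<close>

lemma property_LR_no_arcs:
  assumes no: "arcs \<Gamma> = {}" and LR: "\<And>v. v \<in> verts \<Gamma> \<Longrightarrow> property_LR (Gv v)"
  shows "property_LR FG"
proof -
  interpret FG: group FG by (rule group_FG)
  obtain v where v: "v \<in> verts \<Gamma>"
    using connected by (auto simp: connected_def strongly_connected_def mk_symmetric_def)
  have "u = v" if u: "u \<in> verts \<Gamma>" for u
  proof (rule ccontr)
    assume "u \<noteq> v"
    have "u \<rightarrow>\<^sup>*\<^bsub>with_proj (mk_symmetric \<Gamma>)\<^esub> v"
      using connected u v by (auto simp: connected_def strongly_connected_def mk_symmetric_def)
    then show False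
      by (rule pre_digraph.converse_reachable_cases)
        (use \<open>u \<noteq> v\<close> in \<open>auto simp: mk_symmetric_def arcs_ends_def arc_to_ends_def no\<close>)
  qed
  then have verts: "verts \<Gamma> = {v}" using v by blast
  have "P = {}" using P_arcs(1) no by auto
  then have "generate FG (\<iota> v ` carrier (Gv v)) = carrier FG" using FG_generate verts by simp
  moreover have "generate FG (\<iota> v ` carrier (Gv v)) \<subseteq> \<iota> v ` carrier (Gv v)"
    using \<iota>_subgroup[OF v] by (intro FG.generate_subgroup_incl) auto
  ultimately have "\<iota> v ` carrier (Gv v) = carrier FG"
    using \<iota>_closed[OF v] by auto
  then show ?thesis using \<iota>_property_LR[OF v LR[OF v]] by simp
qed

text \<open>The stable letters of the maximal tree are trivial, so the vertex groups together with
  the letters of the positive edges outside the tree still generate.\<close>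

lemma normal_amalgam_FG:
  assumes N: "N \<lhd> FG" "fg_subgroup FG N" and arcs: "arcs \<Gamma> \<noteq> {}"
    and a: "\<And>e. e \<in> arcs \<Gamma> \<Longrightarrow> \<iota> (tail \<Gamma> e) ` \<alpha> e ` carrier (Ge e) = N"
    and LR: "\<And>v. v \<in> verts \<Gamma> \<Longrightarrow> property_LR (Gv v)"
  shows "normal_amalgam N FG (verts \<Gamma>) (\<lambda>v. \<iota> v ` carrier (Gv v)) (P - arcs T) \<tau>"
proof (intro normal_amalgam.intro normal_amalgam_axioms.intro)
  interpret FG: group FG by (rule group_FG)
  show "verts \<Gamma> \<noteq> {}" using connected by (auto simp: connected_def strongly_connected_def mk_symmetric_def)
  show "N \<subseteq> \<iota> v ` carrier (Gv v)" if v: "v \<in> verts \<Gamma>" for v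
  proof -
    obtain e where e: "e \<in> arcs \<Gamma>" "tail \<Gamma> e = v" using arc_from_vertex[OF arcs v] by blast
    then show ?thesis using a[OF e(1)] \<alpha>_closed[OF e(1)] by blast
  qed
  let ?X = "\<Union>v\<in>verts \<Gamma>. \<iota> v ` carrier (Gv v)"
  have X: "?X \<union> \<tau> ` (P - arcs T) \<subseteq> carrier FG" using \<iota>_closed stable_emb_closed by auto
  have "?X \<union> \<tau> ` P \<subseteq> generate FG (?X \<union> \<tau> ` (P - arcs T))"
  proof
    fix x assume x: "x \<in> ?X \<union> \<tau> ` P"
    show "x \<in> generate FG (?X \<union> \<tau> ` (P - arcs T))"
    proof (cases "x \<in> ?X \<union> \<tau> ` (P - arcs T)")
      case True
      then show ?thesis by (rule generate.incl)
    next
      case False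
      then obtain e where "e \<in> P" "e \<in> arcs T" "x = \<tau> e" using x by blast
      then have "x = \<one>\<^bsub>FG\<^esub>" using stable_emb_tree by simp
      then show ?thesis by (simp add: generate.one)
    qed
  qed
  then have "generate FG (?X \<union> \<tau> ` P) \<subseteq> generate FG (?X \<union> \<tau> ` (P - arcs T))"
    by (rule FG.generate_subgroup_incl) (rule FG.generate_is_subgroup[OF X])
  then show "generate FG (?X \<union> \<tau> ` (P - arcs T)) = carrier FG"
    using FG_generate FG.generate_incl[OF X] by auto
qed (use N \<iota>_subgroup \<iota>_property_LR LR stable_emb_closed in auto)

text \<open>By (a) both embeddings of an edge group have image \<open>N\<close>, so the edge
  relations involve the homomorphisms on the vertex groups only through their common restriction
  \<open>\<theta>N\<close>. Outside the tree they become the condition on \<open>s\<close>. On a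
  tree edge the stable letter is trivial, so the two embeddings agree in the fundamental group and
  the relation holds with the value one.\<close>

lemma extends_to_FG:
  assumes N: "N \<lhd> FG" "fg_subgroup FG N" and arcs: "arcs \<Gamma> \<noteq> {}"
    and a: "\<And>e. e \<in> arcs \<Gamma> \<Longrightarrow> \<iota> (tail \<Gamma> e) ` \<alpha> e ` carrier (Ge e) = N"
    and LR: "\<And>v. v \<in> verts \<Gamma> \<Longrightarrow> property_LR (Gv v)" and "group W"
  shows "normal_amalgam.extends_to N FG (verts \<Gamma>) (\<lambda>v. \<iota> v ` carrier (Gv v)) (P - arcs T) \<tau> W"
proof -
  interpret A: normal_amalgam N FG "verts \<Gamma>" "\<lambda>v. \<iota> v ` carrier (Gv v)" "P - arcs T" \<tau>
    by (rule normal_amalgam_FG) (use N arcs a LR in auto)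
  interpret W: group W by fact
  show ?thesis
    unfolding A.extends_to_def
  proof (intro allI impI)
    fix \<theta> \<theta>N s
    assume \<theta>: "\<forall>v\<in>verts \<Gamma>. \<theta> v \<in> hom (FG\<lparr>carrier := \<iota> v ` carrier (Gv v)\<rparr>) W \<and> (\<forall>n\<in>N. \<theta> v n = \<theta>N n)"
      and s: "\<forall>j\<in>P - arcs T. s j \<in> carrier W \<and>
        (\<forall>n\<in>N. s j \<otimes>\<^bsub>W\<^esub> \<theta>N (inv\<^bsub>FG\<^esub> \<tau> j \<otimes>\<^bsub>FG\<^esub> n \<otimes>\<^bsub>FG\<^esub> \<tau> j) = \<theta>N n \<otimes>\<^bsub>W\<^esub> s j)"
    define s' where "s' e = (if e \<in> arcs T then \<one>\<^bsub>W\<^esub> else s e)" for e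
    have \<theta>\<iota>: "(\<lambda>g. \<theta> v (\<iota> v g)) \<in> hom (Gv v) W" if v: "v \<in> verts \<Gamma>" for v
    proof -
      have "\<iota> v \<in> hom (Gv v) (FG\<lparr>carrier := \<iota> v ` carrier (Gv v)\<rparr>)" using \<iota>_iso[OF v] by (simp add: iso_def)
      from hom_compose[OF this] \<theta> v show ?thesis by (auto simp: comp_def)
    qed
    obtain \<Theta> where \<Theta>: "\<Theta> \<in> hom FG W"
      "\<And>v g. v \<in> verts \<Gamma> \<Longrightarrow> g \<in> carrier (Gv v) \<Longrightarrow> \<Theta> (\<iota> v g) = \<theta> v (\<iota> v g)"
      "\<And>e. e \<in> P \<Longrightarrow> \<Theta> (\<tau> e) = s' e"
    proof (rule FG_hom[OF \<open>group W\<close>, of "\<lambda>v g. \<theta> v (\<iota> v g)" s'])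
      show "s' e \<in> carrier W" if "e \<in> P" for e using s that by (simp add: s'_def)
      show "s' e = \<one>\<^bsub>W\<^esub>" if "e \<in> arcs T" for e using that by (simp add: s'_def)
      fix e x assume e: "e \<in> P" and x: "x \<in> carrier (Ge e)"
      have eA: "e \<in> arcs \<Gamma>" "bar e \<in> arcs \<Gamma>" using P_arcs e by auto
      let ?m = "\<iota> (head \<Gamma> e) (\<alpha> (bar e) x)" and ?n = "\<iota> (tail \<Gamma> e) (\<alpha> e x)"
      have n: "?n \<in> N" using a[OF eA(1)] x by blast
      have "\<iota> (head \<Gamma> e) ` \<alpha> (bar e) ` carrier (Ge e) = N" using a[OF eA(2)] eA by (simp add: Ge_bar)
      then have m: "?m \<in> N" using x by blast
      have mn: "\<tau> e \<otimes>\<^bsub>FG\<^esub> ?m \<otimes>\<^bsub>FG\<^esub> inv\<^bsub>FG\<^esub> \<tau> e = ?n" using e x by (rule stable_emb_conj)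
      have \<tau>: "\<tau> e \<in> carrier FG" using e by (rule stable_emb_closed)
      have "s' e \<otimes>\<^bsub>W\<^esub> \<theta>N ?m = \<theta>N ?n \<otimes>\<^bsub>W\<^esub> s' e"
      proof (cases "e \<in> arcs T")
        case True
        then have "?m = ?n" using mn stable_emb_tree[OF True e] A.mem_carrier[OF m] by simp
        moreover have "\<theta>N ?n \<in> carrier W"
        proof -
          have "?n \<in> \<iota> (tail \<Gamma> e) ` carrier (Gv (tail \<Gamma> e))" using \<alpha>_closed[OF eA(1) x] by blast
          moreover have hom: "\<theta> (tail \<Gamma> e) \<in> hom (FG\<lparr>carrier := \<iota> (tail \<Gamma> e) ` carrier (Gv (tail \<Gamma> e))\<rparr>) W"
            using \<theta> head_in_verts_P(2)[OF e] by blast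
          ultimately have "\<theta> (tail \<Gamma> e) ?n \<in> carrier W" using hom_in_carrier[OF hom, of ?n] by simp
          then show ?thesis using \<theta> head_in_verts_P(2)[OF e] n by simp
        qed
        ultimately show ?thesis using True by (simp add: s'_def)
      next
        case False
        have nm: "inv\<^bsub>FG\<^esub> \<tau> e \<otimes>\<^bsub>FG\<^esub> ?n \<otimes>\<^bsub>FG\<^esub> \<tau> e = ?m"
          unfolding mn[symmetric] using \<tau> A.mem_carrier[OF m] by (simp add: A.group_simps)
        have "s e \<otimes>\<^bsub>W\<^esub> \<theta>N (inv\<^bsub>FG\<^esub> \<tau> e \<otimes>\<^bsub>FG\<^esub> ?n \<otimes>\<^bsub>FG\<^esub> \<tau> e) = \<theta>N ?n \<otimes>\<^bsub>W\<^esub> s e"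
          using s e False n by blast
        then show ?thesis unfolding nm using False by (simp add: s'_def)
      qed
      then show "s' e \<otimes>\<^bsub>W\<^esub> \<theta> (head \<Gamma> e) ?m = \<theta> (tail \<Gamma> e) ?n \<otimes>\<^bsub>W\<^esub> s' e"
        using \<theta> head_in_verts_P[OF e] m n by simp
    qed (use \<theta>\<iota> in auto)
    then show "\<exists>\<Theta>\<in>hom FG W. (\<forall>v\<in>verts \<Gamma>. \<forall>u\<in>\<iota> v ` carrier (Gv v). \<Theta> u = \<theta> v u) \<and>
        (\<forall>j\<in>P - arcs T. \<Theta> (\<tau> j) = s j)"
      by (intro bexI[of _ \<Theta>]) (auto simp: s'_def)
  qed
qed

end

theorem proposition5p4:
  fixes \<Gamma> :: "('v, 'e) pre_digraph" and bar :: "'e \<Rightarrow> 'e"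
    and Gv :: "'v \<Rightarrow> 'a monoid" and Ge :: "'e \<Rightarrow> 'b monoid" and \<alpha> :: "'e \<Rightarrow> 'b \<Rightarrow> 'a"
    and T :: "('v, 'e) pre_digraph" and P :: "'e set"
    and G :: "('v, 'e, 'a) fg_gen word set monoid" and N :: "('v, 'e, 'a) fg_gen word set set"
  assumes "graph_of_groups \<Gamma> bar Gv Ge \<alpha>"
    and "maximal_tree \<Gamma> bar T"
    and "orientation \<Gamma> bar P"
    and "G = fundamental_group \<Gamma> bar Gv Ge \<alpha> T P"
    and "N \<lhd> G"
    and "fg_subgroup G N"
    and "virtually_abelian (G\<lparr>carrier := N\<rparr>)"
    and a: "\<And>e. e \<in> arcs \<Gamma> \<Longrightarrow>
        vertex_emb \<Gamma> bar Gv Ge \<alpha> T P (tail \<Gamma> e) ` \<alpha> e ` carrier (Ge e) = N"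
    and b: "\<And>v. v \<in> verts \<Gamma> \<Longrightarrow> property_LR (Gv v)"
    and c: "finite (to_Out G N ` carrier G)"
  shows "property_LR G"
proof -
  interpret fundamental_group_setup \<Gamma> bar Gv Ge \<alpha> T P
    using assms(1-3) by (simp add: fundamental_group_setup_def fundamental_group_setup_axioms_def)
  note [simp] = assms(4)
  show ?thesis
  proof (cases "arcs \<Gamma> = {}")
    case True
    then show ?thesis using property_LR_no_arcs b by simp
  next
    case False
    note N = assms(5)[unfolded assms(4)] assms(6)[unfolded assms(4)]
    interpret A: normal_amalgam N FG "verts \<Gamma>" "\<lambda>v. \<iota> v ` carrier (Gv v)" "P - arcs T" \<tau>
      using N False a b by (rule normal_amalgam_FG)
    have gN: "group (FG\<lparr>carrier := N\<rparr>)" using A.subgroup_imp_group[OF A.subgroup_axioms] .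
    have "property_LR FG"
    proof (rule A.property_LR_normal_amalgam)
      show "virtually_abelian (FG\<lparr>carrier := N\<rparr>)" "finite (to_Out FG N ` carrier FG)"
        using assms(7) c by simp_all
      fix n :: nat and H assume "subgroup H (FG Mod N)"
      then have "group ((FG Mod N)\<lparr>carrier := H\<rparr>)"
        using group.subgroup_imp_group[OF A.factorgroup_is_group] by blast
      then show "A.extends_to (wreath {..<n} ((FG Mod N)\<lparr>carrier := H\<rparr>))"
        by (intro extends_to_FG N False a b group_wreath)
    next
      show "A.extends_to (wreath I (FG\<lparr>carrier := N\<rparr>))" for I :: "((_ \<Rightarrow> _) set \<times> ('v \<Rightarrow> _)) set"
        using gN by (intro extends_to_FG N False a b group_wreath)
    qed
    then show ?thesis by simp
  qed
qed

end
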